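(* Let $r,k,n$ be positive integers. Equip $\mathsf{A}_{r,n}\otimes\mathsf{A}_{k,n}$ with the braided multiplication determined by the braiding operator $\Theta:\mathsf{A}_{k,n}\otimes\mathsf{A}_{r,n}\to\mathsf{A}_{r,n}\otimes\mathsf{A}_{k,n}$ and with the tensor product action of $\mathrm{U}_q(\mathfrak{q}_n)$. Then the $\mathbb{C}(q)$-linear map $$\sigma:\mathsf{A}_{r,n}\otimes\mathsf{A}_{k,n}\rightarrow\mathsf{A}_{r+k,n},\qquad x\otimes y\mapsto \iota_k(x)\iota_0(y),\quad x\in\mathsf{A}_{r,n},\ y\in\mathsf{A}_{k,n},$$ is an isomorphism of $\mathrm{U}_q(\mathfrak{q}_n)$-supermodule superalgebras. Here $\iota_k:\mathsf{A}_{r,n}\to\mathsf{A}_{r+k,n}$ is the superalgebra homomorphism with $t_{ia}\mapsto t_{k+i,a}$ ($1\le i\le r$, $a\in I_{n|n}$) and $\iota_0:\mathsf{A}_{k,n}\to\mathsf{A}_{r+k,n}$ is the superalgebra homomorphism with $t_{jb}\mapsto t_{jb}$ ($1\le j\le k$, $b\in I_{n|n}$).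
   Context: **Conventions.** The base field is $\mathbb{C}(q)$. Tensor products of superalgebras use the Koszul sign rule $(x\otimes y)(x'\otimes y')=(-1)^{|y||x'|}xx'\otimes yy'$. For $N\ge1$, $I_{N|N}=\{-N,\dots,-1,1,\dots,N\}$, with $|i|=\bar0$ if $i>0$ and $|i|=\bar1$ if $i<0$. Matrix units $E_{ij}$ (possibly rectangular) have parity $|i|+|j|$. $\delta_{a<b}$ is $1$ if $a<b$ and $0$ otherwise; $\xi=q-q^{-1}$; $\varphi(i,j)=(-1)^{|j|}(\delta_{ij}+\delta_{i,-j})$. $V_q$ is the superspace with basis $v_i$, $i\in I_{n|n}$, $|v_i|=|i|$, and $$S=\sum_{i,j\in I_{n|n}}q^{\varphi(i,j)}E_{ii}\otimes E_{jj}+\xi\sum_{i<j}(-1)^{|i|}(E_{ji}+E_{-j,-i})\otimes E_{ij}=\sum_{i,j}S_{ij}\otimes E_{ij}\in\mathrm{End}(V_q)^{\otimes2}.$$ Superscripts indicate tensor positions, and a bracketed position is the one occupied by entries in a superalgebra other than a matrix superalgebra, e.g. $T^{1[3]}=\sum E_{ia}\otimes1\otimes t_{ia}$. **$\mathrm{U}_q(\mathfrak{q}_n)$** is the unital associative superalgebra generated by $L_{ij}$ of parity $|i|+|j|$, $i,j\in I_{n|n}$, $i\le j$, with relations $L_{ii}L_{-i,-i}=1=L_{-i,-i}L_{ii}$ and $L^{[1]2}L^{[1]3}S^{23}=S^{23}L^{[1]3}L^{[1]2}$, where $L=\sum_{i\le j}L_{ij}\otimes E_{ij}$ (put $L_{ij}=0$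 for $i>j$). It is a Hopf superalgebra with $\Delta(L)=L\otimes L$, i.e. $\Delta(L_{ij})=\sum_k(-1)^{(|i|+|k|)(|k|+|j|)}L_{ik}\otimes L_{kj}$, $\varepsilon(L)=1$, antipode $L\mapsto L^{-1}$. A $\mathrm{U}_q(\mathfrak{q}_n)$-supermodule superalgebra is a unital associative superalgebra $B$ that is a $\mathrm{U}_q(\mathfrak{q}_n)$-supermodule with $u.(ab)=\sum_{(u)}(-1)^{|u_{(2)}||a|}(u_{(1)}.a)(u_{(2)}.b)$ and $u.1=\varepsilon(u)1$. **Quantum coordinate superalgebra $\mathsf{A}_{r,n}$.** Unital associative superalgebra generated by $t_{ia}$ of parity $|i|+|a|$, $i\in I_{r|r}$, $a\in I_{n|n}$, with relations $t_{ia}=t_{-i,-a}$ and $S^{12}T^{1[3]}T^{2[3]}=T^{2[3]}T^{1[3]}S^{12}$, where $T=\sum E_{ia}\otimes t_{ia}$ (the left $S$ is the matrix of the same form with indices in $I_{r|r}$). It is equivalently presented by generators $t_{ia}$, $1\le i\le r$, $a\in I_{n|n}$, with relations $$q^{\delta_{ij}}t_{ia}t_{jb}-(-1)^{|a||b|}q^{\varphi(a,b)}t_{jb}t_{ia}=\xi(\delta_{a<b}-\delta_{j<i})t_{ja}t_{ib}+(-1)^{|b|}\xi\,\delta_{-a<b}\,t_{j,-a}t_{i,-b}.$$ It is a $\mathrm{U}_q(\mathfrak{q}_n)$-supermodule superalgebra with action $\Phi$ determined by $L^{[2]3}\cdot_\Phi T^{1[2]}=T^{1[2]}S^{13}$,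 where $L^{[2]3}\cdot_\Phi T^{1[2]}:=\sum(-1)^{(|a|+|b|)(|i|+|c|)}E_{ic}\otimes\Phi_{L_{ab}}(t_{ic})\otimes E_{ab}$. **Braiding operator.** $\Theta:\mathsf{A}_{k,n}\otimes\mathsf{A}_{r,n}\to\mathsf{A}_{r,n}\otimes\mathsf{A}_{k,n}$ is the unique homomorphism of $\mathrm{U}_q(\mathfrak{q}_n)$-supermodules with $\Theta(1\otimes x)=x\otimes1$, $\Theta(y\otimes1)=1\otimes y$, $$\Theta(t_{jb}\otimes t_{ia})=(-1)^{|a||b|}q^{\varphi(b,a)}t_{ia}\otimes t_{jb}+\delta_{b<a}\xi\,t_{ib}\otimes t_{ja}+\delta_{-b<a}(-1)^{|a|}\xi\,t_{i,-b}\otimes t_{j,-a}$$ ($1\le i\le r$, $1\le j\le k$, $a,b\in I_{n|n}$), satisfying $\Theta\circ(1\otimes\mathrm{mul})=(\mathrm{mul}\otimes1)(1\otimes\Theta)(\Theta\otimes1)$ and $\Theta\circ(\mathrm{mul}\otimes1)=(1\otimes\mathrm{mul})(\Theta\otimes1)(1\otimes\Theta)$, where $\mathrm{mul}$ is multiplication. The braided multiplication on $\mathsf{A}_{r,n}\otimes\mathsf{A}_{k,n}$ is $(\mathrm{mul}\otimes\mathrm{mul})\circ(1\otimes\Theta\otimes1)$; with it $\mathsf{A}_{r,n}\otimes\mathsf{A}_{k,n}$ is a $\mathrm{U}_q(\mathfrak{q}_n)$-supermodule superalgebra. *)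

theory Defs
  imports
    "HOL-Algebra.QuotRing"
    "HOL-Algebra.Algebraic_Closure_Type"
    "HOL-Computational_Algebra.Fraction_Field"
    "HOL-Computational_Algebra.Polynomial"
    "HOL-Library.Poly_Mapping"
    "HOL-Library.Z2"
begin

section \<open>The base field\<close>

type_synonym Cq = "complex poly fract"

definition q :: Cq where
  "q = Fraction_Field.Fract [:0, 1:] 1"

definition xi :: Cq where
  "xi = q - inverse q"

abbreviation Cq_ring :: "Cq ring" where
  "Cq_ring \<equiv> ring_of_type_algebra"

text \<open>Parities are elements of the two-element field \<^typ>\<open>bit\<close>, so that exponents of signs can be
  added and multiplied; \<open>ksign d\<close> is the sign with exponent \<open>d\<close>.\<close>

definition ksign :: "bit \<Rightarrow> 'a::ring_1" where
  "ksign d = (if d = 0 then 1 else - 1)"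


section \<open>Superspaces and superalgebras over the base field\<close>

text \<open>\<open>homog A d\<close> is the homogeneous component of parity \<open>d\<close>.  The library's locale \<^locale>\<open>algebra\<close>
  is restricted to commutative algebras, hence the definition of \<open>superalgebra\<close> below.\<close>

record ('k, 'a) superalg = "('k, 'a) module" +
  homog :: "bit \<Rightarrow> 'a set"

type_synonym 'a Cq_superalg = "(Cq, 'a) superalg"

definition superspace :: "'a Cq_superalg \<Rightarrow> bool" where
  "superspace M \<longleftrightarrow> module Cq_ring M \<and> (\<forall>d. submodule (homog M d) Cq_ring M) \<and>
     (\<forall>x\<in>carrier M. \<exists>!(y, z). y \<in> homog M 0 \<and> z \<in> homog M 1 \<and> x = y \<oplus>\<^bsub>M\<^esub> z)"

definition superalgebra :: "'a Cq_superalg \<Rightarrow> bool" where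
  "superalgebra A \<longleftrightarrow> superspace A \<and> ring A \<and>
     (\<forall>c. \<forall>x\<in>carrier A. \<forall>y\<in>carrier A.
        (c \<odot>\<^bsub>A\<^esub> x) \<otimes>\<^bsub>A\<^esub> y = c \<odot>\<^bsub>A\<^esub> (x \<otimes>\<^bsub>A\<^esub> y) \<and> x \<otimes>\<^bsub>A\<^esub> (c \<odot>\<^bsub>A\<^esub> y) = c \<odot>\<^bsub>A\<^esub> (x \<otimes>\<^bsub>A\<^esub> y)) \<and>
     \<one>\<^bsub>A\<^esub> \<in> homog A 0 \<and>
     (\<forall>d e. \<forall>x\<in>homog A d. \<forall>y\<in>homog A e. x \<otimes>\<^bsub>A\<^esub> y \<in> homog A (d + e))"

definition even_linear_map :: "'a Cq_superalg \<Rightarrow> 'b Cq_superalg \<Rightarrow> ('a \<Rightarrow> 'b) \<Rightarrow> bool" where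
  "even_linear_map M N f \<longleftrightarrow> f \<in> carrier M \<rightarrow> carrier N \<and>
     (\<forall>x\<in>carrier M. \<forall>y\<in>carrier M. f (x \<oplus>\<^bsub>M\<^esub> y) = f x \<oplus>\<^bsub>N\<^esub> f y) \<and>
     (\<forall>c. \<forall>x\<in>carrier M. f (c \<odot>\<^bsub>M\<^esub> x) = c \<odot>\<^bsub>N\<^esub> f x) \<and>
     (\<forall>d. f ` homog M d \<subseteq> homog N d)"

definition superalgebra_hom :: "'a Cq_superalg \<Rightarrow> 'b Cq_superalg \<Rightarrow> ('a \<Rightarrow> 'b) \<Rightarrow> bool" where
  "superalgebra_hom A B f \<longleftrightarrow> f \<in> ring_hom A B \<and> even_linear_map A B f"

definition base_superalg :: "Cq Cq_superalg" where
  "base_superalg = \<lparr>carrier = UNIV, monoid.mult = (*), one = 1, zero = 0, add = (+), module.smult = (*),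
     homog = (\<lambda>d. if d = 0 then UNIV else {0})\<rparr>"

definition hcomp :: "'a Cq_superalg \<Rightarrow> bit \<Rightarrow> 'a \<Rightarrow> 'a" where
  "hcomp M d x = (THE y. y \<in> homog M d \<and> (\<exists>z\<in>homog M (d + 1). x = y \<oplus>\<^bsub>M\<^esub> z))"

text \<open>The linear operator that multiplies a homogeneous \<open>x\<close> by the sign with exponent \<open>d |x|\<close>, i.e.
  the sign produced by moving \<open>x\<close> past a homogeneous element of parity \<open>d\<close>.\<close>

definition koszul_twist :: "'a Cq_superalg \<Rightarrow> bit \<Rightarrow> 'a \<Rightarrow> 'a" where
  "koszul_twist M d x = hcomp M 0 x \<oplus>\<^bsub>M\<^esub> ksign d \<odot>\<^bsub>M\<^esub> hcomp M 1 x"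


section \<open>Tensor products\<close>

text \<open>The tensor product is the space of formal linear combinations of pairs modulo the bilinearity
  relations; its elements are cosets.\<close>

definition pscale :: "Cq \<Rightarrow> ('b \<Rightarrow>\<^sub>0 Cq) \<Rightarrow> ('b \<Rightarrow>\<^sub>0 Cq)" where
  "pscale c p = Poly_Mapping.map (\<lambda>x. c * x) p"

definition bilinear_relators :: "'a Cq_superalg \<Rightarrow> 'b Cq_superalg \<Rightarrow> ('a \<times> 'b \<Rightarrow>\<^sub>0 Cq) set" where
  "bilinear_relators A B =
     {Poly_Mapping.single (x \<oplus>\<^bsub>A\<^esub> x', y) 1 - Poly_Mapping.single (x, y) 1 - Poly_Mapping.single (x', y) 1
        | x x' y. x \<in> carrier A \<and> x' \<in> carrier A \<and> y \<in> carrier B} \<union>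
     {Poly_Mapping.single (x, y \<oplus>\<^bsub>B\<^esub> y') 1 - Poly_Mapping.single (x, y) 1 - Poly_Mapping.single (x, y') 1
        | x y y'. x \<in> carrier A \<and> y \<in> carrier B \<and> y' \<in> carrier B} \<union>
     {Poly_Mapping.single (c \<odot>\<^bsub>A\<^esub> x, y) 1 - Poly_Mapping.single (x, y) c
        | c x y. x \<in> carrier A \<and> y \<in> carrier B} \<union>
     {Poly_Mapping.single (x, c \<odot>\<^bsub>B\<^esub> y) 1 - Poly_Mapping.single (x, y) c
        | c x y. x \<in> carrier A \<and> y \<in> carrier B}"

definition tensor_class :: "'a Cq_superalg \<Rightarrow> 'b Cq_superalg \<Rightarrow> ('a \<times> 'b \<Rightarrow>\<^sub>0 Cq) \<Rightarrow> ('a \<times> 'b \<Rightarrow>\<^sub>0 Cq) set"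
  where "tensor_class A B p = (+) p ` Modules.module.span pscale (bilinear_relators A B)"

definition tens :: "'a Cq_superalg \<Rightarrow> 'b Cq_superalg \<Rightarrow> 'a \<Rightarrow> 'b \<Rightarrow> ('a \<times> 'b \<Rightarrow>\<^sub>0 Cq) set" where
  "tens A B x y = tensor_class A B (Poly_Mapping.single (x, y) 1)"

text \<open>The superspace underlying every algebra structure on the tensor product considered below.  The
  field \<^const>\<open>monoid.mult\<close> carries no information here; it is overwritten in \<open>tensor\<close> and
  \<open>braided_tensor\<close>.\<close>

definition tensor_space :: "'a Cq_superalg \<Rightarrow> 'b Cq_superalg \<Rightarrow> ('a \<times> 'b \<Rightarrow>\<^sub>0 Cq) set Cq_superalg" where
  "tensor_space A B =
     \<lparr>carrier = tensor_class A B ` {p. Poly_Mapping.keys p \<subseteq> carrier A \<times> carrier B},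
      monoid.mult = (\<lambda>_ _. undefined),
      one = tens A B \<one>\<^bsub>A\<^esub> \<one>\<^bsub>B\<^esub>,
      zero = tensor_class A B 0,
      add = (\<lambda>Z W. \<Union>z\<in>Z. \<Union>w\<in>W. tensor_class A B (z + w)),
      module.smult = (\<lambda>c Z. \<Union>z\<in>Z. tensor_class A B (pscale c z)),
      homog = (\<lambda>d. tensor_class A B `
        {p. Poly_Mapping.keys p \<subseteq> (\<Union>e. homog A e \<times> homog B (d - e))})\<rparr>"

text \<open>For a bilinear \<open>f\<close> with values in \<open>C\<close>, \<open>tensor_lift C f\<close> is the linear map with
  \<open>tens A B x y \<mapsto> f x y\<close>: it evaluates \<open>f\<close> on some representative of the coset.\<close>

definition tensor_lift :: "'c Cq_superalg \<Rightarrow> ('a \<Rightarrow> 'b \<Rightarrow> 'c) \<Rightarrow> ('a \<times> 'b \<Rightarrow>\<^sub>0 Cq) set \<Rightarrow> 'c" where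
  "tensor_lift C f Z = (let p = (SOME p. p \<in> Z) in
     \<Oplus>\<^bsub>C\<^esub>g\<in>Poly_Mapping.keys p. Poly_Mapping.lookup p g \<odot>\<^bsub>C\<^esub> f (fst g) (snd g))"

text \<open>The tensor product of superalgebras: \<open>(x \<otimes> y)(x' \<otimes> y')\<close> is \<open>xx' \<otimes> yy'\<close> with the sign of exponent
  \<open>|y||x'|\<close>; the sum runs over the homogeneous components of \<open>x'\<close>.\<close>

definition tensor :: "'a Cq_superalg \<Rightarrow> 'b Cq_superalg \<Rightarrow> ('a \<times> 'b \<Rightarrow>\<^sub>0 Cq) set Cq_superalg" where
  "tensor A B = (let T = tensor_space A B in T\<lparr>monoid.mult := \<lambda>Z W.
     tensor_lift T (\<lambda>x y. tensor_lift T (\<lambda>x' y'.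
       \<Oplus>\<^bsub>T\<^esub>d\<in>UNIV. tens A B (x \<otimes>\<^bsub>A\<^esub> hcomp A d x') (koszul_twist B d y \<otimes>\<^bsub>B\<^esub> y')) W) Z\<rparr>)"

text \<open>The multiplication \<open>(mul \<otimes> mul) \<circ> (1 \<otimes> \<Theta> \<otimes> 1)\<close> for \<open>\<Theta> : B \<otimes> A \<rightarrow> A \<otimes> B\<close>.\<close>

definition braided_tensor :: "'a Cq_superalg \<Rightarrow> 'b Cq_superalg
    \<Rightarrow> (('b \<times> 'a \<Rightarrow>\<^sub>0 Cq) set \<Rightarrow> ('a \<times> 'b \<Rightarrow>\<^sub>0 Cq) set) \<Rightarrow> ('a \<times> 'b \<Rightarrow>\<^sub>0 Cq) set Cq_superalg" where
  "braided_tensor A B \<Theta> = (let T = tensor_space A B in T\<lparr>monoid.mult := \<lambda>Z W.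
     tensor_lift T (\<lambda>x y. tensor_lift T (\<lambda>x' y'.
       tensor_lift T (\<lambda>x'' y''. tens A B (x \<otimes>\<^bsub>A\<^esub> x'') (y'' \<otimes>\<^bsub>B\<^esub> y')) (\<Theta> (tens B A y x'))) W) Z\<rparr>)"


section \<open>Supermodules and supermodule superalgebras\<close>

definition supermodule :: "'u Cq_superalg \<Rightarrow> 'a Cq_superalg \<Rightarrow> ('u \<Rightarrow> 'a \<Rightarrow> 'a) \<Rightarrow> bool" where
  "supermodule U M act \<longleftrightarrow> superspace M \<and>
     (\<forall>u\<in>carrier U. \<forall>x\<in>carrier M. act u x \<in> carrier M) \<and>
     (\<forall>u\<in>carrier U. \<forall>x\<in>carrier M. \<forall>y\<in>carrier M. act u (x \<oplus>\<^bsub>M\<^esub> y) = act u x \<oplus>\<^bsub>M\<^esub> act u y) \<and>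
     (\<forall>u\<in>carrier U. \<forall>v\<in>carrier U. \<forall>x\<in>carrier M. act (u \<oplus>\<^bsub>U\<^esub> v) x = act u x \<oplus>\<^bsub>M\<^esub> act v x) \<and>
     (\<forall>c. \<forall>u\<in>carrier U. \<forall>x\<in>carrier M.
        act u (c \<odot>\<^bsub>M\<^esub> x) = c \<odot>\<^bsub>M\<^esub> act u x \<and> act (c \<odot>\<^bsub>U\<^esub> u) x = c \<odot>\<^bsub>M\<^esub> act u x) \<and>
     (\<forall>x\<in>carrier M. act \<one>\<^bsub>U\<^esub> x = x) \<and>
     (\<forall>u\<in>carrier U. \<forall>v\<in>carrier U. \<forall>x\<in>carrier M. act (u \<otimes>\<^bsub>U\<^esub> v) x = act u (act v x)) \<and>
     (\<forall>d e. \<forall>u\<in>homog U d. \<forall>x\<in>homog M e. act u x \<in> homog M (d + e))"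

definition supermodule_hom :: "'u Cq_superalg \<Rightarrow> 'a Cq_superalg \<Rightarrow> ('u \<Rightarrow> 'a \<Rightarrow> 'a)
    \<Rightarrow> 'b Cq_superalg \<Rightarrow> ('u \<Rightarrow> 'b \<Rightarrow> 'b) \<Rightarrow> ('a \<Rightarrow> 'b) \<Rightarrow> bool" where
  "supermodule_hom U M actM N actN f \<longleftrightarrow> even_linear_map M N f \<and>
     (\<forall>u\<in>carrier U. \<forall>x\<in>carrier M. f (actM u x) = actN u (f x))"

text \<open>In Sweedler notation: \<open>u.(x \<otimes> y) = \<Sum> \<plusminus> u1.x \<otimes> u2.y\<close> with sign of exponent \<open>|u2||x|\<close>.\<close>

definition tensor_action :: "'u Cq_superalg \<Rightarrow> ('u \<Rightarrow> ('u \<times> 'u \<Rightarrow>\<^sub>0 Cq) set)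
    \<Rightarrow> 'a Cq_superalg \<Rightarrow> ('u \<Rightarrow> 'a \<Rightarrow> 'a) \<Rightarrow> 'b Cq_superalg \<Rightarrow> ('u \<Rightarrow> 'b \<Rightarrow> 'b)
    \<Rightarrow> 'u \<Rightarrow> ('a \<times> 'b \<Rightarrow>\<^sub>0 Cq) set \<Rightarrow> ('a \<times> 'b \<Rightarrow>\<^sub>0 Cq) set" where
  "tensor_action U \<Delta> A actA B actB u Z = (let T = tensor_space A B in
     tensor_lift T (\<lambda>x y. tensor_lift T (\<lambda>u1 u2.
       \<Oplus>\<^bsub>T\<^esub>d\<in>UNIV. tens A B (actA u1 (hcomp A d x)) (actB (koszul_twist U d u2) y)) (\<Delta> u)) Z)"

definition supermodule_superalgebra :: "'u Cq_superalg \<Rightarrow> ('u \<Rightarrow> ('u \<times> 'u \<Rightarrow>\<^sub>0 Cq) set) \<Rightarrow> ('u \<Rightarrow> Cq)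
    \<Rightarrow> 'a Cq_superalg \<Rightarrow> ('u \<Rightarrow> 'a \<Rightarrow> 'a) \<Rightarrow> bool" where
  "supermodule_superalgebra U \<Delta> \<epsilon> B act \<longleftrightarrow> superalgebra B \<and> supermodule U B act \<and>
     (\<forall>u\<in>carrier U. \<forall>d. \<forall>a\<in>homog B d. \<forall>b\<in>carrier B.
        act u (a \<otimes>\<^bsub>B\<^esub> b) =
          tensor_lift B (\<lambda>u1 u2. act u1 a \<otimes>\<^bsub>B\<^esub> act (koszul_twist U d u2) b) (\<Delta> u)) \<and>
     (\<forall>u\<in>carrier U. act u \<one>\<^bsub>B\<^esub> = \<epsilon> u \<odot>\<^bsub>B\<^esub> \<one>\<^bsub>B\<^esub>)"

definition supermodule_superalgebra_iso :: "'u Cq_superalg \<Rightarrow> ('u \<Rightarrow> ('u \<times> 'u \<Rightarrow>\<^sub>0 Cq) set) \<Rightarrow> ('u \<Rightarrow> Cq)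
    \<Rightarrow> 'a Cq_superalg \<Rightarrow> ('u \<Rightarrow> 'a \<Rightarrow> 'a) \<Rightarrow> 'b Cq_superalg \<Rightarrow> ('u \<Rightarrow> 'b \<Rightarrow> 'b) \<Rightarrow> ('a \<Rightarrow> 'b) \<Rightarrow> bool" where
  "supermodule_superalgebra_iso U \<Delta> \<epsilon> A actA B actB f \<longleftrightarrow>
     supermodule_superalgebra U \<Delta> \<epsilon> A actA \<and> supermodule_superalgebra U \<Delta> \<epsilon> B actB \<and>
     superalgebra_hom A B f \<and> supermodule_hom U A actA B actB f \<and>
     bij_betw f (carrier A) (carrier B)"


section \<open>Superalgebras given by generators and relations\<close>

text \<open>Words, with concatenation written additively: this makes \<open>'g free_monoid \<Rightarrow>\<^sub>0 Cq\<close> with the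
  library's convolution product the free associative algebra.\<close>

datatype 'g free_monoid = Word (letters: "'g list")

instantiation free_monoid :: (type) monoid_add
begin

definition zero_free_monoid :: "'a free_monoid" where
  "0 = Word []"

definition plus_free_monoid :: "'a free_monoid \<Rightarrow> 'a free_monoid \<Rightarrow> 'a free_monoid" where
  "v + w = Word (letters v @ letters w)"

instance
  by standard (simp_all add: zero_free_monoid_def plus_free_monoid_def)

end

type_synonym 'g free_alg = "'g free_monoid \<Rightarrow>\<^sub>0 Cq"

definition gen :: "'g \<Rightarrow> 'g free_alg" where
  "gen g = Poly_Mapping.single (Word [g]) 1"

definition scalar :: "Cq \<Rightarrow> 'g free_alg" where
  "scalar c = Poly_Mapping.single 0 c"

definition free_algebra :: "'g set \<Rightarrow> 'g free_alg ring" where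
  "free_algebra G = \<lparr>carrier = {p. \<forall>w\<in>Poly_Mapping.keys p. set (letters w) \<subseteq> G},
     monoid.mult = (*), one = 1, zero = 0, add = (+)\<rparr>"

definition pclass :: "'g set \<Rightarrow> 'g free_alg set \<Rightarrow> 'g free_alg \<Rightarrow> 'g free_alg set" where
  "pclass G R p = genideal (free_algebra G) R +>\<^bsub>free_algebra G\<^esub> p"

definition presented_superalg :: "'g set \<Rightarrow> ('g \<Rightarrow> bit) \<Rightarrow> 'g free_alg set \<Rightarrow> 'g free_alg set Cq_superalg" where
  "presented_superalg G par R =
     (let Q = free_algebra G Quot genideal (free_algebra G) R in
      \<lparr>carrier = carrier Q, monoid.mult = monoid.mult Q, one = one Q, zero = zero Q, add = add Q,
       module.smult = (\<lambda>c x. pclass G R (scalar c) \<otimes>\<^bsub>Q\<^esub> x),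
       homog = (\<lambda>d. pclass G R ` {p \<in> carrier (free_algebra G).
         \<forall>w\<in>Poly_Mapping.keys p. sum_list (map par (letters w)) = d})\<rparr>)"


section \<open>The matrix S and matrix relations\<close>

definition idx :: "nat \<Rightarrow> int set" where
  "idx n = {- int n..int n} - {0}"

definition ipar :: "int \<Rightarrow> bit" where
  "ipar i = (if i < 0 then 1 else 0)"

definition phi :: "int \<Rightarrow> int \<Rightarrow> int" where
  "phi i j = ksign (ipar j) * (of_bool (i = j) + of_bool (i = - j))"

text \<open>\<open>Smat a b c d\<close> is the coefficient of \<open>E\<^sub>a\<^sub>b \<otimes> E\<^sub>c\<^sub>d\<close> in S; it does not depend on the size of S.\<close>

definition Smat :: "int \<Rightarrow> int \<Rightarrow> int \<Rightarrow> int \<Rightarrow> Cq" where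
  "Smat a b c d =
     (if a = b \<and> c = d then q powi phi a c else 0) +
     (if c < d then xi * ksign (ipar c) * (of_bool (a = d \<and> b = c) + of_bool (a = - d \<and> b = - c)) else 0)"

text \<open>An element of the tensor product of two (rectangular) matrix superspaces and a superalgebra is
  given by its coefficients: \<open>M a b c d\<close> is the coefficient at \<open>E\<^sub>a\<^sub>b\<close> and \<open>E\<^sub>c\<^sub>d\<close>.  The product below obeys
  the Koszul rule for even elements, that is, when \<open>M a b c d\<close> has the same parity as
  \<open>E\<^sub>a\<^sub>b \<otimes> E\<^sub>c\<^sub>d\<close>, as is the case for \<open>S\<close>, \<open>T\<close> and \<open>L\<close>.  Under this assumption the sign is the
  same whether the superalgebra is the first or the last tensor factor: its exponent is
  \<open>|M a c b e| (|E\<^sub>c\<^sub>d| + |E\<^sub>e\<^sub>f|) + |E\<^sub>b\<^sub>e| |E\<^sub>c\<^sub>d|\<close>, respectively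
  \<open>(|E\<^sub>a\<^sub>c| + |E\<^sub>b\<^sub>e|) |M' c d e f| + |E\<^sub>b\<^sub>e| |E\<^sub>c\<^sub>d|\<close>.  \<open>I\<close> and \<open>J\<close> are the ranges of the
  summation indices in the first and in the second matrix factor.\<close>

definition mat_mult :: "int set \<Rightarrow> int set \<Rightarrow> (int \<Rightarrow> int \<Rightarrow> int \<Rightarrow> int \<Rightarrow> 'x::ring_1)
    \<Rightarrow> (int \<Rightarrow> int \<Rightarrow> int \<Rightarrow> int \<Rightarrow> 'x) \<Rightarrow> int \<Rightarrow> int \<Rightarrow> int \<Rightarrow> int \<Rightarrow> 'x" where
  "mat_mult I J M M' a d b f = (\<Sum>c\<in>I. \<Sum>e\<in>J.
     ksign ((ipar a + ipar c + ipar b + ipar e) * (ipar c + ipar d + ipar e + ipar f)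
            + (ipar b + ipar e) * (ipar c + ipar d)) * M a c b e * M' c d e f)"

definition Sfree :: "int \<Rightarrow> int \<Rightarrow> int \<Rightarrow> int \<Rightarrow> 'g free_alg" where
  "Sfree a b c d = scalar (Smat a b c d)"

definition slot1 :: "(int \<Rightarrow> int \<Rightarrow> 'x::zero) \<Rightarrow> int \<Rightarrow> int \<Rightarrow> int \<Rightarrow> int \<Rightarrow> 'x" where
  "slot1 M a b c d = (if c = d then M a b else 0)"

definition slot2 :: "(int \<Rightarrow> int \<Rightarrow> 'x::zero) \<Rightarrow> int \<Rightarrow> int \<Rightarrow> int \<Rightarrow> int \<Rightarrow> 'x" where
  "slot2 M a b c d = (if a = b then M c d else 0)"


section \<open>The quantum queer superalgebra\<close>

definition genpar :: "int \<times> int \<Rightarrow> bit" where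
  "genpar g = ipar (fst g) + ipar (snd g)"

definition Lfree :: "int \<Rightarrow> int \<Rightarrow> (int \<times> int) free_alg" where
  "Lfree i j = (if i \<le> j then gen (i, j) else 0)"

definition Uq_gens :: "nat \<Rightarrow> (int \<times> int) set" where
  "Uq_gens n = {(i, j). i \<in> idx n \<and> j \<in> idx n \<and> i \<le> j}"

definition Uq_rels :: "nat \<Rightarrow> (int \<times> int) free_alg set" where
  "Uq_rels n = (\<Union>i\<in>idx n. {Lfree i i * Lfree (- i) (- i) - 1, Lfree (- i) (- i) * Lfree i i - 1}) \<union>
     (let N = idx n in {mat_mult N N (mat_mult N N (slot1 Lfree) (slot2 Lfree)) Sfree a b c d
        - mat_mult N N Sfree (mat_mult N N (slot2 Lfree) (slot1 Lfree)) a b c d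
        | a b c d. a \<in> N \<and> b \<in> N \<and> c \<in> N \<and> d \<in> N})"

definition Uq :: "nat \<Rightarrow> (int \<times> int) free_alg set Cq_superalg" where
  "Uq n = presented_superalg (Uq_gens n) genpar (Uq_rels n)"

definition Uq_L :: "nat \<Rightarrow> int \<Rightarrow> int \<Rightarrow> (int \<times> int) free_alg set" where
  "Uq_L n i j = pclass (Uq_gens n) (Uq_rels n) (Lfree i j)"

definition Uq_coproduct :: "nat \<Rightarrow> ((int \<times> int) free_alg set
    \<Rightarrow> ((int \<times> int) free_alg set \<times> (int \<times> int) free_alg set \<Rightarrow>\<^sub>0 Cq) set) \<Rightarrow> bool" where
  "Uq_coproduct n \<Delta> \<longleftrightarrow> superalgebra_hom (Uq n) (tensor (Uq n) (Uq n)) \<Delta> \<and>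
     (\<forall>i\<in>idx n. \<forall>j\<in>idx n. i \<le> j \<longrightarrow> \<Delta> (Uq_L n i j) =
        (\<Oplus>\<^bsub>tensor (Uq n) (Uq n)\<^esub>k\<in>idx n. ksign ((ipar i + ipar k) * (ipar k + ipar j))
           \<odot>\<^bsub>tensor (Uq n) (Uq n)\<^esub> tens (Uq n) (Uq n) (Uq_L n i k) (Uq_L n k j)))"

definition Uq_counit :: "nat \<Rightarrow> ((int \<times> int) free_alg set \<Rightarrow> Cq) \<Rightarrow> bool" where
  "Uq_counit n \<epsilon> \<longleftrightarrow> superalgebra_hom (Uq n) base_superalg \<epsilon> \<and>
     (\<forall>i\<in>idx n. \<forall>j\<in>idx n. i \<le> j \<longrightarrow> \<epsilon> (Uq_L n i j) = of_bool (i = j))"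


section \<open>Quantum coordinate superalgebras\<close>

definition tfree :: "int \<Rightarrow> int \<Rightarrow> (int \<times> int) free_alg" where
  "tfree i a = gen (i, a)"

definition qcoord_gens :: "nat \<Rightarrow> nat \<Rightarrow> (int \<times> int) set" where
  "qcoord_gens r n = idx r \<times> idx n"

text \<open>The matrix \<open>T\<close> is rectangular, so in \<open>S T\<^sup>1 T\<^sup>2\<close> the two intermediate indices of the last
  product range over \<open>idx n\<close> and \<open>idx r\<close>, and similarly for \<open>T\<^sup>2 T\<^sup>1 S\<close>.\<close>

definition qcoord_rels :: "nat \<Rightarrow> nat \<Rightarrow> (int \<times> int) free_alg set" where
  "qcoord_rels r n = (let R = idx r; N = idx n in
     {tfree i a - tfree (- i) (- a) | i a. i \<in> R \<and> a \<in> N} \<union>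
     {mat_mult N R (mat_mult R R Sfree (slot1 tfree)) (slot2 tfree) i a j b
        - mat_mult N N (mat_mult R N (slot2 tfree) (slot1 tfree)) Sfree i a j b
        | i a j b. i \<in> R \<and> a \<in> N \<and> j \<in> R \<and> b \<in> N})"

definition qcoord :: "nat \<Rightarrow> nat \<Rightarrow> (int \<times> int) free_alg set Cq_superalg" where
  "qcoord r n = presented_superalg (qcoord_gens r n) genpar (qcoord_rels r n)"

definition qcoord_t :: "nat \<Rightarrow> nat \<Rightarrow> int \<Rightarrow> int \<Rightarrow> (int \<times> int) free_alg set" where
  "qcoord_t r n i a = pclass (qcoord_gens r n) (qcoord_rels r n) (tfree i a)"

text \<open>The second conjunct is the equality of the coefficients of \<open>E\<^sub>i\<^sub>c \<otimes> _ \<otimes> E\<^sub>a\<^sub>b\<close> in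
  \<open>L \<cdot> T = T S\<close>, with \<open>L\<close> in position [2]3, \<open>T\<close> in position 1[2] and \<open>S\<close> in position 13; the sign
  on the right comes from moving \<open>t\<^sub>i\<^sub>e\<close> past \<open>E\<^sub>e\<^sub>c\<close>.\<close>

definition qcoord_action :: "nat \<Rightarrow> nat
    \<Rightarrow> ((int \<times> int) free_alg set \<Rightarrow> ((int \<times> int) free_alg set \<times> (int \<times> int) free_alg set \<Rightarrow>\<^sub>0 Cq) set)
    \<Rightarrow> ((int \<times> int) free_alg set \<Rightarrow> Cq)
    \<Rightarrow> ((int \<times> int) free_alg set \<Rightarrow> (int \<times> int) free_alg set \<Rightarrow> (int \<times> int) free_alg set) \<Rightarrow> bool" where
  "qcoord_action r n \<Delta> \<epsilon> \<Phi> \<longleftrightarrow> supermodule_superalgebra (Uq n) \<Delta> \<epsilon> (qcoord r n) \<Phi> \<and>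
     (\<forall>i\<in>idx r. \<forall>c\<in>idx n. \<forall>a\<in>idx n. \<forall>b\<in>idx n.
        ksign ((ipar a + ipar b) * (ipar i + ipar c)) \<odot>\<^bsub>qcoord r n\<^esub> \<Phi> (Uq_L n a b) (qcoord_t r n i c) =
        (\<Oplus>\<^bsub>qcoord r n\<^esub>e\<in>idx n.
           (ksign ((ipar i + ipar e) * (ipar e + ipar c)) * Smat e c a b) \<odot>\<^bsub>qcoord r n\<^esub> qcoord_t r n i e))"


section \<open>The braiding operator\<close>

text \<open>The last two conjuncts are \<open>\<Theta> \<circ> (1 \<otimes> mul) = (mul \<otimes> 1)(1 \<otimes> \<Theta>)(\<Theta> \<otimes> 1)\<close> and
  \<open>\<Theta> \<circ> (mul \<otimes> 1) = (1 \<otimes> mul)(\<Theta> \<otimes> 1)(1 \<otimes> \<Theta>)\<close>, evaluated at \<open>y \<otimes> x \<otimes> x'\<close> and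
  \<open>y \<otimes> y' \<otimes> x\<close>.\<close>

definition braiding_operator :: "nat \<Rightarrow> nat \<Rightarrow> nat
    \<Rightarrow> ((int \<times> int) free_alg set \<Rightarrow> ((int \<times> int) free_alg set \<times> (int \<times> int) free_alg set \<Rightarrow>\<^sub>0 Cq) set)
    \<Rightarrow> ((int \<times> int) free_alg set \<Rightarrow> (int \<times> int) free_alg set \<Rightarrow> (int \<times> int) free_alg set)
    \<Rightarrow> ((int \<times> int) free_alg set \<Rightarrow> (int \<times> int) free_alg set \<Rightarrow> (int \<times> int) free_alg set)
    \<Rightarrow> (((int \<times> int) free_alg set \<times> (int \<times> int) free_alg set \<Rightarrow>\<^sub>0 Cq) set
         \<Rightarrow> ((int \<times> int) free_alg set \<times> (int \<times> int) free_alg set \<Rightarrow>\<^sub>0 Cq) set) \<Rightarrow> bool" where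
  "braiding_operator r k n \<Delta> \<Phi>r \<Phi>k \<Theta> \<longleftrightarrow>
    (let A = qcoord r n; B = qcoord k n; T = tensor A B in
     supermodule_hom (Uq n) (tensor B A) (tensor_action (Uq n) \<Delta> B \<Phi>k A \<Phi>r)
       T (tensor_action (Uq n) \<Delta> A \<Phi>r B \<Phi>k) \<Theta> \<and>
     (\<forall>x\<in>carrier A. \<Theta> (tens B A \<one>\<^bsub>B\<^esub> x) = tens A B x \<one>\<^bsub>B\<^esub>) \<and>
     (\<forall>y\<in>carrier B. \<Theta> (tens B A y \<one>\<^bsub>A\<^esub>) = tens A B \<one>\<^bsub>A\<^esub> y) \<and>
     (\<forall>i\<in>{1..int r}. \<forall>j\<in>{1..int k}. \<forall>a\<in>idx n. \<forall>b\<in>idx n.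
        \<Theta> (tens B A (qcoord_t k n j b) (qcoord_t r n i a)) =
          (ksign (ipar a * ipar b) * q powi phi b a) \<odot>\<^bsub>T\<^esub> tens A B (qcoord_t r n i a) (qcoord_t k n j b)
          \<oplus>\<^bsub>T\<^esub> (of_bool (b < a) * xi) \<odot>\<^bsub>T\<^esub> tens A B (qcoord_t r n i b) (qcoord_t k n j a)
          \<oplus>\<^bsub>T\<^esub> (of_bool (- b < a) * ksign (ipar a) * xi) \<odot>\<^bsub>T\<^esub>
                tens A B (qcoord_t r n i (- b)) (qcoord_t k n j (- a))) \<and>
     (\<forall>y\<in>carrier B. \<forall>x\<in>carrier A. \<forall>x'\<in>carrier A.
        \<Theta> (tens B A y (x \<otimes>\<^bsub>A\<^esub> x')) =
          tensor_lift T (\<lambda>x1 y1. tensor_lift T (\<lambda>x2 y2. tens A B (x1 \<otimes>\<^bsub>A\<^esub> x2) y2)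
            (\<Theta> (tens B A y1 x'))) (\<Theta> (tens B A y x))) \<and>
     (\<forall>y\<in>carrier B. \<forall>y'\<in>carrier B. \<forall>x\<in>carrier A.
        \<Theta> (tens B A (y \<otimes>\<^bsub>B\<^esub> y') x) =
          tensor_lift T (\<lambda>x1 y1. tensor_lift T (\<lambda>x2 y2. tens A B x2 (y2 \<otimes>\<^bsub>B\<^esub> y1))
            (\<Theta> (tens B A y x1))) (\<Theta> (tens B A y' x))))"


section \<open>The map sigma\<close>

text \<open>The superalgebra homomorphism from \<open>qcoord m n\<close> to \<open>qcoord m' n\<close> that shifts the positive row
  indices by \<open>s\<close>.  It is made unique as a HOL function by fixing its values outside the carrier.\<close>

definition iota :: "nat \<Rightarrow> nat \<Rightarrow> nat \<Rightarrow> nat \<Rightarrow> (int \<times> int) free_alg set \<Rightarrow> (int \<times> int) free_alg set" where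
  "iota n m m' s = (THE f. f \<in> extensional (carrier (qcoord m n)) \<and>
     superalgebra_hom (qcoord m n) (qcoord m' n) f \<and>
     (\<forall>i\<in>{1..int m}. \<forall>a\<in>idx n. f (qcoord_t m n i a) = qcoord_t m' n (int s + i) a))"

definition sigma :: "nat \<Rightarrow> nat \<Rightarrow> nat
    \<Rightarrow> ((int \<times> int) free_alg set \<times> (int \<times> int) free_alg set \<Rightarrow>\<^sub>0 Cq) set \<Rightarrow> (int \<times> int) free_alg set" where
  "sigma r k n = tensor_lift (qcoord (r + k) n)
     (\<lambda>x y. iota n r (r + k) k x \<otimes>\<^bsub>qcoord (r + k) n\<^esub> iota n k (r + k) 0 y)"

end

theory Submission
  imports Defs
begin

text \<open>The braided multiplication need not be shown associative directly: once \<open>\<sigma>\<close> is a bijection that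
  respects the products and the actions, all structure of the braided tensor product is transported
  from \<open>A\<^bsub>r+k,n\<^esub>\<close>.

  By induction on words, the hexagon identities reduce \<open>\<sigma> (\<Theta> (y \<otimes> x)) = \<iota>\<^sub>0 y * \<iota>\<^sub>k x\<close> to generators, where it
  is a defining relation of \<open>A\<^bsub>r+k,n\<^esub>\<close>.  Hence \<open>\<sigma>\<close> is multiplicative, and its image is a subalgebra
  containing all generators.  For injectivity, let \<open>A\<^bsub>r,n\<^esub>\<close> act on \<open>A\<^bsub>r,n\<^esub> \<otimes> A\<^bsub>k,n\<^esub>\<close> by left multiplication and
  \<open>A\<^bsub>k,n\<^esub>\<close> by \<open>y . (x \<otimes> w) = \<Theta> (y \<otimes> x) (1 \<otimes> w)\<close>.  The hexagon identities and the formula for \<open>\<Theta>\<close> on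
  generators say that these two actions combine to a representation \<open>\<rho>\<close> of \<open>A\<^bsub>r+k,n\<^esub>\<close>, and
  \<open>z \<mapsto> \<rho> z (1 \<otimes> 1)\<close> is a left inverse of \<open>\<sigma>\<close>.  Equivariance follows from that of \<open>\<iota>\<^sub>0\<close> and \<open>\<iota>\<^sub>k\<close>, again
  checked on generators.\<close>

section \<open>Modules over the base field\<close>

text \<open>A presented algebra can be mapped only into something already known to be an associative
  algebra, and for the braided product this is one of the conclusions. Composition of operators is
  associative at no cost, which is why \<open>\<rho>\<close> takes values in
  \<open>End_alg T\<close>. The relations of the coordinate superalgebras range over all rows,
  negative ones included, while the braiding is prescribed on positive rows only; the symmetry of
  the generators under negating both indices bridges the two, and the relations between the two
  blocks of rows reduce to a finite comparison of coefficients. \<open>tensor_lift\<close> evaluates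
  on a chosen representative: it is linear once bilinearity has been checked, but it commutes with
  linear maps for every carrier-valued integrand. The gradings of the coordinate superalgebras are
  contained in the assumed actions, that of \<open>Uq n\<close> is derived from homogeneity of its
  relations, and directness of the grading on the tensor product is read off from
  \<open>\<sigma>\<close>. Linearity is kept apart from parity because multiplication by an odd
  element, or its action, is not an even map.\<close>

definition linear_on :: "'a Cq_superalg \<Rightarrow> 'b Cq_superalg \<Rightarrow> ('a \<Rightarrow> 'b) \<Rightarrow> bool" where
  "linear_on M N f \<longleftrightarrow> f \<in> carrier M \<rightarrow> carrier N \<and>
     (\<forall>x\<in>carrier M. \<forall>y\<in>carrier M. f (x \<oplus>\<^bsub>M\<^esub> y) = f x \<oplus>\<^bsub>N\<^esub> f y) \<and>
     (\<forall>c. \<forall>x\<in>carrier M. f (c \<odot>\<^bsub>M\<^esub> x) = c \<odot>\<^bsub>N\<^esub> f x)"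

lemma linear_onI:
  assumes "\<And>x. x \<in> carrier M \<Longrightarrow> f x \<in> carrier N"
    and "\<And>x y. x \<in> carrier M \<Longrightarrow> y \<in> carrier M \<Longrightarrow> f (x \<oplus>\<^bsub>M\<^esub> y) = f x \<oplus>\<^bsub>N\<^esub> f y"
    and "\<And>c x. x \<in> carrier M \<Longrightarrow> f (c \<odot>\<^bsub>M\<^esub> x) = c \<odot>\<^bsub>N\<^esub> f x"
  shows "linear_on M N f"
  using assms by (auto simp: linear_on_def)

lemma linear_on_closed: "linear_on M N f \<Longrightarrow> x \<in> carrier M \<Longrightarrow> f x \<in> carrier N"
  and linear_on_add:
    "linear_on M N f \<Longrightarrow> x \<in> carrier M \<Longrightarrow> y \<in> carrier M \<Longrightarrow> f (x \<oplus>\<^bsub>M\<^esub> y) = f x \<oplus>\<^bsub>N\<^esub> f y"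
  and linear_on_smult: "linear_on M N f \<Longrightarrow> x \<in> carrier M \<Longrightarrow> f (c \<odot>\<^bsub>M\<^esub> x) = c \<odot>\<^bsub>N\<^esub> f x"
  by (auto simp: linear_on_def)

lemma even_linear_map_iff:
  "even_linear_map M N f \<longleftrightarrow> linear_on M N f \<and> (\<forall>d. f ` homog M d \<subseteq> homog N d)"
  by (auto simp: even_linear_map_def linear_on_def)

lemma linear_on_compose: "linear_on M N f \<Longrightarrow> linear_on N K g \<Longrightarrow> linear_on M K (\<lambda>x. g (f x))"
  by (auto simp: linear_on_def Pi_iff)

text \<open>The common core of \<open>tensor_lift\<close> and of the evaluation of noncommutative
  polynomials: both extend a function linearly from basis symbols to formal combinations, so one
  calculus serves both.\<close>

definition linear_ext :: "'b Cq_superalg \<Rightarrow> ('g \<Rightarrow> 'b) \<Rightarrow> ('g \<Rightarrow>\<^sub>0 Cq) \<Rightarrow> 'b" where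
  "linear_ext M f p = (\<Oplus>\<^bsub>M\<^esub>g\<in>Poly_Mapping.keys p. Poly_Mapping.lookup p g \<odot>\<^bsub>M\<^esub> f g)"

lemma keys_pscale: "Poly_Mapping.keys (pscale c p) \<subseteq> Poly_Mapping.keys p"
  by (auto simp: pscale_def in_keys_iff Poly_Mapping.map.rep_eq when_def split: if_splits)

lemma lookup_pscale [simp]: "Poly_Mapping.lookup (pscale c p) g = c * Poly_Mapping.lookup p g"
  by (simp add: pscale_def Poly_Mapping.map.rep_eq when_def)

text \<open>Identifies the span inside \<open>tensor_class\<close> with a span in a genuine vector
  space, so that closure and minimality of spans become available.\<close>

interpretation PS: vector_space "pscale :: Cq \<Rightarrow> ('b \<Rightarrow>\<^sub>0 Cq) \<Rightarrow> _"
  by standard (auto intro!: poly_mapping_eqI simp: lookup_add algebra_simps)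

lemma subspace_keys: "PS.subspace {p. Poly_Mapping.keys p \<subseteq> U}"
proof -
  have "Poly_Mapping.keys (p + q) \<subseteq> U" if "Poly_Mapping.keys p \<subseteq> U" "Poly_Mapping.keys q \<subseteq> U"
    for p q :: "'a \<Rightarrow>\<^sub>0 Cq"
    using keys_add[of p q] that by blast
  then show ?thesis
    using keys_pscale by (fastforce simp: PS.subspace_def)
qed

text \<open>Splits off one monomial at a time. The bound \<open>U\<close> on the support is carried
  along so that every partial sum consists of admissible symbols, which the \<open>add\<close> case
  may then assume of both summands.\<close>

lemma poly_mapping_single_induct [consumes 1, case_names zero single add]:
  assumes "Poly_Mapping.keys p \<subseteq> U"
    and "P 0" and "\<And>g c. g \<in> U \<Longrightarrow> P (Poly_Mapping.single g c)"
    and "\<And>p q. Poly_Mapping.keys p \<subseteq> U \<Longrightarrow> Poly_Mapping.keys q \<subseteq> U \<Longrightarrow> P p \<Longrightarrow> P q \<Longrightarrow> P (p + q)"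
  shows "P (p :: 'b \<Rightarrow>\<^sub>0 'c::comm_monoid_add)"
proof -
  have "finite S \<Longrightarrow> S \<subseteq> U \<Longrightarrow> P (\<Sum>g\<in>S. Poly_Mapping.single g (Poly_Mapping.lookup p g)) \<and>
    Poly_Mapping.keys (\<Sum>g\<in>S. Poly_Mapping.single g (Poly_Mapping.lookup p g)) \<subseteq> U" for S
  proof (induction S rule: finite_induct)
    case (insert g S)
    let ?a = "Poly_Mapping.single g (Poly_Mapping.lookup p g)"
    let ?b = "\<Sum>g\<in>S. Poly_Mapping.single g (Poly_Mapping.lookup p g)"
    have "Poly_Mapping.keys ?a \<subseteq> U" using insert by auto
    moreover have "Poly_Mapping.keys (?a + ?b) \<subseteq> U"
      using keys_add[of ?a ?b] insert \<open>Poly_Mapping.keys ?a \<subseteq> U\<close> by blast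
    ultimately show ?case using insert assms(3,4) by auto
  qed (use assms(2) in auto)
  moreover have "p = (\<Sum>g\<in>Poly_Mapping.keys p. Poly_Mapping.single g (Poly_Mapping.lookup p g))"
    by (rule poly_mapping_eqI)
      (auto simp: lookup_sum lookup_single when_def in_keys_iff sum.delta)
  ultimately show ?thesis using assms(1) by (metis finite_keys)
qed

lemma Cq_ring_simps [simp]:
  "carrier (ring_of_type_algebra :: 'a ring) = (UNIV :: 'a::ring_1 set)"
  "monoid.mult (ring_of_type_algebra :: 'a ring) = (*)"
  "monoid.one (ring_of_type_algebra :: 'a ring) = 1"
  "ring.zero (ring_of_type_algebra :: 'a ring) = 0"
  "ring.add (ring_of_type_algebra :: 'a ring) = (+)"
  by (simp_all add: ring_of_type_algebra_def)

section \<open>Calculus of linear combinations in a module over the base field\<close>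

locale cmod =
  fixes M :: "'a Cq_superalg" (structure)
  assumes is_module: "module Cq_ring M"
begin

sublocale abelian_group M
  using is_module by (rule module.axioms)

lemma smult_closed [simp, intro]: "x \<in> carrier M \<Longrightarrow> c \<odot> x \<in> carrier M"
  using module.smult_closed[OF is_module, of c x] by simp

lemma smult_add_left: "x \<in> carrier M \<Longrightarrow> (c + d) \<odot> x = c \<odot> x \<oplus> d \<odot> x"
  using module.smult_l_distr[OF is_module, of c d x] by simp

lemma smult_add_right: "x \<in> carrier M \<Longrightarrow> y \<in> carrier M \<Longrightarrow> c \<odot> (x \<oplus> y) = c \<odot> x \<oplus> c \<odot> y"
  using module.smult_r_distr[OF is_module, of c x y] by simp

lemma smult_smult: "x \<in> carrier M \<Longrightarrow> c \<odot> (d \<odot> x) = (c * d) \<odot> x"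
  using module.smult_assoc1[OF is_module, of c d x] by simp

lemma smult_one [simp]: "x \<in> carrier M \<Longrightarrow> 1 \<odot> x = x"
  using module.smult_one[OF is_module, of x] by simp

lemma smult_zero_left [simp]: "x \<in> carrier M \<Longrightarrow> 0 \<odot> x = \<zero>"
  using module.smult_l_null[OF is_module, of x] by simp

lemma smult_zero_right [simp]: "c \<odot> \<zero> = \<zero>"
  using module.smult_r_null[OF is_module, of c] by simp

lemma smult_minus_one: "x \<in> carrier M \<Longrightarrow> (- 1) \<odot> x = \<ominus> x"
proof -
  assume x: "x \<in> carrier M"
  have "x \<oplus> (- 1) \<odot> x = \<zero>" using smult_add_left[OF x, of 1 "-1"] x by simp
  then show ?thesis using x by (metis add.inv_equality add.m_comm smult_closed)
qed

lemma smult_cancel: "x \<in> carrier M \<Longrightarrow> y \<in> carrier M \<Longrightarrow> c \<noteq> 0 \<Longrightarrow> c \<odot> x = c \<odot> y \<Longrightarrow> x = y"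
  by (metis smult_smult smult_one left_inverse)

lemma smult_finsum: "f \<in> S \<rightarrow> carrier M \<Longrightarrow> c \<odot> finsum M f S = (\<Oplus>i\<in>S. c \<odot> f i)"
  by (induction S rule: infinite_finite_induct) (auto simp: smult_add_right Pi_iff)

text \<open>Symbols outside the support contribute zero. Hence \<open>p\<close>, \<open>r\<close>
  and \<open>p + r\<close> can be summed over one index set although cancellation may shrink the
  support of the sum.\<close>

lemma linear_ext_superset:
  assumes "finite S" "Poly_Mapping.keys p \<subseteq> S" "f \<in> S \<rightarrow> carrier M"
  shows "linear_ext M f p = (\<Oplus>g\<in>S. Poly_Mapping.lookup p g \<odot> f g)"
  unfolding linear_ext_def using assms
  by (intro add.finprod_mono_neutral_cong_left) (auto simp: in_keys_iff Pi_iff)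

lemma linear_ext_closed [intro]: "f \<in> Poly_Mapping.keys p \<rightarrow> carrier M \<Longrightarrow> linear_ext M f p \<in> carrier M"
  unfolding linear_ext_def by (intro finsum_closed) auto

lemma linear_ext_zero [simp]: "linear_ext M f 0 = \<zero>"
  by (simp add: linear_ext_def)

lemma linear_ext_add:
  assumes "f \<in> Poly_Mapping.keys p \<rightarrow> carrier M" "f \<in> Poly_Mapping.keys r \<rightarrow> carrier M"
  shows "linear_ext M f (p + r) = linear_ext M f p \<oplus> linear_ext M f r"
proof -
  let ?S = "Poly_Mapping.keys p \<union> Poly_Mapping.keys r"
  have f: "f \<in> ?S \<rightarrow> carrier M" using assms by auto
  then have "linear_ext M f (p + r) = (\<Oplus>g\<in>?S. Poly_Mapping.lookup (p + r) g \<odot> f g)"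
    using keys_add[of p r] by (intro linear_ext_superset) auto
  also have "\<dots> = (\<Oplus>g\<in>?S. Poly_Mapping.lookup p g \<odot> f g \<oplus> Poly_Mapping.lookup r g \<odot> f g)"
    using f by (intro finsum_cong') (auto simp: lookup_add smult_add_left Pi_iff)
  also have "\<dots> = linear_ext M f p \<oplus> linear_ext M f r"
    using f by (subst finsum_addf) (auto simp: linear_ext_superset[of ?S] Pi_iff)
  finally show ?thesis .
qed

lemma linear_ext_single [simp]: "f g \<in> carrier M \<Longrightarrow> linear_ext M f (Poly_Mapping.single g c) = c \<odot> f g"
  by (subst linear_ext_superset[of "{g}"]) (auto simp: finsum_insert[of "{}"])

lemma linear_ext_pscale:
  assumes "f \<in> Poly_Mapping.keys p \<rightarrow> carrier M"
  shows "linear_ext M f (pscale c p) = c \<odot> linear_ext M f p"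
  using assms keys_pscale[of c p]
  by (subst linear_ext_superset[of "Poly_Mapping.keys p"])
    (auto simp: linear_ext_def smult_finsum smult_smult Pi_iff intro!: finsum_cong')

lemma linear_ext_cong:
  assumes "\<And>g. g \<in> Poly_Mapping.keys p \<Longrightarrow> f g = h g" "h \<in> Poly_Mapping.keys p \<rightarrow> carrier M"
  shows "linear_ext M f p = linear_ext M h p"
  unfolding linear_ext_def using assms by (intro finsum_cong') (auto simp: Pi_iff)

lemma linear_ext_fun_add:
  assumes "f \<in> Poly_Mapping.keys p \<rightarrow> carrier M" "h \<in> Poly_Mapping.keys p \<rightarrow> carrier M"
  shows "linear_ext M (\<lambda>g. f g \<oplus> h g) p = linear_ext M f p \<oplus> linear_ext M h p"
proof -
  have "linear_ext M (\<lambda>g. f g \<oplus> h g) p =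
      (\<Oplus>g\<in>Poly_Mapping.keys p. Poly_Mapping.lookup p g \<odot> f g \<oplus> Poly_Mapping.lookup p g \<odot> h g)"
    unfolding linear_ext_def using assms by (intro finsum_cong') (auto simp: smult_add_right Pi_iff)
  then show ?thesis
    using assms by (simp add: linear_ext_def finsum_addf Pi_iff)
qed

lemma linear_ext_fun_smult:
  assumes "f \<in> Poly_Mapping.keys p \<rightarrow> carrier M"
  shows "linear_ext M (\<lambda>g. c \<odot> f g) p = c \<odot> linear_ext M f p"
  unfolding linear_ext_def using assms
  by (subst smult_finsum) (auto simp: smult_smult Pi_iff mult.commute intro!: finsum_cong')

end

lemma linear_on_zero:
  assumes "cmod M" "cmod N" "linear_on M N f"
  shows "f \<zero>\<^bsub>M\<^esub> = \<zero>\<^bsub>N\<^esub>"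
proof -
  interpret M: cmod M by fact
  interpret N: cmod N by fact
  have "f (0 \<odot>\<^bsub>M\<^esub> \<zero>\<^bsub>M\<^esub>) = 0 \<odot>\<^bsub>N\<^esub> f \<zero>\<^bsub>M\<^esub>"
    using assms(3) M.zero_closed by (rule linear_on_smult)
  then show ?thesis using linear_on_closed[OF assms(3) M.zero_closed] by simp
qed

lemma linear_on_finsum:
  assumes "cmod M" "cmod N" "linear_on M N f" "h \<in> S \<rightarrow> carrier M"
  shows "f (finsum M h S) = (\<Oplus>\<^bsub>N\<^esub>i\<in>S. f (h i))"
proof -
  interpret M: cmod M by fact
  interpret N: cmod N by fact
  from assms(4) show ?thesis
    by (induction S rule: infinite_finite_induct)
      (auto simp: linear_on_zero[OF assms(1-3)] linear_on_add[OF assms(3)] linear_on_closed[OF assms(3)] Pi_iff)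
qed

lemma linear_on_linear_ext:
  assumes "cmod M" "cmod N" "linear_on M N h" "f \<in> Poly_Mapping.keys p \<rightarrow> carrier M"
  shows "h (linear_ext M f p) = linear_ext N (\<lambda>g. h (f g)) p"
proof -
  interpret M: cmod M by fact
  interpret N: cmod N by fact
  show ?thesis
    unfolding linear_ext_def using assms(4)
    by (subst linear_on_finsum[OF assms(1-3)])
      (auto simp: linear_on_smult[OF assms(3)] linear_on_closed[OF assms(3)] Pi_iff intro!: N.finsum_cong')
qed


section \<open>Tensor products\<close>

definition bilinear_on :: "'a Cq_superalg \<Rightarrow> 'b Cq_superalg \<Rightarrow> 'c Cq_superalg \<Rightarrow> ('a \<Rightarrow> 'b \<Rightarrow> 'c) \<Rightarrow> bool" where
  "bilinear_on A B C f \<longleftrightarrow>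
     (\<forall>y\<in>carrier B. linear_on A C (\<lambda>x. f x y)) \<and> (\<forall>x\<in>carrier A. linear_on B C (f x))"

lemma bilinear_onI:
  assumes "\<And>y. y \<in> carrier B \<Longrightarrow> linear_on A C (\<lambda>x. f x y)"
    and "\<And>x. x \<in> carrier A \<Longrightarrow> linear_on B C (f x)"
  shows "bilinear_on A B C f"
  using assms by (simp add: bilinear_on_def)

lemma bilinear_on_left: "bilinear_on A B C f \<Longrightarrow> y \<in> carrier B \<Longrightarrow> linear_on A C (\<lambda>x. f x y)"
  and bilinear_on_right: "bilinear_on A B C f \<Longrightarrow> x \<in> carrier A \<Longrightarrow> linear_on B C (f x)"
  and bilinear_on_closed: "bilinear_on A B C f \<Longrightarrow> x \<in> carrier A \<Longrightarrow> y \<in> carrier B \<Longrightarrow> f x y \<in> carrier C"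
  by (auto simp: bilinear_on_def linear_on_def)

lemma bilinear_on_compose: "bilinear_on A B C f \<Longrightarrow> linear_on C D h \<Longrightarrow> bilinear_on A B D (\<lambda>x y. h (f x y))"
  by (auto simp: bilinear_on_def linear_on_def Pi_iff)

locale tensor_pair = A: cmod A + B: cmod B for A :: "'a Cq_superalg" and B :: "'b Cq_superalg"
begin

abbreviation "relspan \<equiv> PS.span (bilinear_relators A B)"
definition formal :: "('a \<times> 'b \<Rightarrow>\<^sub>0 Cq) set" where
  "formal = {p. Poly_Mapping.keys p \<subseteq> carrier A \<times> carrier B}"
abbreviation "T \<equiv> tensor_space A B"

lemma subspace_formal: "PS.subspace formal"
  unfolding formal_def by (rule subspace_keys)

lemma formal_single [simp]: "x \<in> carrier A \<Longrightarrow> y \<in> carrier B \<Longrightarrow> Poly_Mapping.single (x, y) c \<in> formal"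
  by (auto simp: formal_def split: if_splits)

lemmas formal_closed [simp] =
  PS.subspace_0[OF subspace_formal] PS.subspace_add[OF subspace_formal] PS.subspace_scale[OF subspace_formal]
  PS.subspace_diff[OF subspace_formal] PS.subspace_neg[OF subspace_formal]

lemma formal_keys: "p \<in> formal \<Longrightarrow> g \<in> Poly_Mapping.keys p \<Longrightarrow> fst g \<in> carrier A \<and> snd g \<in> carrier B"
  by (auto simp: formal_def)

text \<open>The relators only involve pairs from the carriers. Consequently every member of the
  coset of an admissible combination is admissible, including the one that
  \<open>tensor_lift\<close> picks by choice.\<close>

lemma relspan_formal: "p \<in> relspan \<Longrightarrow> p \<in> formal"
proof -
  have "bilinear_relators A B \<subseteq> formal"
    unfolding bilinear_relators_def by auto
  then show "p \<in> relspan \<Longrightarrow> p \<in> formal"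
    using PS.span_minimal[OF _ subspace_formal] by blast
qed

lemma mem_tensor_class: "r \<in> tensor_class A B p \<longleftrightarrow> r - p \<in> relspan"
  unfolding tensor_class_def by (auto intro: image_eqI[of _ _ "r - p"])

lemma self_mem_tensor_class: "p \<in> tensor_class A B p"
  by (simp add: mem_tensor_class PS.span_zero)

lemma tensor_class_eq_iff: "tensor_class A B p = tensor_class A B r \<longleftrightarrow> p - r \<in> relspan"
proof
  assume "tensor_class A B p = tensor_class A B r"
  then show "p - r \<in> relspan" using self_mem_tensor_class[of p] by (simp add: mem_tensor_class)
next
  assume pr: "p - r \<in> relspan"
  have "s - p \<in> relspan \<longleftrightarrow> s - r \<in> relspan" for s
    using PS.span_add[OF _ pr, of "s - p"] PS.span_diff[OF _ pr, of "s - r"] by auto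
  then show "tensor_class A B p = tensor_class A B r" by (auto simp: mem_tensor_class)
qed

lemma tensor_class_formal: "p \<in> formal \<Longrightarrow> r \<in> tensor_class A B p \<Longrightarrow> r \<in> formal"
  using PS.subspace_add[OF subspace_formal relspan_formal, of "r - p" p] by (simp add: mem_tensor_class)

lemma tensor_space_sel:
  "carrier T = tensor_class A B ` formal"
  "monoid.one T = tens A B \<one>\<^bsub>A\<^esub> \<one>\<^bsub>B\<^esub>"
  "ring.zero T = tensor_class A B 0"
  by (auto simp: tensor_space_def formal_def)

lemma tensor_class_add: "tensor_class A B p \<oplus>\<^bsub>T\<^esub> tensor_class A B r = tensor_class A B (p + r)"
proof -
  have "tensor_class A B (z + w) = tensor_class A B (p + r)"
    if "z \<in> tensor_class A B p" "w \<in> tensor_class A B r" for z w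
  proof -
    have "z + w - (p + r) = (z - p) + (w - r)" by simp
    then show ?thesis
      using that PS.span_add[of "z - p" _ "w - r"] unfolding mem_tensor_class tensor_class_eq_iff by metis
  qed
  then have "(\<Union>z\<in>tensor_class A B p. \<Union>w\<in>tensor_class A B r. tensor_class A B (z + w)) = tensor_class A B (p + r)"
    using self_mem_tensor_class by blast
  then show ?thesis by (simp add: tensor_space_def)
qed

lemma tensor_class_smult: "c \<odot>\<^bsub>T\<^esub> tensor_class A B p = tensor_class A B (pscale c p)"
proof -
  have "tensor_class A B (pscale c z) = tensor_class A B (pscale c p)"
    if "z \<in> tensor_class A B p" for z
    using that PS.span_scale[of "z - p" _ c]
    by (simp add: mem_tensor_class tensor_class_eq_iff PS.scale_right_diff_distrib)
  then have "(\<Union>z\<in>tensor_class A B p. tensor_class A B (pscale c z)) = tensor_class A B (pscale c p)"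
    using self_mem_tensor_class by blast
  then show ?thesis by (simp add: tensor_space_def)
qed

lemma cmod_tensor_space: "cmod T"
proof (rule cmod.intro)
  have grp: "abelian_group T"
  proof (rule abelian_groupI)
    fix x assume "x \<in> carrier T"
    then obtain p where p: "x = tensor_class A B p" "p \<in> formal" by (auto simp: tensor_space_sel)
    show "\<exists>y\<in>carrier T. y \<oplus>\<^bsub>T\<^esub> x = \<zero>\<^bsub>T\<^esub>"
      by (rule bexI[of _ "tensor_class A B (- p)"])
        (use p in \<open>auto simp: tensor_class_add tensor_space_sel(3) tensor_space_sel(1)\<close>)
  qed (auto simp: tensor_class_add tensor_space_sel(3) tensor_space_sel(1) add_ac)
  show "module Cq_ring T"
    by (rule moduleI[OF cring_from_type_algebra grp])
      (auto simp: tensor_class_smult tensor_class_add tensor_space_sel(1) PS.scale_left_distrib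
         PS.scale_right_distrib)
qed

sublocale T: cmod T
  by (rule cmod_tensor_space)

lemma tens_closed [simp, intro]: "x \<in> carrier A \<Longrightarrow> y \<in> carrier B \<Longrightarrow> tens A B x y \<in> carrier T"
  unfolding tens_def tensor_space_sel by simp

lemma bilinear_on_tens: "bilinear_on A B T (tens A B)"
proof (intro bilinear_onI linear_onI)
  fix x x' y assume "x \<in> carrier A" "x' \<in> carrier A" "y \<in> carrier B"
  then show "tens A B (x \<oplus>\<^bsub>A\<^esub> x') y = tens A B x y \<oplus>\<^bsub>T\<^esub> tens A B x' y"
    unfolding tens_def tensor_class_add tensor_class_eq_iff diff_add_eq_diff_diff_swap
    by (intro PS.span_base) (auto simp: bilinear_relators_def algebra_simps)
next
  fix c x y assume "x \<in> carrier A" "y \<in> carrier B"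
  moreover have "pscale c (Poly_Mapping.single (x, y) 1) = Poly_Mapping.single (x, y) c"
    by (rule poly_mapping_eqI) (simp add: lookup_single when_def)
  ultimately show "tens A B (c \<odot>\<^bsub>A\<^esub> x) y = c \<odot>\<^bsub>T\<^esub> tens A B x y" "tens A B x (c \<odot>\<^bsub>B\<^esub> y) = c \<odot>\<^bsub>T\<^esub> tens A B x y"
    unfolding tens_def tensor_class_smult tensor_class_eq_iff
    by (auto intro!: PS.span_base simp: bilinear_relators_def)
next
  fix x y y' assume "x \<in> carrier A" "y \<in> carrier B" "y' \<in> carrier B"
  then show "tens A B x (y \<oplus>\<^bsub>B\<^esub> y') = tens A B x y \<oplus>\<^bsub>T\<^esub> tens A B x y'"
    unfolding tens_def tensor_class_add tensor_class_eq_iff diff_add_eq_diff_diff_swap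
    by (intro PS.span_base) (auto simp: bilinear_relators_def algebra_simps)
qed auto

text \<open>Scalars are absorbed into the first factor, so a multiple of a pure tensor is again a
  pure tensor and falls under \<open>tens\<close>.\<close>

lemma tensor_induct [consumes 1, case_names tens add]:
  assumes "Z \<in> carrier T"
    and tens: "\<And>x y. x \<in> carrier A \<Longrightarrow> y \<in> carrier B \<Longrightarrow> P (tens A B x y)"
    and add: "\<And>Z W. Z \<in> carrier T \<Longrightarrow> W \<in> carrier T \<Longrightarrow> P Z \<Longrightarrow> P W \<Longrightarrow> P (Z \<oplus>\<^bsub>T\<^esub> W)"
  shows "P Z"
proof -
  from assms(1) obtain p where p: "Z = tensor_class A B p" "Poly_Mapping.keys p \<subseteq> carrier A \<times> carrier B"
    by (auto simp: tensor_space_sel formal_def)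
  have single: "P (tensor_class A B (Poly_Mapping.single g c))" if "g \<in> carrier A \<times> carrier B" for g c
  proof -
    from that obtain x y where g: "g = (x, y)" "x \<in> carrier A" "y \<in> carrier B" by auto
    have "Poly_Mapping.single (x, y) c = pscale c (Poly_Mapping.single (x, y) 1)"
      by (rule poly_mapping_eqI) (simp add: lookup_single when_def)
    then have "tensor_class A B (Poly_Mapping.single g c) = tens A B (c \<odot>\<^bsub>A\<^esub> x) y"
      using linear_on_smult[OF bilinear_on_left[OF bilinear_on_tens]] g
      by (simp add: tens_def tensor_class_smult)
    then show ?thesis using tens g by auto
  qed
  have "P (tensor_class A B p)" using p(2)
  proof (induction p rule: poly_mapping_single_induct)
    case zero
    \<comment> \<open>The zero class, too, is a pure tensor: that of the two zeros.\<close>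
    have "tens A B \<zero>\<^bsub>A\<^esub> \<zero>\<^bsub>B\<^esub> = tensor_class A B 0"
      using linear_on_zero[OF A.cmod_axioms cmod_tensor_space bilinear_on_left[OF bilinear_on_tens]]
      by (simp add: tensor_space_sel)
    then show ?case using tens by (metis A.zero_closed B.zero_closed)
  next
    case (add p r)
    then show ?case using assms(3)[of "tensor_class A B p" "tensor_class A B r"]
      by (auto simp: tensor_class_add tensor_space_sel(1) formal_def)
  qed (rule single)
  then show ?thesis using p by simp
qed

lemma linear_on_tensor_eqI:
  assumes "linear_on T C f" "linear_on T C g"
    and "\<And>x y. x \<in> carrier A \<Longrightarrow> y \<in> carrier B \<Longrightarrow> f (tens A B x y) = g (tens A B x y)"
    and "Z \<in> carrier T"
  shows "f Z = g Z"
  using assms(4)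
proof (induction rule: tensor_induct)
  case (add Z W)
  then show ?case by (simp add: linear_on_add[OF assms(1)] linear_on_add[OF assms(2)])
qed (rule assms(3))

lemma tensor_lift_as_linear_ext:
  "tensor_lift C f Z = linear_ext C (\<lambda>g. f (fst g) (snd g)) (SOME p. p \<in> Z)"
  by (simp add: tensor_lift_def linear_ext_def Let_def)

text \<open>All that is ever known about the chosen representative: it is admissible and lies in the
  right class.\<close>

lemma some_rep:
  assumes "Z \<in> carrier T"
  shows "(SOME p. p \<in> Z) \<in> formal" and "tensor_class A B (SOME p. p \<in> Z) = Z"
proof -
  from assms obtain p where p: "Z = tensor_class A B p" "p \<in> formal" by (auto simp: tensor_space_sel)
  then have "p \<in> Z" using self_mem_tensor_class by simp
  then have s: "(SOME p. p \<in> Z) \<in> Z" by (rule someI)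
  then show "(SOME p. p \<in> Z) \<in> formal" "tensor_class A B (SOME p. p \<in> Z) = Z"
    using p tensor_class_formal by (auto simp: mem_tensor_class tensor_class_eq_iff)
qed

context
  fixes C :: "'c Cq_superalg" and f
  assumes C: "cmod C" and f: "\<And>x y. x \<in> carrier A \<Longrightarrow> y \<in> carrier B \<Longrightarrow> f x y \<in> carrier C"
begin

interpretation C: cmod C by (rule C)

lemma tensor_lift_closed: "Z \<in> carrier T \<Longrightarrow> tensor_lift C f Z \<in> carrier C"
  unfolding tensor_lift_as_linear_ext using formal_keys[OF some_rep(1)[of Z]] f by (intro C.linear_ext_closed) auto

text \<open>Both sides sum over the same chosen representative, so the identity holds for every
  carrier-valued \<open>f\<close>. It is the tool that pushes \<open>\<sigma>\<close> through the
  nested lifts defining the braided product and the tensor action.\<close>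

lemma tensor_lift_compose:
  assumes "cmod D" "linear_on C D h" "Z \<in> carrier T"
  shows "h (tensor_lift C f Z) = tensor_lift D (\<lambda>x y. h (f x y)) Z"
  unfolding tensor_lift_as_linear_ext using formal_keys[OF some_rep(1)[OF assms(3)]] f
  by (intro linear_on_linear_ext[OF C assms(1,2)]) auto

lemma tensor_lift_cong:
  assumes "\<And>x y. x \<in> carrier A \<Longrightarrow> y \<in> carrier B \<Longrightarrow> f' x y = f x y" "Z \<in> carrier T"
  shows "tensor_lift C f' Z = tensor_lift C f Z"
  unfolding tensor_lift_as_linear_ext using formal_keys[OF some_rep(1)[OF assms(2)]] assms(1) f
  by (intro C.linear_ext_cong) auto

lemma tensor_lift_fun_add:
  assumes "\<And>x y. x \<in> carrier A \<Longrightarrow> y \<in> carrier B \<Longrightarrow> f' x y \<in> carrier C" "Z \<in> carrier T"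
  shows "tensor_lift C (\<lambda>x y. f x y \<oplus>\<^bsub>C\<^esub> f' x y) Z = tensor_lift C f Z \<oplus>\<^bsub>C\<^esub> tensor_lift C f' Z"
  unfolding tensor_lift_as_linear_ext using formal_keys[OF some_rep(1)[of Z]] f assms
  by (intro C.linear_ext_fun_add) auto

end

context
  fixes C :: "'c Cq_superalg" and f
  assumes C: "cmod C" and f: "bilinear_on A B C f"
begin

interpretation C: cmod C by (rule C)

text \<open>The extension kills a subspace of \<open>formal\<close>. Bilinearity of \<open>f\<close>
  says exactly that the four families of relators lie in it, and their span is the smallest subspace
  containing them.\<close>

lemma linear_ext_relspan:
  assumes "p \<in> relspan"
  shows "linear_ext C (\<lambda>g. f (fst g) (snd g)) p = \<zero>\<^bsub>C\<^esub>"
proof -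
  let ?f = "\<lambda>g. f (fst g) (snd g)"
  have fc: "?f \<in> Poly_Mapping.keys p \<rightarrow> carrier C" if "p \<in> formal" for p
    using formal_keys[OF that] bilinear_on_closed[OF f] by auto
  let ?K = "{p \<in> formal. linear_ext C ?f p = \<zero>\<^bsub>C\<^esub>}"
  have "PS.subspace ?K"
    unfolding PS.subspace_def
    by (auto simp: C.linear_ext_add[OF fc fc] C.linear_ext_pscale[OF fc])
  moreover have diff: "linear_ext C ?f (p - r) = linear_ext C ?f p \<ominus>\<^bsub>C\<^esub> linear_ext C ?f r"
    if "p \<in> formal" "r \<in> formal" for p r
  proof -
    have "p - r = p + pscale (- 1) r" by (rule poly_mapping_eqI) (simp add: lookup_add lookup_minus)
    then show ?thesis
      using that C.linear_ext_add[OF fc fc, of p "pscale (- 1) r"] C.linear_ext_pscale[OF fc, of r "- 1"]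
         C.smult_minus_one C.linear_ext_closed[OF fc]
      by (simp add: a_minus_def)
  qed
  have single: "linear_ext C ?f (Poly_Mapping.single (x, y) c) = c \<odot>\<^bsub>C\<^esub> f x y"
    if "x \<in> carrier A" "y \<in> carrier B" for x y c
    using that bilinear_on_closed[OF f] by simp
  \<comment> \<open>The shape that an additive relator takes under the extension.\<close>
  have cancel: "(a \<oplus>\<^bsub>C\<^esub> b) \<ominus>\<^bsub>C\<^esub> a \<ominus>\<^bsub>C\<^esub> b = \<zero>\<^bsub>C\<^esub>"
    if "a \<in> carrier C" "b \<in> carrier C" for a b
    using that C.r_neg[of "a \<oplus>\<^bsub>C\<^esub> b"]
    by (simp_all add: C.minus_eq C.a_assoc[of "a \<oplus>\<^bsub>C\<^esub> b"] C.minus_add C.r_neg)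
  have self_diff: "a \<ominus>\<^bsub>C\<^esub> a = \<zero>\<^bsub>C\<^esub>" if "a \<in> carrier C" for a
    using that by (simp add: C.minus_eq C.r_neg)
  have "bilinear_relators A B \<subseteq> ?K"
  proof
    fix p assume "p \<in> bilinear_relators A B"
    then show "p \<in> ?K"
      using bilinear_on_closed[OF f]
      by (auto simp: bilinear_relators_def diff single
          linear_on_add[OF bilinear_on_left[OF f]] linear_on_add[OF bilinear_on_right[OF f]]
          linear_on_smult[OF bilinear_on_left[OF f]] linear_on_smult[OF bilinear_on_right[OF f]] cancel self_diff)
  qed
  ultimately show ?thesis
    using PS.span_minimal[of _ ?K] assms by blast
qed

text \<open>Two representatives differ by an element of the span of the relators, on which the
  extension vanishes; the choice made by \<open>tensor_lift\<close> is therefore immaterial.\<close>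

lemma tensor_lift_class:
  assumes "p \<in> formal"
  shows "tensor_lift C f (tensor_class A B p) = linear_ext C (\<lambda>g. f (fst g) (snd g)) p"
proof -
  let ?f = "\<lambda>g. f (fst g) (snd g)" and ?Z = "tensor_class A B p"
  have fc: "?f \<in> Poly_Mapping.keys p \<rightarrow> carrier C" if "p \<in> formal" for p
    using formal_keys[OF that] bilinear_on_closed[OF f] by auto
  let ?s = "SOME p. p \<in> ?Z"
  have "?Z \<in> carrier T" using assms by (auto simp: tensor_space_sel)
  from some_rep(2)[OF this] have "?s - p \<in> relspan" by (simp add: tensor_class_eq_iff)
  then have "linear_ext C ?f (p + (?s - p)) = linear_ext C ?f p"
    using C.linear_ext_add[OF fc[OF assms] fc[OF relspan_formal], of "?s - p"] linear_ext_relspan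
      C.linear_ext_closed[OF fc[OF assms]] by simp
  then show ?thesis by (simp add: tensor_lift_as_linear_ext)
qed

lemma tensor_lift_tens [simp]:
  "x \<in> carrier A \<Longrightarrow> y \<in> carrier B \<Longrightarrow> tensor_lift C f (tens A B x y) = f x y"
  unfolding tens_def using bilinear_on_closed[OF f]
  by (subst tensor_lift_class) auto

lemma linear_on_tensor_lift: "linear_on T C (tensor_lift C f)"
proof (rule linear_onI)
  have fc: "(\<lambda>g. f (fst g) (snd g)) \<in> Poly_Mapping.keys p \<rightarrow> carrier C" if "p \<in> formal" for p
    using formal_keys[OF that] bilinear_on_closed[OF f] by auto
  fix Z W c assume Z: "Z \<in> carrier T"
  then obtain p where p: "Z = tensor_class A B p" "p \<in> formal" by (auto simp: tensor_space_sel)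
  show "tensor_lift C f Z \<in> carrier C"
    using Z by (intro tensor_lift_closed C bilinear_on_closed[OF f])
  show "tensor_lift C f (c \<odot>\<^bsub>T\<^esub> Z) = c \<odot>\<^bsub>C\<^esub> tensor_lift C f Z"
    using p by (simp add: tensor_class_smult tensor_lift_class  C.linear_ext_pscale fc)
  assume "W \<in> carrier T"
  then obtain r where r: "W = tensor_class A B r" "r \<in> formal" by (auto simp: tensor_space_sel)
  show "tensor_lift C f (Z \<oplus>\<^bsub>T\<^esub> W) = tensor_lift C f Z \<oplus>\<^bsub>C\<^esub> tensor_lift C f W"
    using p r by (simp add: tensor_class_add tensor_lift_class  C.linear_ext_add fc)
qed

end

end

section \<open>Superspaces\<close>

lemma bit_cases: "(d :: bit) = 0 \<or> d = 1"
  by (cases d) auto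

lemma ksign_simps [simp]: "ksign 0 = 1" "ksign 1 = - 1"
  by (simp_all add: ksign_def)

lemma ksign_add: "ksign (d + e) = ksign d * ksign e"
  using bit_cases[of d] bit_cases[of e] by auto

lemma ksign_square [simp]: "ksign d * ksign d = 1"
  using bit_cases[of d] by auto

lemma ksign_nonzero [simp]: "ksign d \<noteq> (0 :: Cq)"
  using bit_cases[of d] by auto

locale sspace =
  fixes M :: "'a Cq_superalg" (structure)
  assumes is_superspace: "superspace M"
begin

sublocale cmod M
  using is_superspace by (intro cmod.intro) (simp add: superspace_def)

lemma homog_submodule: "submodule (homog M d) Cq_ring M"
  using is_superspace by (simp add: superspace_def)

lemma homog_closed [intro]: "x \<in> homog M d \<Longrightarrow> x \<in> carrier M"
  using module.submoduleE(1)[OF is_module homog_submodule] by blast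

lemma homog_add [intro]: "x \<in> homog M d \<Longrightarrow> y \<in> homog M d \<Longrightarrow> x \<oplus> y \<in> homog M d"
  using module.submoduleE(5)[OF is_module homog_submodule] by blast

lemma homog_smult [intro]: "x \<in> homog M d \<Longrightarrow> c \<odot> x \<in> homog M d"
  using module.submoduleE(4)[OF is_module homog_submodule, of c] by simp

lemma homog_zero [simp, intro]: "\<zero> \<in> homog M d"
proof -
  obtain x where "x \<in> homog M d"
    using module.submoduleE(2)[OF is_module homog_submodule] by blast
  then show ?thesis using homog_smult[of x d 0] homog_closed[of x d] by simp
qed

lemma homog_finsum: "f \<in> S \<rightarrow> homog M d \<Longrightarrow> finsum M f S \<in> homog M d"
proof (induction S rule: infinite_finite_induct)
  case (insert a S)
  then have "f \<in> insert a S \<rightarrow> carrier M" by (auto intro: homog_closed)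
  with insert show ?case by (subst finsum_insert) (auto intro: homog_add)
qed auto

lemma homog_decomp_ex1:
  assumes "x \<in> carrier M"
  shows "\<exists>!(y, z). y \<in> homog M 0 \<and> z \<in> homog M 1 \<and> x = y \<oplus> z"
  using is_superspace assms by (simp add: superspace_def)

lemma homog_decomp_unique:
  assumes "y \<in> homog M 0" "z \<in> homog M 1" "y' \<in> homog M 0" "z' \<in> homog M 1" "y \<oplus> z = y' \<oplus> z'"
  shows "y = y'" "z = z'"
proof -
  have "y \<oplus> z \<in> carrier M" using assms by (auto intro: homog_closed)
  from homog_decomp_ex1[OF this] have "(y, z) = (y', z')"
    using assms by (elim ex1E) (metis (mono_tags, lifting) case_prodI)
  then show "y = y'" "z = z'" by auto
qed

lemma hcomp_eq:
  assumes "y \<in> homog M 0" "z \<in> homog M 1"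
  shows "hcomp M 0 (y \<oplus> z) = y" "hcomp M 1 (y \<oplus> z) = z"
proof -
  show "hcomp M 0 (y \<oplus> z) = y"
    unfolding hcomp_def using assms homog_decomp_unique(1)[OF assms] by (intro the_equality) auto
  \<comment> \<open>For the odd component \<open>hcomp\<close> splits the element as odd plus even,
    since \<open>1 + 1 = 0\<close> in \<open>bit\<close>; the uniqueness statement applies after
    swapping the summands.\<close>
  have "w = z" if "w \<in> homog M 1" "v \<in> homog M 0" "y \<oplus> z = w \<oplus> v" for v w
    using homog_decomp_unique(2)[OF assms that(2,1)] that assms
    by (auto simp: a_comm[of w v] homog_closed)
  then show "hcomp M 1 (y \<oplus> z) = z"
    unfolding hcomp_def using assms
    by (intro the_equality) (auto simp: a_comm[of y z] homog_closed)
qed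

lemma hcomp_decomp:
  assumes "x \<in> carrier M"
  shows "hcomp M d x \<in> homog M d" "x = hcomp M 0 x \<oplus> hcomp M 1 x"
proof -
  from homog_decomp_ex1[OF assms] obtain y z
    where yz: "y \<in> homog M 0" "z \<in> homog M 1" "x = y \<oplus> z" by auto
  then show "hcomp M d x \<in> homog M d" "x = hcomp M 0 x \<oplus> hcomp M 1 x"
    using hcomp_eq[OF yz(1,2)] bit_cases[of d] by auto
qed

lemma hcomp_closed [simp, intro]: "x \<in> carrier M \<Longrightarrow> hcomp M d x \<in> carrier M"
  using hcomp_decomp(1) by blast

lemma hcomp_homog:
  assumes "x \<in> homog M d"
  shows "hcomp M e x = (if e = d then x else \<zero>)"
proof -
  have x: "x \<in> carrier M" using assms by blast
  show ?thesis
    using hcomp_eq[of x \<zero>] hcomp_eq[of \<zero> x] assms x bit_cases[of d] bit_cases[of e] by auto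
qed

lemma linear_on_hcomp: "linear_on M M (hcomp M d)"
proof (rule linear_onI)
  fix x y c assume x: "x \<in> carrier M"
  show "hcomp M d (c \<odot> x) = c \<odot> hcomp M d x"
  proof -
    have "c \<odot> x = c \<odot> hcomp M 0 x \<oplus> c \<odot> hcomp M 1 x"
      using hcomp_decomp(2)[OF x] x smult_add_right hcomp_closed by metis
    moreover have "c \<odot> hcomp M 0 x \<in> homog M 0" "c \<odot> hcomp M 1 x \<in> homog M 1"
      using hcomp_decomp(1)[OF x] by auto
    ultimately show ?thesis using hcomp_eq bit_cases[of d] by metis
  qed
  assume y: "y \<in> carrier M"
  show "hcomp M d (x \<oplus> y) = hcomp M d x \<oplus> hcomp M d y"
  proof -
    have "(a \<oplus> b) \<oplus> (c \<oplus> d) = (a \<oplus> c) \<oplus> (b \<oplus> d)"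
      if "a \<in> carrier M" "b \<in> carrier M" "c \<in> carrier M" "d \<in> carrier M" for a b c d
      using that by (simp add: a_ac)
    then have "x \<oplus> y = (hcomp M 0 x \<oplus> hcomp M 0 y) \<oplus> (hcomp M 1 x \<oplus> hcomp M 1 y)"
      using hcomp_decomp(2)[OF x] hcomp_decomp(2)[OF y] x y hcomp_closed by metis
    moreover have "hcomp M e x \<oplus> hcomp M e y \<in> homog M e" for e
      using hcomp_decomp(1)[OF x] hcomp_decomp(1)[OF y] by auto
    ultimately show ?thesis using hcomp_eq bit_cases[of d] by metis
  qed
qed auto

lemma linear_on_koszul_twist: "linear_on M M (koszul_twist M d)"
proof (rule linear_onI)
  fix x y c assume x: "x \<in> carrier M"
  show "koszul_twist M d (c \<odot> x) = c \<odot> koszul_twist M d x"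
    using x by (simp add: koszul_twist_def linear_on_smult[OF linear_on_hcomp] smult_add_right smult_smult mult.commute)
  assume y: "y \<in> carrier M"
  then show "koszul_twist M d (x \<oplus> y) = koszul_twist M d x \<oplus> koszul_twist M d y"
    using x by (simp add: koszul_twist_def linear_on_add[OF linear_on_hcomp] smult_add_right a_ac)
qed (simp add: koszul_twist_def)

lemma koszul_twist_closed [simp, intro]: "x \<in> carrier M \<Longrightarrow> koszul_twist M d x \<in> carrier M"
  using linear_on_closed[OF linear_on_koszul_twist] .

lemma koszul_twist_homog: "x \<in> homog M e \<Longrightarrow> koszul_twist M d x = ksign (d * e) \<odot> x"
  using bit_cases[of e] homog_closed[of x e] by (auto simp: koszul_twist_def hcomp_homog)

end


section \<open>Associative algebras over the base field\<close>

text \<open>Free of any grading on purpose: evaluating noncommutative polynomials only involves an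
  associative algebra, and one of the targets, \<open>End_alg\<close>, carries an empty
  grading.\<close>

locale calg = cmod B + ring B for B :: "'a Cq_superalg" (structure) +
  assumes smult_mult_left: "x \<in> carrier B \<Longrightarrow> y \<in> carrier B \<Longrightarrow> (c \<odot> x) \<otimes> y = c \<odot> (x \<otimes> y)"
    and smult_mult_right: "x \<in> carrier B \<Longrightarrow> y \<in> carrier B \<Longrightarrow> x \<otimes> (c \<odot> y) = c \<odot> (x \<otimes> y)"

locale salg =
  fixes B :: "'a Cq_superalg" (structure)
  assumes is_superalgebra: "superalgebra B"
begin

sublocale sspace B
  using is_superalgebra by (intro sspace.intro) (simp add: superalgebra_def)

sublocale calg B
  using is_superalgebra
  by (intro calg.intro calg_axioms.intro cmod_axioms) (auto simp: superalgebra_def)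

lemma one_homog: "\<one> \<in> homog B 0"
  and mult_homog: "x \<in> homog B d \<Longrightarrow> y \<in> homog B e \<Longrightarrow> x \<otimes> y \<in> homog B (d + e)"
  using is_superalgebra by (auto simp: superalgebra_def)

end

section \<open>Evaluation of noncommutative polynomials in an algebra\<close>

definition word_prod :: "'b Cq_superalg \<Rightarrow> ('g \<Rightarrow> 'b) \<Rightarrow> 'g free_monoid \<Rightarrow> 'b" where
  "word_prod B h w = foldr (\<lambda>g x. h g \<otimes>\<^bsub>B\<^esub> x) (letters w) \<one>\<^bsub>B\<^esub>"

definition free_eval :: "'b Cq_superalg \<Rightarrow> ('g \<Rightarrow> 'b) \<Rightarrow> 'g free_alg \<Rightarrow> 'b" where
  "free_eval B h = linear_ext B (word_prod B h)"

lemma word_prod_simps [simp]: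
  "word_prod B h (Word []) = \<one>\<^bsub>B\<^esub>"
  "word_prod B h (Word (g # ws)) = h g \<otimes>\<^bsub>B\<^esub> word_prod B h (Word ws)"
  by (simp_all add: word_prod_def)

context calg
begin

context
  fixes h :: "'g \<Rightarrow> 'a"
  assumes h: "\<And>g. h g \<in> carrier B"
begin

lemma word_prod_closed [simp]: "word_prod B h w \<in> carrier B"
proof (cases w)
  case (Word ws)
  show ?thesis unfolding Word by (induction ws) (use h in auto)
qed

lemma word_prod_add: "word_prod B h (v + w) = word_prod B h v \<otimes> word_prod B h w"
proof (cases v)
  case (Word vs)
  show ?thesis unfolding Word
  proof (induction vs)
    case (Cons g vs)
    have "Word (g # vs) + w = Word (g # letters (Word vs + w))"
      by (simp add: plus_free_monoid_def)
    moreover have "Word (letters (Word vs + w)) = Word vs + w" by simp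
    ultimately show ?case using Cons h by (simp add: m_assoc del: free_monoid.collapse)
  qed (cases w, simp add: plus_free_monoid_def)
qed

lemma free_eval_closed [simp]: "free_eval B h p \<in> carrier B"
  unfolding free_eval_def by (intro linear_ext_closed) simp

lemma free_eval_add: "free_eval B h (p + r) = free_eval B h p \<oplus> free_eval B h r"
  unfolding free_eval_def by (intro linear_ext_add) simp_all

lemma free_eval_zero [simp]: "free_eval B h 0 = \<zero>"
  by (simp add: free_eval_def)

lemma free_eval_single: "free_eval B h (Poly_Mapping.single w c) = c \<odot> word_prod B h w"
  by (simp add: free_eval_def)

lemma free_eval_mult: "free_eval B h (p * r) = free_eval B h p \<otimes> free_eval B h r"
proof -
  have *: "free_eval B h (Poly_Mapping.single v c * r) = free_eval B h (Poly_Mapping.single v c) \<otimes> free_eval B h r"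
    for v c
    by (rule poly_mapping_single_induct[of r UNIV])
      (auto simp: mult_single free_eval_single word_prod_add distrib_left free_eval_add r_distr smult_mult_left
        smult_mult_right smult_smult mult.commute[of c])
  show ?thesis
    by (rule poly_mapping_single_induct[of p UNIV]) (auto simp: * distrib_right free_eval_add l_distr)
qed

lemma free_eval_scalar [simp]: "free_eval B h (scalar c) = c \<odot> \<one>"
  by (simp add: scalar_def free_eval_single zero_free_monoid_def)

lemma free_eval_one [simp]: "free_eval B h 1 = \<one>"
  using free_eval_scalar[of 1] by (simp add: scalar_def)

lemma free_eval_gen [simp]: "free_eval B h (gen g) = h g"
  using h by (simp add: gen_def free_eval_single)

lemma free_eval_scalar_mult: "free_eval B h (scalar c * p) = c \<odot> free_eval B h p"
  by (simp add: free_eval_mult smult_mult_left)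

lemma free_eval_uminus: "free_eval B h (- p) = \<ominus> free_eval B h p"
  using free_eval_add[of "- p" p] by (intro add.inv_equality[symmetric]) auto

lemma free_eval_diff: "free_eval B h (p - r) = free_eval B h p \<ominus> free_eval B h r"
  using free_eval_add[of p "- r"] by (simp add: free_eval_uminus a_minus_def)

end

lemma linear_on_mult_left: "x \<in> carrier B \<Longrightarrow> linear_on B B (\<lambda>y. x \<otimes> y)"
  and linear_on_mult_right: "y \<in> carrier B \<Longrightarrow> linear_on B B (\<lambda>x. x \<otimes> y)"
  by (auto intro!: linear_onI simp: r_distr l_distr smult_mult_left smult_mult_right)

end

definition alg_hom :: "'a Cq_superalg \<Rightarrow> 'b Cq_superalg \<Rightarrow> ('a \<Rightarrow> 'b) \<Rightarrow> bool" where
  "alg_hom A B f \<longleftrightarrow> f \<in> ring_hom A B \<and> linear_on A B f"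

lemma superalgebra_hom_iff:
  "superalgebra_hom A B f \<longleftrightarrow> alg_hom A B f \<and> (\<forall>d. f ` homog A d \<subseteq> homog B d)"
  by (auto simp: superalgebra_hom_def alg_hom_def even_linear_map_iff)

lemma alg_homI:
  assumes "linear_on A B f" "\<And>x y. x \<in> carrier A \<Longrightarrow> y \<in> carrier A \<Longrightarrow> f (x \<otimes>\<^bsub>A\<^esub> y) = f x \<otimes>\<^bsub>B\<^esub> f y"
    "f \<one>\<^bsub>A\<^esub> = \<one>\<^bsub>B\<^esub>"
  shows "alg_hom A B f"
  using assms by (auto simp: alg_hom_def ring_hom_def linear_on_def)

lemma alg_hom_linear: "alg_hom A B f \<Longrightarrow> linear_on A B f"
  and alg_hom_mult: "alg_hom A B f \<Longrightarrow> x \<in> carrier A \<Longrightarrow> y \<in> carrier A \<Longrightarrow> f (x \<otimes>\<^bsub>A\<^esub> y) = f x \<otimes>\<^bsub>B\<^esub> f y"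
  and alg_hom_one: "alg_hom A B f \<Longrightarrow> f \<one>\<^bsub>A\<^esub> = \<one>\<^bsub>B\<^esub>"
  by (auto simp: alg_hom_def ring_hom_def)

lemma alg_hom_compose: "alg_hom A B f \<Longrightarrow> alg_hom B C g \<Longrightarrow> alg_hom A C (\<lambda>x. g (f x))"
  by (auto simp: alg_hom_def ring_hom_def linear_on_def Pi_iff)

section \<open>Superalgebras given by generators and relations\<close>

text \<open>Allows halving: the even component of an element will be determined through its
  double.\<close>

lemma two_nonzero: "(2 :: Cq) \<noteq> 0"
proof -
  have "Fraction_Field.Fract (2 :: complex poly) 1 \<noteq> 0"
    unfolding Zero_fract_def by (simp add: eq_fract)
  then show ?thesis using of_nat_fract[of 2, where 'a = "complex poly"] by simp
qed

lemma scalar_commute: "scalar c * p = p * (scalar c :: 'g free_alg)"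
  by (rule poly_mapping_single_induct[of p UNIV])
    (auto simp: scalar_def mult_single distrib_left distrib_right mult.commute)

lemma scalar_simps [simp]:
  "scalar c * scalar d = scalar (c * d)" "scalar c + scalar d = scalar (c + d)" "scalar 1 = 1" "scalar 0 = 0"
  by (simp_all add: scalar_def mult_single single_add)

lemma scalar_left_commute: "p * (scalar c * r) = scalar c * (p * (r :: 'g free_alg))"
  by (metis scalar_commute mult.assoc)

lemma letters_simps [simp]: "letters 0 = []" "letters (v + w) = letters v @ letters w"
  by (simp_all add: zero_free_monoid_def plus_free_monoid_def)

definition hom_poly :: "('g \<Rightarrow> bit) \<Rightarrow> bit \<Rightarrow> 'g free_alg \<Rightarrow> bool" where
  "hom_poly par d p \<longleftrightarrow> (\<forall>w\<in>Poly_Mapping.keys p. sum_list (map par (letters w)) = d)"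

lemma hom_poly_zero [simp]: "hom_poly par d 0"
  by (simp add: hom_poly_def)

lemma hom_poly_add [intro]: "hom_poly par d p \<Longrightarrow> hom_poly par d r \<Longrightarrow> hom_poly par d (p + r)"
  using keys_add[of p r] by (auto simp: hom_poly_def)

lemma hom_poly_diff [intro]: "hom_poly par d p \<Longrightarrow> hom_poly par d r \<Longrightarrow> hom_poly par d (p - r)"
  using keys_diff[of p r] by (auto simp: hom_poly_def)

lemma hom_poly_mult:
  assumes "hom_poly par d p" "hom_poly par e r"
  shows "hom_poly par (d + e) (p * r)"
  unfolding hom_poly_def
proof
  fix w assume "w \<in> Poly_Mapping.keys (p * r)"
  then obtain u v where "w = u + v" "u \<in> Poly_Mapping.keys p" "v \<in> Poly_Mapping.keys r"
    using keys_mult[of p r] by blast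
  then show "sum_list (map par (letters w)) = d + e" using assms by (auto simp: hom_poly_def simp del: add_bit_eq_xor)
qed

lemma hom_poly_sum: "(\<And>i. i \<in> S \<Longrightarrow> hom_poly par d (f i)) \<Longrightarrow> hom_poly par d (sum f S)"
  by (induction S rule: infinite_finite_induct) (auto intro: hom_poly_add)

lemma hom_poly_scalar [simp, intro]: "hom_poly par 0 (scalar c)"
  by (auto simp: hom_poly_def scalar_def split: if_splits)

lemma hom_poly_one [simp, intro]: "hom_poly par 0 1"
  using hom_poly_scalar[of par 1] by simp

lemma hom_poly_ksign: "hom_poly par d p \<Longrightarrow> hom_poly par d (ksign e * p)"
  using hom_poly_diff[of par d 0 p] bit_cases[of e] by auto

lemma hom_poly_gen: "hom_poly par (par g) (gen g)"
  by (simp add: hom_poly_def gen_def)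

locale presented =
  fixes G :: "'g set" and par :: "'g \<Rightarrow> bit" and R :: "'g free_alg set"
  assumes rels_closed: "R \<subseteq> carrier (free_algebra G)"
begin

abbreviation "F \<equiv> free_algebra G"
abbreviation "cl \<equiv> pclass G R"

definition "A = presented_superalg G par R"

lemma F_sel [simp]: "monoid.mult F = (*)" "monoid.one F = 1" "ring.zero F = 0" "ring.add F = (+)"
  by (simp_all add: free_algebra_def)

lemma carrier_F: "carrier F = {p. Poly_Mapping.keys p \<subseteq> {w. set (letters w) \<subseteq> G}}"
  by (auto simp: free_algebra_def)

lemma carrier_F_closed [simp, intro]:
  "0 \<in> carrier F" "1 \<in> carrier F" "scalar c \<in> carrier F"
  "p \<in> carrier F \<Longrightarrow> r \<in> carrier F \<Longrightarrow> p + r \<in> carrier F"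
  "p \<in> carrier F \<Longrightarrow> r \<in> carrier F \<Longrightarrow> p - r \<in> carrier F"
  "p \<in> carrier F \<Longrightarrow> - p \<in> carrier F"
  "p \<in> carrier F \<Longrightarrow> r \<in> carrier F \<Longrightarrow> p * r \<in> carrier F"
  "g \<in> G \<Longrightarrow> gen g \<in> carrier F"
  "set ws \<subseteq> G \<Longrightarrow> Poly_Mapping.single (Word ws) c \<in> carrier F"
proof -
  show "p * r \<in> carrier F" if "p \<in> carrier F" "r \<in> carrier F"
  proof -
    have "set (letters w) \<subseteq> G" if w: "w \<in> Poly_Mapping.keys (p * r)" for w
    proof -
      obtain u v where "w = u + v" "u \<in> Poly_Mapping.keys p" "v \<in> Poly_Mapping.keys r"
        using w keys_mult[of p r] by blast
      then show ?thesis
        using \<open>p \<in> carrier F\<close> \<open>r \<in> carrier F\<close> by (auto simp: free_algebra_def)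
    qed
    then show ?thesis by (auto simp: free_algebra_def)
  qed
  show "p + r \<in> carrier F" if "p \<in> carrier F" "r \<in> carrier F"
    using keys_add[of p r] that by (auto simp: carrier_F)
  show "p - r \<in> carrier F" if "p \<in> carrier F" "r \<in> carrier F"
    using keys_diff[of p r] that by (auto simp: carrier_F)
qed (auto simp: carrier_F scalar_def gen_def split: if_splits)

lemma ring_F: "ring F"
proof (rule ringI)
  show "abelian_group F"
  proof (rule abelian_groupI)
    fix x assume "x \<in> carrier F"
    then show "\<exists>y\<in>carrier F. y \<oplus>\<^bsub>F\<^esub> x = \<zero>\<^bsub>F\<^esub>" by (intro bexI[of _ "- x"]) auto
  qed (auto simp: add_ac)
  show "Group.monoid F" by (rule monoidI) (auto simp: mult.assoc)
qed (auto simp: distrib_left distrib_right)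

sublocale F: ring F
  by (rule ring_F)

sublocale J: ideal "genideal F R" F
  using rels_closed by (rule F.genideal_ideal)

lemma F_minus [simp]: "p \<in> carrier F \<Longrightarrow> r \<in> carrier F \<Longrightarrow> p \<ominus>\<^bsub>F\<^esub> r = p - r"
proof -
  assume "p \<in> carrier F" "r \<in> carrier F"
  then have "\<ominus>\<^bsub>F\<^esub> r = - r" by (intro F.add.inv_equality) auto
  then show ?thesis by (simp add: a_minus_def)
qed

lemma cl_eq_iff: "p \<in> carrier F \<Longrightarrow> r \<in> carrier F \<Longrightarrow> cl p = cl r \<longleftrightarrow> p - r \<in> genideal F R"
  using F.quotient_eq_iff_same_a_r_cos[OF J.is_ideal, of p r] by (simp add: pclass_def)

lemma cl_rel: "r \<in> R \<Longrightarrow> cl r = cl 0"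
  using rels_closed F.genideal_self[OF rels_closed] by (subst cl_eq_iff) auto

lemma cl_relD: "p - r \<in> R \<Longrightarrow> p \<in> carrier F \<Longrightarrow> r \<in> carrier F \<Longrightarrow> cl p = cl r"
  using F.genideal_self[OF rels_closed] by (subst cl_eq_iff) auto

lemma A_sel:
  "carrier A = cl ` carrier F" "\<one>\<^bsub>A\<^esub> = cl 1" "\<zero>\<^bsub>A\<^esub> = cl 0"
  "homog A d = cl ` {p \<in> carrier F. hom_poly par d p}"
  using J.a_rcos_const[OF J.zero_closed]
  by (auto simp: A_def presented_superalg_def FactRing_def Let_def A_RCOSETS_def' pclass_def hom_poly_def)

lemma cl_closed [simp]: "p \<in> carrier F \<Longrightarrow> cl p \<in> carrier A"
  by (simp add: A_sel)

lemma cl_add: "p \<in> carrier F \<Longrightarrow> r \<in> carrier F \<Longrightarrow> cl p \<oplus>\<^bsub>A\<^esub> cl r = cl (p + r)"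
  using J.a_rcos_sum[of p r] by (simp add: A_def presented_superalg_def FactRing_def Let_def pclass_def)

lemma cl_mult: "p \<in> carrier F \<Longrightarrow> r \<in> carrier F \<Longrightarrow> cl p \<otimes>\<^bsub>A\<^esub> cl r = cl (p * r)"
  using J.rcoset_mult_add[of p r] by (simp add: A_def presented_superalg_def FactRing_def Let_def pclass_def)

lemma cl_smult: "p \<in> carrier F \<Longrightarrow> c \<odot>\<^bsub>A\<^esub> cl p = cl (scalar c * p)"
  using J.rcoset_mult_add[of "scalar c" p] by (simp add: A_def presented_superalg_def FactRing_def Let_def pclass_def)

lemma carrierE: "x \<in> carrier A \<Longrightarrow> (\<And>p. p \<in> carrier F \<Longrightarrow> x = cl p \<Longrightarrow> thesis) \<Longrightarrow> thesis"
  by (auto simp: A_sel)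

lemma ring_A: "ring A"
proof (rule ringI)
  show "abelian_group A"
  proof (rule abelian_groupI)
    fix x assume "x \<in> carrier A"
    then obtain p where "p \<in> carrier F" "x = cl p" by (rule carrierE)
    then show "\<exists>y\<in>carrier A. y \<oplus>\<^bsub>A\<^esub> x = \<zero>\<^bsub>A\<^esub>"
      by (intro bexI[of _ "cl (- p)"]) (auto simp: cl_add A_sel(3))
  qed (auto elim!: carrierE simp: cl_add add_ac A_sel(3))
  show "Group.monoid A" by (rule monoidI) (auto elim!: carrierE simp: cl_mult mult.assoc A_sel(2))
qed (auto elim!: carrierE simp: cl_mult cl_add distrib_left distrib_right)

lemma calg_A: "calg A"
proof (intro calg.intro cmod.intro calg_axioms.intro ring_A)
  show "module Cq_ring A"
    by (rule moduleI[OF cring_from_type_algebra ring.is_abelian_group[OF ring_A]])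
      (auto elim!: carrierE simp: cl_smult cl_add distrib_left distrib_right mult.assoc[symmetric]
        scalar_simps(2)[symmetric] simp del: scalar_simps(2))
qed (auto elim!: carrierE simp: cl_mult cl_smult mult.assoc scalar_left_commute)

sublocale A: calg A
  by (rule calg_A)

lemma cl_gen_mult: "cl (Poly_Mapping.single (Word (g # ws)) 1) = cl (gen g) \<otimes>\<^bsub>A\<^esub> cl (Poly_Mapping.single (Word ws) 1)"
  if "g \<in> G" "set ws \<subseteq> G"
  using that by (simp add: cl_mult gen_def mult_single plus_free_monoid_def)

text \<open>Every word arises from the unit by left multiplication with generators. Stripping
  letters from the left is the pattern that the hexagon identities and the product rule of the
  action can absorb.\<close>

lemma presented_induct [consumes 1, case_names one mult add smult]:
  assumes "x \<in> carrier A"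
    and one: "P \<one>\<^bsub>A\<^esub>"
    and mult: "\<And>g y. g \<in> G \<Longrightarrow> y \<in> carrier A \<Longrightarrow> P y \<Longrightarrow> P (cl (gen g) \<otimes>\<^bsub>A\<^esub> y)"
    and add: "\<And>x y. x \<in> carrier A \<Longrightarrow> y \<in> carrier A \<Longrightarrow> P x \<Longrightarrow> P y \<Longrightarrow> P (x \<oplus>\<^bsub>A\<^esub> y)"
    and smult: "\<And>c x. x \<in> carrier A \<Longrightarrow> P x \<Longrightarrow> P (c \<odot>\<^bsub>A\<^esub> x)"
  shows "P x"
proof -
  have word: "P (cl (Poly_Mapping.single (Word ws) 1))" if "set ws \<subseteq> G" for ws
    using that
  proof (induction ws)
    case Nil
    have "(Poly_Mapping.single (Word []) 1 :: 'g free_alg) = 1"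
      by (simp add: zero_free_monoid_def[symmetric])
    then show ?case using one by (simp add: A_sel)
  qed (use mult in \<open>simp add: cl_gen_mult\<close>)
  from assms(1) obtain p where p: "p \<in> carrier F" "x = cl p" by (rule carrierE)
  then have "Poly_Mapping.keys p \<subseteq> {w. set (letters w) \<subseteq> G}" by (simp add: carrier_F)
  then have "P (cl p)"
  proof (induction rule: poly_mapping_single_induct)
    case zero
    show ?case using smult[OF A.one_closed one, of 0] by (simp add: A_sel(3))
  next
    case (single w c)
    then have w: "set (letters w) \<subseteq> G" by simp
    then have "cl (Poly_Mapping.single w c) = c \<odot>\<^bsub>A\<^esub> cl (Poly_Mapping.single (Word (letters w)) 1)"
      by (simp add: cl_smult[OF carrier_F_closed(9)] scalar_def mult_single del: free_monoid.collapse)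
        (simp add: zero_free_monoid_def plus_free_monoid_def)
    then show ?case using word[OF w] smult w by (simp del: free_monoid.collapse)
  next
    case (add p r)
    then show ?case
      using assms(4)[of "cl p" "cl r"] by (simp add: cl_add carrier_F)
  qed
  then show ?thesis using p by simp
qed

text \<open>The universal property: the kernel of evaluation is an ideal containing
  \<open>R\<close>, so the value depends on the class alone. The map is taken extensional because
  \<open>iota\<close> is singled out among extensional functions.\<close>

lemma induced_hom:
  assumes B: "calg B" and h: "\<And>g. h g \<in> carrier B"
    and rel: "\<And>r. r \<in> R \<Longrightarrow> free_eval B h r = \<zero>\<^bsub>B\<^esub>"
  shows "\<exists>f\<in>extensional (carrier A). alg_hom A B f \<and> (\<forall>p\<in>carrier F. f (cl p) = free_eval B h p)"
proof -
  interpret B: calg B by (rule B)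
  let ?e = "free_eval B h"
  have e: "?e p \<in> carrier B" for p using h by (rule B.free_eval_closed)
  have add: "?e (p + r) = ?e p \<oplus>\<^bsub>B\<^esub> ?e r" for p r by (rule B.free_eval_add[OF h])
  have mult: "?e (p * r) = ?e p \<otimes>\<^bsub>B\<^esub> ?e r" for p r by (rule B.free_eval_mult[OF h])
  have uminus: "?e (- p) = \<ominus>\<^bsub>B\<^esub> ?e p" for p by (rule B.free_eval_uminus[OF h])
  have ker: "ideal {p \<in> carrier F. ?e p = \<zero>\<^bsub>B\<^esub>} F" (is "ideal ?K F")
  proof (rule idealI[OF ring_F])
    show "subgroup ?K (add_monoid F)"
    proof (rule F.add.subgroupI)
      show "\<ominus>\<^bsub>F\<^esub> a \<in> ?K" if "a \<in> ?K" for a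
      proof -
        have "\<ominus>\<^bsub>F\<^esub> a = - a" using that by (intro F.add.inv_equality) auto
        then show ?thesis using that by (simp add: uminus)
      qed
      have "0 \<in> ?K" by (simp add: B.free_eval_zero[OF h])
      then show "?K \<noteq> {}" by (rule ex_in_conv[THEN iffD1, OF exI])
      show "a \<oplus>\<^bsub>F\<^esub> b \<in> ?K" if "a \<in> ?K" "b \<in> ?K" for a b using that by (simp add: add)
    qed blast
    show "x \<otimes>\<^bsub>F\<^esub> a \<in> ?K" "a \<otimes>\<^bsub>F\<^esub> x \<in> ?K" if "a \<in> ?K" "x \<in> carrier F" for a x
      using that by (simp_all add: mult e)
  qed
  have JK: "genideal F R \<subseteq> ?K"
    by (rule F.genideal_minimal[OF ker]) (use rel rels_closed in auto)
  have wd: "?e p = ?e r" if "p \<in> carrier F" "r \<in> carrier F" "cl p = cl r" for p r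
  proof -
    have "p - r \<in> ?K" using JK cl_eq_iff[OF that(1,2)] that(3) by blast
    then have "?e (p - r + r) = \<zero>\<^bsub>B\<^esub> \<oplus>\<^bsub>B\<^esub> ?e r" unfolding add by simp
    then show ?thesis using e by simp
  qed
  define f where "f = (\<lambda>x\<in>carrier A. ?e (SOME p. p \<in> carrier F \<and> x = cl p))"
  have f: "f (cl p) = ?e p" if "p \<in> carrier F" for p
  proof -
    let ?p = "SOME p'. p' \<in> carrier F \<and> cl p = cl p'"
    have "?p \<in> carrier F \<and> cl p = cl ?p"
      by (rule someI[of "\<lambda>p'. p' \<in> carrier F \<and> cl p = cl p'" p]) (use that in simp)
    then have "?e ?p = ?e p" using wd[of ?p p] that by simp
    then show ?thesis unfolding f_def using that by simp
  qed
  have "alg_hom A B f"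
  proof (intro alg_homI linear_onI)
    show "f \<one>\<^bsub>A\<^esub> = \<one>\<^bsub>B\<^esub>" using f[of 1] B.free_eval_one[OF h] by (simp add: A_sel)
    fix x y c assume "x \<in> carrier A"
    then obtain p where p: "p \<in> carrier F" "x = cl p" by (rule carrierE)
    show "f x \<in> carrier B" using p by (simp add: f e)
    show "f (c \<odot>\<^bsub>A\<^esub> x) = c \<odot>\<^bsub>B\<^esub> f x" using p by (simp add: f cl_smult B.free_eval_scalar_mult[OF h])
    assume "y \<in> carrier A"
    then obtain r where r: "r \<in> carrier F" "y = cl r" by (rule carrierE)
    show "f (x \<oplus>\<^bsub>A\<^esub> y) = f x \<oplus>\<^bsub>B\<^esub> f y" using p r by (simp add: f cl_add add)
    show "f (x \<otimes>\<^bsub>A\<^esub> y) = f x \<otimes>\<^bsub>B\<^esub> f y" using p r by (simp add: f cl_mult mult)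
  qed
  moreover have "f \<in> extensional (carrier A)" by (simp add: f_def)
  ultimately show ?thesis using f by blast
qed

text \<open>Reads the projection onto the quotient as evaluation at the classes of the generators.
  Relators thus evaluate to zero in \<open>A\<close> itself, which is how relations among generators
  are extracted later.\<close>

lemma cl_eq_free_eval:
  assumes "p \<in> carrier F"
  shows "cl p = free_eval A (\<lambda>g. if g \<in> G then cl (gen g) else \<zero>\<^bsub>A\<^esub>) p"
proof -
  \<comment> \<open>Evaluation expects a carrier value at every letter, hence the value zero outside
    \<open>G\<close>.\<close>
  let ?h = "\<lambda>g. if g \<in> G then cl (gen g) else \<zero>\<^bsub>A\<^esub>"
  have h: "?h g \<in> carrier A" for g by simp
  have word: "cl (Poly_Mapping.single (Word ws) 1) = word_prod A ?h (Word ws)" if "set ws \<subseteq> G" for ws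
    using that
  proof (induction ws)
    case Nil
    have "(Poly_Mapping.single (Word []) 1 :: 'g free_alg) = 1"
      by (simp add: zero_free_monoid_def[symmetric])
    then show ?case by (simp add: A_sel)
  qed (simp add: cl_gen_mult)
  from assms have "Poly_Mapping.keys p \<subseteq> {w. set (letters w) \<subseteq> G}" by (simp add: carrier_F)
  then show ?thesis
  proof (induction rule: poly_mapping_single_induct)
    case zero
    show ?case by (simp add: A_sel(3)[symmetric] A.free_eval_zero[OF h])
  next
    case (single w c)
    then have w: "set (letters w) \<subseteq> G" by simp
    then have "cl (Poly_Mapping.single w c) = c \<odot>\<^bsub>A\<^esub> cl (Poly_Mapping.single (Word (letters w)) 1)"
      by (simp add: cl_smult[OF carrier_F_closed(9)] scalar_def mult_single del: free_monoid.collapse)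
        (simp add: zero_free_monoid_def plus_free_monoid_def)
    then show ?case using word[OF w] by (simp add: A.free_eval_single[OF h])
  next
    case (add p r)
    then show ?case by (simp add: cl_add[symmetric] carrier_F A.free_eval_add[OF h])
  qed
qed

text \<open>Homogeneity of the relations makes \<open>x \<mapsto> \<plusminus> x\<close> on generators into an automorphism; it acts by
  \<open>1\<close> and \<open>- 1\<close> on the two homogeneous components, which therefore meet only in zero.\<close>

lemma parity_automorphism:
  assumes hom: "\<And>r. r \<in> R \<Longrightarrow> \<exists>d. hom_poly par d r"
  obtains \<alpha> where "linear_on A A \<alpha>" "\<And>d x. x \<in> homog A d \<Longrightarrow> \<alpha> x = ksign d \<odot>\<^bsub>A\<^esub> x"
proof -
  let ?h = "\<lambda>g. if g \<in> G then cl (gen g) else \<zero>\<^bsub>A\<^esub>"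
  let ?k = "\<lambda>g. ksign (par g) \<odot>\<^bsub>A\<^esub> ?h g"
  have h: "?h g \<in> carrier A" for g by simp
  have k: "?k g \<in> carrier A" for g by simp
  have word: "word_prod A ?k w = ksign (sum_list (map par (letters w))) \<odot>\<^bsub>A\<^esub> word_prod A ?h w" for w
  proof (cases w)
    case (Word ws)
    show ?thesis unfolding Word
    proof (induction ws)
      case (Cons g ws)
      let ?w = "word_prod A ?h (Word ws)" and ?s = "ksign (sum_list (map par ws)) :: Cq"
      have w: "?w \<in> carrier A" by (rule A.word_prod_closed[OF h])
      have "word_prod A ?k (Word (g # ws)) = ?k g \<otimes>\<^bsub>A\<^esub> (?s \<odot>\<^bsub>A\<^esub> ?w)"
        unfolding word_prod_simps Cons.IH by simp
      also have "\<dots> = (ksign (par g) * ?s) \<odot>\<^bsub>A\<^esub> (?h g \<otimes>\<^bsub>A\<^esub> ?w)"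
        using h w by (simp only: A.smult_mult_left A.smult_mult_right A.smult_smult A.smult_closed A.m_closed mult.commute)
      finally show ?case by (simp only: word_prod_simps free_monoid.sel list.map sum_list.Cons ksign_add)
    qed simp
  qed
  have ev: "free_eval A ?k p = ksign d \<odot>\<^bsub>A\<^esub> free_eval A ?h p" if "hom_poly par d p" for p d
  proof -
    have "linear_ext A (word_prod A ?k) p = linear_ext A (\<lambda>w. ksign d \<odot>\<^bsub>A\<^esub> word_prod A ?h w) p"
      using that word by (intro A.linear_ext_cong) (auto simp: hom_poly_def A.word_prod_closed[OF h])
    also have "\<dots> = ksign d \<odot>\<^bsub>A\<^esub> linear_ext A (word_prod A ?h) p"
      by (intro A.linear_ext_fun_smult) (simp add: A.word_prod_closed[OF h])
    finally show ?thesis by (simp add: free_eval_def)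
  qed
  have rel: "free_eval A ?k r = \<zero>\<^bsub>A\<^esub>" if r: "r \<in> R" for r
  proof -
    obtain d where "hom_poly par d r" using hom[OF r] by blast
    moreover have "free_eval A ?h r = \<zero>\<^bsub>A\<^esub>"
      using cl_eq_free_eval[of r] cl_rel[OF r] r rels_closed A_sel(3) by (metis subsetD)
    ultimately show ?thesis using ev[of d r] by simp
  qed
  obtain \<alpha> where \<alpha>: "alg_hom A A \<alpha>" "\<And>p. p \<in> carrier F \<Longrightarrow> \<alpha> (cl p) = free_eval A ?k p"
    using induced_hom[OF calg_A k rel] by auto
  show thesis
  proof (rule that)
    show "linear_on A A \<alpha>" using \<alpha>(1) by (rule alg_hom_linear)
    show "\<alpha> x = ksign d \<odot>\<^bsub>A\<^esub> x" if x: "x \<in> homog A d" for x d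
    proof -
      obtain p where p: "p \<in> carrier F" "hom_poly par d p" "x = cl p" using x by (auto simp: A_sel(4))
      show ?thesis unfolding p(3) \<alpha>(2)[OF p(1)] ev[OF p(2)] cl_eq_free_eval[OF p(1), symmetric] ..
    qed
  qed
qed

lemma hom_poly_split:
  obtains p0 p1 where "p = p0 + p1" "hom_poly par 0 p0" "hom_poly par 1 p1"
    "Poly_Mapping.keys p0 \<subseteq> Poly_Mapping.keys p" "Poly_Mapping.keys p1 \<subseteq> Poly_Mapping.keys p"
proof -
  have "\<exists>p0 p1. p = p0 + p1 \<and> hom_poly par 0 p0 \<and> hom_poly par 1 p1 \<and>
    Poly_Mapping.keys p0 \<subseteq> U \<and> Poly_Mapping.keys p1 \<subseteq> U" if "Poly_Mapping.keys p \<subseteq> U" for U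
    using that
  proof (induction rule: poly_mapping_single_induct)
    case zero
    show ?case by (rule exI[of _ 0], rule exI[of _ 0]) simp
  next
    case (single w c)
    have hom: "hom_poly par (sum_list (map par (letters w))) (Poly_Mapping.single w c)"
      "Poly_Mapping.keys (Poly_Mapping.single w c) \<subseteq> U"
      using single by (auto simp: hom_poly_def)
    have "Poly_Mapping.single w c = Poly_Mapping.single w c + 0" "Poly_Mapping.single w c = 0 + Poly_Mapping.single w c"
      by simp_all
    then show ?case using hom bit_cases[of "sum_list (map par (letters w))"]
      by (metis hom_poly_zero keys_zero empty_subsetI)
  next
    case (add p r)
    then obtain p0 p1 r0 r1 where *: "p = p0 + p1" "hom_poly par 0 p0" "hom_poly par 1 p1"
      "r = r0 + r1" "hom_poly par 0 r0" "hom_poly par 1 r1"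
      "Poly_Mapping.keys p0 \<subseteq> U" "Poly_Mapping.keys p1 \<subseteq> U" "Poly_Mapping.keys r0 \<subseteq> U" "Poly_Mapping.keys r1 \<subseteq> U"
      by blast
    show ?case
      by (rule exI[of _ "p0 + r0"], rule exI[of _ "p1 + r1"])
        (use * keys_add[of p0 r0] keys_add[of p1 r1] in \<open>auto simp: add_ac\<close>)
  qed
  then show thesis using that by blast
qed

lemma homog_subset: "homog A d \<subseteq> carrier A"
  by (auto simp: A_sel)

lemma superspace_A:
  assumes hom: "\<And>r. r \<in> R \<Longrightarrow> \<exists>d. hom_poly par d r"
  shows "superspace A"
  unfolding superspace_def
proof (intro conjI allI ballI)
  have mod: "module Cq_ring A" by (rule A.is_module)
  show "module Cq_ring A" by (rule mod)
  have add: "x \<oplus>\<^bsub>A\<^esub> y \<in> homog A d" if "x \<in> homog A d" "y \<in> homog A d" for x y d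
    using that by (auto simp: A_sel(4) cl_add)
  have smult: "c \<odot>\<^bsub>A\<^esub> x \<in> homog A d" if x: "x \<in> homog A d" for c x d
  proof -
    obtain p where p: "p \<in> carrier F" "hom_poly par d p" "x = cl p" using x by (auto simp: A_sel(4))
    then show ?thesis using hom_poly_mult[OF hom_poly_scalar p(2), of c] by (auto simp: A_sel(4) cl_smult simp del: add_bit_eq_xor)
  qed
  show "submodule (homog A d) Cq_ring A" for d
  proof (rule module.submoduleI[OF mod homog_subset])
    show "\<zero>\<^bsub>A\<^esub> \<in> homog A d" by (auto simp: A_sel(3,4))
    show "\<ominus>\<^bsub>A\<^esub> a \<in> homog A d" if "a \<in> homog A d" for a
      using smult[OF that, of "- 1"] A.smult_minus_one[of a] subsetD[OF homog_subset that] by simp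
  qed (use add smult in auto)
  obtain \<alpha> where \<alpha>: "linear_on A A \<alpha>" "\<And>d x. x \<in> homog A d \<Longrightarrow> \<alpha> x = ksign d \<odot>\<^bsub>A\<^esub> x"
    using parity_automorphism[OF hom] by blast
  \<comment> \<open>Adding the image under the parity automorphism cancels the odd part, so twice
    the even part is a function of \<open>x\<close>; uniqueness of the decomposition follows by
    halving.\<close>
  have even_part: "(2 :: Cq) \<odot>\<^bsub>A\<^esub> y = x \<oplus>\<^bsub>A\<^esub> \<alpha> x"
    if "y \<in> homog A 0" "z \<in> homog A 1" "x = y \<oplus>\<^bsub>A\<^esub> z" for x y z
  proof -
    have yz: "y \<in> carrier A" "z \<in> carrier A" using that homog_subset by auto
    have "\<alpha> x = y \<oplus>\<^bsub>A\<^esub> (- 1) \<odot>\<^bsub>A\<^esub> z"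
      using that yz by (simp add: linear_on_add[OF \<alpha>(1)] \<alpha>(2))
    then have "x \<oplus>\<^bsub>A\<^esub> \<alpha> x = y \<oplus>\<^bsub>A\<^esub> y \<oplus>\<^bsub>A\<^esub> (z \<oplus>\<^bsub>A\<^esub> \<ominus>\<^bsub>A\<^esub> z)"
      using that(3) yz by (simp add: A.smult_minus_one A.a_ac)
    also have "\<dots> = (1 + 1) \<odot>\<^bsub>A\<^esub> y"
      using yz by (simp only: A.smult_add_left A.smult_one A.r_neg A.r_zero A.a_closed)
    finally show ?thesis by simp
  qed
  fix x assume "x \<in> carrier A"
  then obtain p where p: "p \<in> carrier F" "x = cl p" by (rule carrierE)
  obtain p0 p1 where s: "p = p0 + p1" "hom_poly par 0 p0" "hom_poly par 1 p1"
    "Poly_Mapping.keys p0 \<subseteq> Poly_Mapping.keys p" "Poly_Mapping.keys p1 \<subseteq> Poly_Mapping.keys p"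
    by (rule hom_poly_split)
  then have "p0 \<in> carrier F" "p1 \<in> carrier F" using p(1) by (auto simp: carrier_F)
  with s p have ex: "cl p0 \<in> homog A 0 \<and> cl p1 \<in> homog A 1 \<and> x = cl p0 \<oplus>\<^bsub>A\<^esub> cl p1"
    by (auto simp: A_sel(4) cl_add)
  have uniq: "y = y' \<and> z = z'"
    if y: "y \<in> homog A 0" "z \<in> homog A 1" "x = y \<oplus>\<^bsub>A\<^esub> z"
      and y': "y' \<in> homog A 0" "z' \<in> homog A 1" "x = y' \<oplus>\<^bsub>A\<^esub> z'" for y z y' z'
  proof -
    have c: "y \<in> carrier A" "y' \<in> carrier A" "z \<in> carrier A" "z' \<in> carrier A"
      using y y' homog_subset by auto
    have "y = y'"
      using A.smult_cancel[OF _ _ two_nonzero, of y y'] even_part[OF y] even_part[OF y'] c by simp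
    then show ?thesis using y(3) y'(3) c by auto
  qed
  show "\<exists>!(y, z). y \<in> homog A 0 \<and> z \<in> homog A 1 \<and> x = y \<oplus>\<^bsub>A\<^esub> z"
    by (rule ex1I[of _ "(cl p0, cl p1)"]) (use ex uniq in auto)
qed

end

lemma (in presented) induced_hom_homog:
  assumes B: "salg B" and h: "\<And>g. h g \<in> carrier B" "\<And>g. g \<in> G \<Longrightarrow> h g \<in> homog B (par g)"
    and f: "\<And>p. p \<in> carrier F \<Longrightarrow> f (cl p) = free_eval B h p"
  shows "f ` homog A d \<subseteq> homog B d"
proof -
  interpret B: salg B by (rule B)
  have word: "word_prod B h (Word ws) \<in> homog B (sum_list (map par ws))" if "set ws \<subseteq> G" for ws
    using that
    by (induction ws) (auto intro: B.one_homog B.mult_homog h simp del: add_bit_eq_xor)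
  have "free_eval B h p \<in> homog B d" if "p \<in> carrier F" "hom_poly par d p" for p
    unfolding free_eval_def linear_ext_def
  proof (rule B.homog_finsum, rule Pi_I)
    fix w assume "w \<in> Poly_Mapping.keys p"
    then have "set (letters w) \<subseteq> G" "sum_list (map par (letters w)) = d"
      using that by (auto simp: carrier_F hom_poly_def)
    then show "Poly_Mapping.lookup p w \<odot>\<^bsub>B\<^esub> word_prod B h w \<in> homog B d"
      using word[of "letters w"] B.homog_smult by simp
  qed
  then show ?thesis by (auto simp: A_sel(4) f)
qed

section \<open>The defining relations in components\<close>

lemma finite_idx [simp]: "finite (idx n)"
  by (simp add: idx_def)

lemma idx_uminus [simp]: "- i \<in> idx n \<longleftrightarrow> i \<in> idx n"
  by (auto simp: idx_def)

lemma idx_nonzero: "i \<in> idx n \<Longrightarrow> i \<noteq> 0"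
  by (simp add: idx_def)

lemma ipar_uminus: "i \<noteq> 0 \<Longrightarrow> ipar (- i) = ipar i + 1"
  by (auto simp: ipar_def)

lemma bit_add_self [simp]: "(x :: bit) + x = 0" "x + (x + y) = y"
  using bit_cases[of x] bit_cases[of y] by auto

text \<open>Expresses that S is an even element. All Koszul exponents below are simplified under
  this parity constraint, the entries violating it being zero.\<close>

lemma Smat_even:
  assumes "Smat a b c d \<noteq> 0" "a \<noteq> 0" "c \<noteq> 0"
  shows "ipar a + ipar b + ipar c + ipar d = 0"
  using assms
  by (auto simp: Smat_def ipar_def of_bool_def split: if_splits)

lemma ksign_scalar: "ksign d = (scalar (ksign d) :: 'b free_alg)"
  using bit_cases[of d] by (auto simp: scalar_def single_uminus)

lemma double_sum_delta:
  fixes g :: "int \<Rightarrow> int \<Rightarrow> 'x::comm_monoid_add"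
  assumes "c0 \<in> C" "e0 \<in> E" "finite C" "finite E"
  shows "(\<Sum>c\<in>C. \<Sum>e\<in>E. if c = c0 \<and> e = e0 then g c e else 0) = g c0 e0"
proof -
  have "(\<Sum>e\<in>E. if c = c0 \<and> e = e0 then g c e else 0) = (if c = c0 then g c0 e0 else 0)" for c
    using assms by (auto simp: sum.delta)
  then show ?thesis using assms by (simp add: sum.delta)
qed

lemma scalar_add_mult: "scalar (c + d) * p = scalar c * p + scalar d * (p :: 'g free_alg)"
  by (simp only: scalar_simps(2)[symmetric] distrib_right)

lemma scalar_if_mult:
  "scalar (k * (if P then u else 0)) * p = (if P then scalar (k * u) * (p :: 'g free_alg) else 0)"
  by simp

text \<open>The conditions are turned so that \<open>a\<close> and \<open>c\<close> determine
  \<open>b\<close> and \<open>d\<close>: for fixed \<open>a\<close> and \<open>c\<close> at most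
  three entries survive, and each summand is a delta that a double sum can collapse.\<close>

lemma Smat_split:
  "Smat a b c d = (if b = a \<and> d = c then q powi phi a c else 0)
    + (if b = c \<and> a = d then of_bool (c < d) * (xi * ksign (ipar c)) else 0)
    + (if b = - c \<and> - a = d then of_bool (c < d) * (xi * ksign (ipar c)) else 0)"
proof -
  have e: "(a = b \<and> c = d) = (b = a \<and> d = c)" "(a = d \<and> b = c) = (b = c \<and> a = d)"
    "(a = - d \<and> b = - c) = (b = - c \<and> - a = d)"
    by (metis minus_equation_iff)+
  show ?thesis unfolding Smat_def e by (simp add: of_bool_def)
qed

text \<open>\<open>K\<close> is left arbitrary to make room for the Koszul sign of the matrix
  product. The surviving index pairs come from the diagonal of S and from its two off-diagonal
  families.\<close>

lemma Smat_sum_left: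
  fixes f :: "int \<Rightarrow> int \<Rightarrow> 'g free_alg"
  assumes "i \<in> idx m" "j \<in> idx m"
  shows "(\<Sum>c\<in>idx m. \<Sum>e\<in>idx m. scalar (K c e * Smat i c j e) * f c e) =
    scalar (K i j * q powi phi i j) * f i j
    + scalar (K j i * (of_bool (j < i) * (xi * ksign (ipar j)))) * f j i
    + scalar (K (- j) (- i) * (of_bool (j < - i) * (xi * ksign (ipar j)))) * f (- j) (- i)"
proof -
  have S: "Smat i c j e = (if c = i \<and> e = j then q powi phi i j else 0)
      + (if c = j \<and> e = i then of_bool (j < i) * (xi * ksign (ipar j)) else 0)
      + (if c = - j \<and> e = - i then of_bool (j < - i) * (xi * ksign (ipar j)) else 0)" for c e
  proof -
    have eqs: "(i = c) = (c = i)" "(c = j \<and> i = e) = (c = j \<and> e = i)" "(c = - j \<and> - i = e) = (c = - j \<and> e = - i)"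
      by (metis minus_equation_iff)+
    show ?thesis unfolding Smat_split eqs by (intro arg_cong2[of _ _ _ _ "(+)"] if_cong) simp_all
  qed
  have "scalar (K c e * Smat i c j e) * f c e =
      (if c = i \<and> e = j then scalar (K c e * q powi phi i j) * f c e else 0)
      + (if c = j \<and> e = i then scalar (K c e * (of_bool (j < i) * (xi * ksign (ipar j)))) * f c e else 0)
      + (if c = - j \<and> e = - i then scalar (K c e * (of_bool (j < - i) * (xi * ksign (ipar j)))) * f c e else 0)"
    for c e
    unfolding S distrib_left scalar_add_mult scalar_if_mult ..
  then show ?thesis
    using assms by (simp only: sum.distrib double_sum_delta finite_idx idx_uminus)
qed

text \<open>Here the column indices are the fixed ones. The last sign involves \<open>- a\<close>
  because S takes its sign from the row index of the second factor, which is \<open>- a\<close> in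
  that term.\<close>

lemma Smat_sum_right:
  fixes f :: "int \<Rightarrow> int \<Rightarrow> 'g free_alg"
  assumes "a \<in> idx n" "b \<in> idx n"
  shows "(\<Sum>c\<in>idx n. \<Sum>e\<in>idx n. scalar (K c e * Smat c a e b) * f c e) =
    scalar (K a b * q powi phi a b) * f a b
    + scalar (K b a * (of_bool (a < b) * (xi * ksign (ipar a)))) * f b a
    + scalar (K (- b) (- a) * (of_bool (- a < b) * (xi * ksign (ipar (- a))))) * f (- b) (- a)"
proof -
  have S: "Smat c a e b = (if c = a \<and> e = b then q powi phi a b else 0)
      + (if c = b \<and> e = a then of_bool (a < b) * (xi * ksign (ipar a)) else 0)
      + (if c = - b \<and> e = - a then of_bool (- a < b) * (xi * ksign (ipar (- a))) else 0)" for c e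
  proof -
    have eqs: "(a = c \<and> b = e) = (c = a \<and> e = b)" "(a = e \<and> c = b) = (c = b \<and> e = a)" "(a = - e \<and> - c = b) = (c = - b \<and> e = - a)"
      by (metis minus_equation_iff)+
    show ?thesis unfolding Smat_split eqs by (intro arg_cong2[of _ _ _ _ "(+)"] if_cong) simp_all
  qed
  have "scalar (K c e * Smat c a e b) * f c e =
      (if c = a \<and> e = b then scalar (K c e * q powi phi a b) * f c e else 0)
      + (if c = b \<and> e = a then scalar (K c e * (of_bool (a < b) * (xi * ksign (ipar a)))) * f c e else 0)
      + (if c = - b \<and> e = - a then scalar (K c e * (of_bool (- a < b) * (xi * ksign (ipar (- a))))) * f c e else 0)"
    for c e
    unfolding S distrib_left scalar_add_mult scalar_if_mult ..
  then show ?thesis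
    using assms by (simp only: sum.distrib double_sum_delta finite_idx idx_uminus)
qed

text \<open>The left side adds the exponents of the two successive matrix products in
  \<open>S T\<^sup>1 T\<^sup>2\<close>; the assumption is evenness of the entry of S. The total no
  longer depends on \<open>e\<close>.\<close>

lemma sign_exponent:
  fixes a b c e i j :: bit
  assumes "i + c + j + e = 0"
  shows "(i + a + j + e) * (e + b) + (j + e) * (c + a) = (c + a) * (b + j)"
  using assms by (cases i; cases a; cases j; cases e; cases b; cases c) simp_all

text \<open>\<open>slot1\<close> and \<open>slot2\<close> carry an identity matrix in the other
  factor, so of the four summations only those over the entries of S remain. Evenness of S then
  merges the two signs into one.\<close>

lemma relation_left:
  assumes "i \<in> idx m" "j \<in> idx m" "a \<in> idx n" "b \<in> idx n"
  shows "mat_mult (idx n) (idx m) (mat_mult (idx m) (idx m) Sfree (slot1 tfree)) (slot2 tfree) i a j b =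
    (\<Sum>c\<in>idx m. \<Sum>e\<in>idx m.
      scalar (ksign ((ipar c + ipar a) * (ipar b + ipar j)) * Smat i c j e) * (tfree c a * tfree e b))"
proof -
  have inner: "mat_mult (idx m) (idx m) Sfree (slot1 tfree) i a j e =
      (\<Sum>c\<in>idx m. scalar (ksign ((ipar j + ipar e) * (ipar c + ipar a)) * Smat i c j e) * tfree c a)"
    if e: "e \<in> idx m" for e
  proof -
    have "(\<Sum>e'\<in>idx m. ksign ((ipar i + ipar c + ipar j + ipar e') * (ipar c + ipar a + ipar e' + ipar e)
          + (ipar j + ipar e') * (ipar c + ipar a)) * Sfree i c j e' * slot1 tfree c a e' e) =
        scalar (ksign ((ipar j + ipar e) * (ipar c + ipar a)) * Smat i c j e) * tfree c a" (is "sum ?s _ = ?r") for c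
    proof -
      have "?s e' = (if e' = e then ?r else 0)" for e'
      proof (cases "e' = e \<and> Smat i c j e \<noteq> 0")
        case True
        then have p: "ipar i + ipar c + ipar j + ipar e = 0"
          using Smat_even assms idx_nonzero by blast
        have e': "e' = e" using True by simp
        show ?thesis unfolding e' slot1_def Sfree_def ksign_scalar[where 'b = "int \<times> int"]
          by (simp add: p del: add_bit_eq_xor)
      qed (auto simp: slot1_def Sfree_def)
      then show ?thesis using e by (simp add: sum.delta)
    qed
    then show ?thesis by (simp add: mat_mult_def)
  qed
  have "mat_mult (idx n) (idx m) (mat_mult (idx m) (idx m) Sfree (slot1 tfree)) (slot2 tfree) i a j b =
      (\<Sum>c\<in>idx n. if c = a then \<Sum>e\<in>idx m. ksign ((ipar i + ipar a + ipar j + ipar e) * (ipar e + ipar b))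
        * mat_mult (idx m) (idx m) Sfree (slot1 tfree) i a j e * tfree e b else 0)"
    unfolding mat_mult_def[of "idx n"]
    by (intro sum.cong refl) (auto simp: slot2_def simp del: add_bit_eq_xor)
  also have "\<dots> = (\<Sum>e\<in>idx m. ksign ((ipar i + ipar a + ipar j + ipar e) * (ipar e + ipar b))
        * mat_mult (idx m) (idx m) Sfree (slot1 tfree) i a j e * tfree e b)"
    using assms by (simp add: sum.delta)
  also have "\<dots> = (\<Sum>e\<in>idx m. \<Sum>c\<in>idx m.
      scalar (ksign ((ipar c + ipar a) * (ipar b + ipar j)) * Smat i c j e) * (tfree c a * tfree e b))"
  proof (intro sum.cong refl)
    fix e assume e: "e \<in> idx m"
    have "scalar (ksign ((ipar i + ipar a + ipar j + ipar e) * (ipar e + ipar b)))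
          * (scalar (ksign ((ipar j + ipar e) * (ipar c + ipar a)) * Smat i c j e) * tfree c a) * tfree e b =
        scalar (ksign ((ipar c + ipar a) * (ipar b + ipar j)) * Smat i c j e) * (tfree c a * tfree e b)" for c
    proof (cases "Smat i c j e = 0")
      case False
      then have p: "ipar i + ipar c + ipar j + ipar e = 0"
        using Smat_even assms idx_nonzero by blast
      have "ksign ((ipar i + ipar a + ipar j + ipar e) * (ipar e + ipar b)) * ksign ((ipar j + ipar e) * (ipar c + ipar a))
          = (ksign ((ipar c + ipar a) * (ipar b + ipar j)) :: Cq)"
        unfolding ksign_add[symmetric] sign_exponent[OF p] ..
      then show ?thesis
        by (simp only: mult.assoc[symmetric] scalar_simps)
    qed simp
    then show "ksign ((ipar i + ipar a + ipar j + ipar e) * (ipar e + ipar b))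
        * mat_mult (idx m) (idx m) Sfree (slot1 tfree) i a j e * tfree e b =
      (\<Sum>c\<in>idx m. scalar (ksign ((ipar c + ipar a) * (ipar b + ipar j)) * Smat i c j e) * (tfree c a * tfree e b))"
      unfolding inner[OF e] ksign_scalar[where 'b = "int \<times> int"] sum_distrib_left sum_distrib_right
      by (intro sum.cong refl)
  qed
  finally show ?thesis by (subst sum.swap)
qed

lemma scalar_mult_scalar: "scalar c * p * scalar d = scalar (c * d) * (p :: 'g free_alg)"
proof -
  have "scalar c * p * scalar d = scalar c * (scalar d * p)"
    by (simp only: mult.assoc scalar_commute[of d])
  then show ?thesis by (simp only: mult.assoc[symmetric] scalar_simps)
qed

text \<open>The product \<open>T\<^sup>2 T\<^sup>1\<close> is free of signs because the two summands
  of its exponent coincide and cancel. In the product with S evenness kills the first summand, and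
  the second one is the sign that stays.\<close>

lemma relation_right:
  assumes "i \<in> idx m" "j \<in> idx m" "a \<in> idx n" "b \<in> idx n"
  shows "mat_mult (idx n) (idx n) (mat_mult (idx m) (idx n) (slot2 tfree) (slot1 tfree)) Sfree i a j b =
    (\<Sum>c\<in>idx n. \<Sum>e\<in>idx n.
      scalar (ksign ((ipar j + ipar e) * (ipar c + ipar a)) * Smat c a e b) * (tfree j e * tfree i c))"
proof -
  have inner: "mat_mult (idx m) (idx n) (slot2 tfree) (slot1 tfree) i c j e = tfree j e * tfree i c"
    if e: "e \<in> idx n" for c e
  proof -
    have "mat_mult (idx m) (idx n) (slot2 tfree) (slot1 tfree) i c j e =
        (\<Sum>c'\<in>idx m. \<Sum>e'\<in>idx n. if c' = i \<and> e' = e then tfree j e * tfree i c else 0)"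
      unfolding mat_mult_def
      by (intro sum.cong refl) (auto simp: slot1_def slot2_def simp del: add_bit_eq_xor)
    then show ?thesis using assms e by (simp add: double_sum_delta)
  qed
  have "ksign ((ipar i + ipar c + ipar j + ipar e) * (ipar c + ipar a + ipar e + ipar b)
        + (ipar j + ipar e) * (ipar c + ipar a)) * (tfree j e * tfree i c) * Sfree c a e b =
      scalar (ksign ((ipar j + ipar e) * (ipar c + ipar a)) * Smat c a e b) * (tfree j e * tfree i c)"
    if c: "c \<in> idx n" "e \<in> idx n" for c e
  proof (cases "Smat c a e b = 0")
    case False
    then have p: "ipar c + ipar a + ipar e + ipar b = 0"
      using Smat_even assms c idx_nonzero by blast
    show ?thesis unfolding p Sfree_def ksign_scalar[where 'b = "int \<times> int"] mult_zero_right add_0_left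
      by (rule scalar_mult_scalar)
  qed (simp add: Sfree_def)
  then show ?thesis
    unfolding mat_mult_def[of "idx n" "idx n"] by (intro sum.cong refl) (simp only: inner)
qed

text \<open>The coefficient of \<open>E\<^sub>i\<^sub>a \<otimes> E\<^sub>j\<^sub>b\<close> in \<open>S T\<^sup>1 T\<^sup>2 = T\<^sup>2 T\<^sup>1 S\<close>, with the vanishing entries of \<open>S\<close> removed.\<close>

definition satisfies_rel :: "'b Cq_superalg \<Rightarrow> (int \<Rightarrow> int \<Rightarrow> 'b) \<Rightarrow> int \<Rightarrow> int \<Rightarrow> int \<Rightarrow> int \<Rightarrow> bool" where
  "satisfies_rel B t i a j b \<longleftrightarrow>
    (ksign ((ipar i + ipar a) * (ipar b + ipar j)) * q powi phi i j) \<odot>\<^bsub>B\<^esub> (t i a \<otimes>\<^bsub>B\<^esub> t j b)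
    \<oplus>\<^bsub>B\<^esub> (ksign ((ipar j + ipar a) * (ipar b + ipar j)) * (of_bool (j < i) * (xi * ksign (ipar j))))
      \<odot>\<^bsub>B\<^esub> (t j a \<otimes>\<^bsub>B\<^esub> t i b)
    \<oplus>\<^bsub>B\<^esub> (ksign ((ipar (- j) + ipar a) * (ipar b + ipar j)) * (of_bool (j < - i) * (xi * ksign (ipar j))))
      \<odot>\<^bsub>B\<^esub> (t (- j) a \<otimes>\<^bsub>B\<^esub> t (- i) b) =
    (ksign ((ipar j + ipar b) * (ipar a + ipar a)) * q powi phi a b) \<odot>\<^bsub>B\<^esub> (t j b \<otimes>\<^bsub>B\<^esub> t i a)
    \<oplus>\<^bsub>B\<^esub> (ksign ((ipar j + ipar a) * (ipar b + ipar a)) * (of_bool (a < b) * (xi * ksign (ipar a))))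
      \<odot>\<^bsub>B\<^esub> (t j a \<otimes>\<^bsub>B\<^esub> t i b)
    \<oplus>\<^bsub>B\<^esub> (ksign ((ipar j + ipar (- a)) * (ipar (- b) + ipar a)) * (of_bool (- a < b) * (xi * ksign (ipar (- a)))))
      \<odot>\<^bsub>B\<^esub> (t j (- a) \<otimes>\<^bsub>B\<^esub> t i (- b))"

lemma (in abelian_group) minus_eq_zero_iff:
  "x \<in> carrier G \<Longrightarrow> y \<in> carrier G \<Longrightarrow> x \<ominus> y = \<zero> \<longleftrightarrow> x = y"
  using add.inv_equality[of x "\<ominus> y"] by (auto simp: a_minus_def r_neg)

text \<open>Stated as an equivalence because it is read both ways: to verify the relations in a
  target algebra and to extract them in \<open>qcoord\<close> itself.\<close>

lemma free_eval_relator: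
  assumes B: "calg B" and t: "\<And>i a. t i a \<in> carrier B"
    and ia: "i \<in> idx m" "j \<in> idx m" "a \<in> idx n" "b \<in> idx n"
  shows "free_eval B (\<lambda>(i, a). t i a)
      (mat_mult (idx n) (idx m) (mat_mult (idx m) (idx m) Sfree (slot1 tfree)) (slot2 tfree) i a j b
        - mat_mult (idx n) (idx n) (mat_mult (idx m) (idx n) (slot2 tfree) (slot1 tfree)) Sfree i a j b) = \<zero>\<^bsub>B\<^esub>
    \<longleftrightarrow> satisfies_rel B t i a j b"
proof -
  interpret B: calg B by (rule B)
  let ?h = "\<lambda>(i, a). t i a"
  have h: "?h g \<in> carrier B" for g using t by (cases g) simp
  have ev: "free_eval B ?h (scalar c * (tfree i a * tfree j b)) = c \<odot>\<^bsub>B\<^esub> (t i a \<otimes>\<^bsub>B\<^esub> t j b)" for c i a j b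
    by (simp add: B.free_eval_scalar[OF h] B.free_eval_mult[OF h] tfree_def B.free_eval_gen[OF h]
        B.smult_mult_left t)
  show ?thesis
    unfolding relation_left[OF ia] relation_right[OF ia] satisfies_rel_def
      Smat_sum_left[OF ia(1,2), of "\<lambda>c e. ksign ((ipar c + ipar a) * (ipar b + ipar j))"]
      Smat_sum_right[OF ia(3,4), of "\<lambda>c e. ksign ((ipar j + ipar e) * (ipar c + ipar a))"]
      B.free_eval_diff[OF h] B.free_eval_add[OF h] ev
    by (intro B.minus_eq_zero_iff) (simp_all add: t)
qed

context presented
begin

lemma sum_closed [intro]: "(\<And>i. i \<in> S \<Longrightarrow> f i \<in> carrier F) \<Longrightarrow> sum f S \<in> carrier F"
  by (induction S rule: infinite_finite_induct) auto

lemma ksign_closed [simp, intro]: "ksign d \<in> carrier F"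
  by (simp add: ksign_scalar)

lemma Sfree_closed [simp, intro]: "Sfree a b c d \<in> carrier F"
  by (simp add: Sfree_def)

lemma mat_mult_closed:
  assumes "\<And>c e. c \<in> I \<Longrightarrow> e \<in> J \<Longrightarrow> M a c b e \<in> carrier F" "\<And>c e. c \<in> I \<Longrightarrow> e \<in> J \<Longrightarrow> M' c d e f \<in> carrier F"
  shows "mat_mult I J M M' a d b f \<in> carrier F"
  unfolding mat_mult_def using assms by (intro sum_closed carrier_F_closed ksign_closed) auto

lemma slot_closed:
  assumes "\<And>i j. i \<in> I \<Longrightarrow> j \<in> J \<Longrightarrow> M i j \<in> carrier F"
  shows "a \<in> I \<Longrightarrow> b \<in> J \<Longrightarrow> slot1 M a b c d \<in> carrier F" "c \<in> I \<Longrightarrow> d \<in> J \<Longrightarrow> slot2 M a b c d \<in> carrier F"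
  using assms by (auto simp: slot1_def slot2_def)

end

section \<open>Well-formedness and homogeneity of the two presentations\<close>

lemma presented_qcoord: "presented (qcoord_gens m n) (qcoord_rels m n)"
proof
  interpret P: presented "qcoord_gens m n" genpar "{}" by standard simp
  have t: "tfree i a \<in> carrier (free_algebra (qcoord_gens m n))" if "i \<in> idx m" "a \<in> idx n" for i a
    unfolding tfree_def using that by (intro P.carrier_F_closed) (simp add: qcoord_gens_def)
  note s = P.slot_closed[OF t]
  show "qcoord_rels m n \<subseteq> carrier (free_algebra (qcoord_gens m n))"
    unfolding qcoord_rels_def Let_def
    by (auto intro!: P.carrier_F_closed(5) P.mat_mult_closed t s)
qed

lemma mat_mult_hom_poly:
  assumes "\<And>c e. c \<in> I \<Longrightarrow> e \<in> J \<Longrightarrow> hom_poly par (ipar a + ipar c + ipar b + ipar e) (M a c b e)"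
    and "\<And>c e. c \<in> I \<Longrightarrow> e \<in> J \<Longrightarrow> hom_poly par (ipar c + ipar d + ipar e + ipar f) (M' c d e f)"
  shows "hom_poly par (ipar a + ipar d + ipar b + ipar f) (mat_mult I J M M' a d b f)"
  unfolding mat_mult_def
proof (intro hom_poly_sum)
  fix c e assume "c \<in> I" "e \<in> J"
  from hom_poly_mult[OF hom_poly_ksign[OF assms(1)[OF this]] assms(2)[OF this]]
  have "hom_poly par (ipar a + ipar c + ipar b + ipar e + (ipar c + ipar d + ipar e + ipar f))
    (ksign s * M a c b e * M' c d e f)" for s .
  \<comment> \<open>The parities of the two summation indices occur twice each and cancel.\<close>
  moreover have "x + y + z + w + (y + u + w + v) = x + u + z + v" for x y z w u v :: bit
    by (cases x; cases y; cases z; cases w; cases u; cases v) simp_all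
  ultimately show "hom_poly par (ipar a + ipar d + ipar b + ipar f)
      (ksign ((ipar a + ipar c + ipar b + ipar e) * (ipar c + ipar d + ipar e + ipar f)
        + (ipar b + ipar e) * (ipar c + ipar d)) * M a c b e * M' c d e f)" by metis
qed

lemma Sfree_hom_poly: "a \<noteq> 0 \<Longrightarrow> c \<noteq> 0 \<Longrightarrow> hom_poly par (ipar a + ipar b + ipar c + ipar d) (Sfree a b c d)"
  using Smat_even[of a b c d] by (cases "Smat a b c d = 0") (auto simp: Sfree_def simp del: add_bit_eq_xor)

lemma slot_hom_poly:
  assumes "\<And>i j. hom_poly par (ipar i + ipar j) (M i j)"
  shows "hom_poly par (ipar a + ipar b + ipar c + ipar d) (slot1 M a b c d)"
    "hom_poly par (ipar a + ipar b + ipar c + ipar d) (slot2 M a b c d)"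
proof -
  have "x + y + z + z = x + y" "z + z + x + y = x + y" for x y z :: bit
    by (cases x; cases y; cases z; simp)+
  then show "hom_poly par (ipar a + ipar b + ipar c + ipar d) (slot1 M a b c d)"
    "hom_poly par (ipar a + ipar b + ipar c + ipar d) (slot2 M a b c d)"
    using assms by (auto simp: slot1_def slot2_def simp del: add_bit_eq_xor)
qed

lemma presented_Uq: "presented (Uq_gens n) (Uq_rels n)"
proof
  interpret P: presented "Uq_gens n" genpar "{}" by standard simp
  have t: "Lfree i a \<in> carrier (free_algebra (Uq_gens n))" if "i \<in> idx n" "a \<in> idx n" for i a
    using that P.carrier_F_closed(8)[of "(i, a)"] P.carrier_F_closed(1) by (auto simp: Lfree_def Uq_gens_def)
  note s = P.slot_closed[OF t]
  show "Uq_rels n \<subseteq> carrier (free_algebra (Uq_gens n))"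
    unfolding Uq_rels_def Let_def
    by (auto intro!: P.carrier_F_closed(2,5,7) P.mat_mult_closed t s)
qed

lemma Lfree_hom_poly: "hom_poly genpar (ipar i + ipar j) (Lfree i j)"
  using hom_poly_gen[of genpar "(i, j)"] by (simp add: Lfree_def genpar_def del: add_bit_eq_xor)

lemma Uq_rels_hom_poly:
  assumes "r \<in> Uq_rels n"
  shows "\<exists>d. hom_poly genpar d r"
proof -
  have "hom_poly genpar 0 (Lfree i i * Lfree j j - 1)" for i j
    using hom_poly_mult[OF Lfree_hom_poly Lfree_hom_poly, of i i j j]
    by (intro hom_poly_diff) (simp_all del: add_bit_eq_xor)
  moreover have "hom_poly genpar (ipar a + ipar b + ipar c + ipar d)
      (mat_mult (idx n) (idx n) (mat_mult (idx n) (idx n) (slot1 Lfree) (slot2 Lfree)) Sfree a b c d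
        - mat_mult (idx n) (idx n) Sfree (mat_mult (idx n) (idx n) (slot2 Lfree) (slot1 Lfree)) a b c d)"
    if "a \<in> idx n" "b \<in> idx n" "c \<in> idx n" "d \<in> idx n" for a b c d
    using that
    by (intro hom_poly_diff mat_mult_hom_poly slot_hom_poly Lfree_hom_poly Sfree_hom_poly idx_nonzero)
  ultimately show ?thesis using assms unfolding Uq_rels_def Let_def by blast
qed

text \<open>The Koszul twist on \<open>Uq n\<close> enters the product rule of every action, and it
  is a well-defined linear operator only if \<open>Uq n\<close> is the direct sum of its homogeneous
  parts.\<close>

lemma sspace_Uq: "sspace (Uq n)"
proof -
  interpret P: presented "Uq_gens n" genpar "Uq_rels n" by (rule presented_Uq)
  show ?thesis
    using P.superspace_A[OF Uq_rels_hom_poly] by (intro sspace.intro) (simp add: P.A_def Uq_def)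
qed

lemma calg_Uq: "calg (Uq n)"
proof -
  interpret P: presented "Uq_gens n" genpar "Uq_rels n" by (rule presented_Uq)
  show ?thesis using P.calg_A by (simp add: P.A_def Uq_def)
qed

lemma Uq_L_homog:
  assumes "i \<in> idx n" "j \<in> idx n"
  shows "Uq_L n i j \<in> homog (Uq n) (ipar i + ipar j)"
proof -
  interpret P: presented "Uq_gens n" genpar "Uq_rels n" by (rule presented_Uq)
  have A: "P.A = Uq n" by (simp add: P.A_def Uq_def)
  have "Lfree i j \<in> carrier P.F"
    using assms P.carrier_F_closed(8)[of "(i, j)"] P.carrier_F_closed(1) by (auto simp: Lfree_def Uq_gens_def)
  then show ?thesis
    using P.A_sel(4)[of "ipar i + ipar j"] Lfree_hom_poly[of i j] by (auto simp: A Uq_L_def)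
qed

text \<open>Lets the coproduct sum run over all of \<open>idx n\<close>: the terms outside the
  triangular range vanish.\<close>

lemma Uq_L_zero: "j < i \<Longrightarrow> Uq_L n i j = \<zero>\<^bsub>Uq n\<^esub>"
proof -
  interpret P: presented "Uq_gens n" genpar "Uq_rels n" by (rule presented_Uq)
  have A: "P.A = Uq n" by (simp add: P.A_def Uq_def)
  assume "j < i"
  then show ?thesis using P.A_sel(3) by (simp add: A Uq_L_def Lfree_def)
qed

lemma Uq_induct [consumes 1, case_names one mult add smult]:
  assumes "u \<in> carrier (Uq n)" "P \<one>\<^bsub>Uq n\<^esub>"
    and "\<And>i j v. i \<in> idx n \<Longrightarrow> j \<in> idx n \<Longrightarrow> i \<le> j \<Longrightarrow> v \<in> carrier (Uq n) \<Longrightarrow> P v \<Longrightarrow> P (Uq_L n i j \<otimes>\<^bsub>Uq n\<^esub> v)"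
    and "\<And>u v. u \<in> carrier (Uq n) \<Longrightarrow> v \<in> carrier (Uq n) \<Longrightarrow> P u \<Longrightarrow> P v \<Longrightarrow> P (u \<oplus>\<^bsub>Uq n\<^esub> v)"
    and "\<And>c u. u \<in> carrier (Uq n) \<Longrightarrow> P u \<Longrightarrow> P (c \<odot>\<^bsub>Uq n\<^esub> u)"
  shows "P u"
proof -
  interpret P: presented "Uq_gens n" genpar "Uq_rels n" by (rule presented_Uq)
  have A: "P.A = Uq n" by (simp add: P.A_def Uq_def)
  have step: "P (P.cl (gen g) \<otimes>\<^bsub>Uq n\<^esub> y)" if "g \<in> Uq_gens n" "y \<in> carrier (Uq n)" "P y" for g y
    using that assms(3)[of "fst g" "snd g" y] by (auto simp: Uq_gens_def Uq_L_def Lfree_def)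
  show ?thesis by (rule P.presented_induct[unfolded A, OF assms(1,2) step assms(4,5)])
qed


section \<open>Homomorphisms between quantum coordinate superalgebras\<close>

lemma calg_qcoord: "calg (qcoord m n)"
proof -
  interpret P: presented "qcoord_gens m n" genpar "qcoord_rels m n" by (rule presented_qcoord)
  show ?thesis using P.calg_A by (simp add: P.A_def qcoord_def)
qed

lemma qcoord_t_homog:
  assumes "i \<in> idx m" "a \<in> idx n"
  shows "qcoord_t m n i a \<in> homog (qcoord m n) (ipar i + ipar a)"
proof -
  interpret P: presented "qcoord_gens m n" genpar "qcoord_rels m n" by (rule presented_qcoord)
  have A: "P.A = qcoord m n" by (simp add: P.A_def qcoord_def)
  have "tfree i a \<in> carrier P.F"
    using assms P.carrier_F_closed(8)[of "(i, a)"] by (auto simp: tfree_def qcoord_gens_def)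
  moreover have "hom_poly genpar (ipar i + ipar a) (tfree i a)"
    using hom_poly_gen[of genpar "(i, a)"] by (simp add: tfree_def genpar_def del: add_bit_eq_xor)
  ultimately show ?thesis
    using P.A_sel(4)[of "ipar i + ipar a"] by (auto simp: A qcoord_t_def)
qed

lemma qcoord_t_closed: "i \<in> idx m \<Longrightarrow> a \<in> idx n \<Longrightarrow> qcoord_t m n i a \<in> carrier (qcoord m n)"
proof -
  interpret P: presented "qcoord_gens m n" genpar "qcoord_rels m n" by (rule presented_qcoord)
  have A: "P.A = qcoord m n" by (simp add: P.A_def qcoord_def)
  show "i \<in> idx m \<Longrightarrow> a \<in> idx n \<Longrightarrow> qcoord_t m n i a \<in> carrier (qcoord m n)"
    by (rule subsetD[OF P.homog_subset[unfolded A] qcoord_t_homog])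
qed

lemma qcoord_t_uminus:
  assumes "i \<in> idx m" "a \<in> idx n"
  shows "qcoord_t m n (- i) (- a) = qcoord_t m n i a"
proof -
  interpret P: presented "qcoord_gens m n" genpar "qcoord_rels m n" by (rule presented_qcoord)
  have "tfree i a - tfree (- i) (- a) \<in> qcoord_rels m n"
    using assms by (auto simp: qcoord_rels_def Let_def)
  then have "P.cl (tfree i a) = P.cl (tfree (- i) (- a))"
    using assms P.carrier_F_closed(8)[of "(i, a)"] P.carrier_F_closed(8)[of "(- i, - a)"]
    by (intro P.cl_relD) (auto simp: tfree_def qcoord_gens_def)
  then show ?thesis by (simp add: qcoord_t_def)
qed

text \<open>The parity clause is conditional so that one statement serves two kinds of target: a
  graded one for the embeddings \<open>iota\<close> and the ungraded endomorphism algebra for the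
  inverse of \<open>\<sigma>\<close>.\<close>

lemma qcoord_hom_exists:
  assumes B: "calg B" and t: "\<And>i a. t i a \<in> carrier B"
    and sym: "\<And>i a. i \<in> idx m \<Longrightarrow> a \<in> idx n \<Longrightarrow> t (- i) (- a) = t i a"
    and rel: "\<And>i a j b. i \<in> idx m \<Longrightarrow> j \<in> idx m \<Longrightarrow> a \<in> idx n \<Longrightarrow> b \<in> idx n \<Longrightarrow> satisfies_rel B t i a j b"
  shows "\<exists>f\<in>extensional (carrier (qcoord m n)). alg_hom (qcoord m n) B f \<and>
    (\<forall>i\<in>idx m. \<forall>a\<in>idx n. f (qcoord_t m n i a) = t i a) \<and>
    ((\<forall>i\<in>idx m. \<forall>a\<in>idx n. t i a \<in> homog B (ipar i + ipar a)) \<longrightarrow> salg B \<longrightarrow>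
      (\<forall>d. f ` homog (qcoord m n) d \<subseteq> homog B d))"
proof -
  interpret P: presented "qcoord_gens m n" genpar "qcoord_rels m n" by (rule presented_qcoord)
  interpret B: calg B by (rule B)
  have A: "P.A = qcoord m n" by (simp add: P.A_def qcoord_def)
  let ?h = "\<lambda>(i, a). t i a"
  have h: "?h g \<in> carrier B" for g using t by (cases g) simp
  have "free_eval B ?h r = \<zero>\<^bsub>B\<^esub>" if r: "r \<in> qcoord_rels m n" for r
    using r unfolding qcoord_rels_def Let_def
  proof (elim UnE CollectE exE conjE)
    fix i a assume "r = tfree i a - tfree (- i) (- a)" "i \<in> idx m" "a \<in> idx n"
    then show ?thesis
      using t by (simp add: B.free_eval_diff[OF h] tfree_def B.free_eval_gen[OF h] sym B.minus_eq_zero_iff)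
  next
    fix i a j b assume r': "r = mat_mult (idx n) (idx m) (mat_mult (idx m) (idx m) Sfree (slot1 tfree)) (slot2 tfree) i a j b
        - mat_mult (idx n) (idx n) (mat_mult (idx m) (idx n) (slot2 tfree) (slot1 tfree)) Sfree i a j b"
      and ia: "i \<in> idx m" "a \<in> idx n" "j \<in> idx m" "b \<in> idx n"
    show ?thesis
      unfolding r' using free_eval_relator[where t = t, OF B t ia(1,3,2,4)] rel[OF ia(1,3,2,4)] by (rule iffD2)
  qed
  from P.induced_hom[OF B h this] obtain f where f: "f \<in> extensional (carrier P.A)" "alg_hom P.A B f"
    "\<forall>p\<in>carrier P.F. f (P.cl p) = free_eval B ?h p" by blast
  have gens: "f (qcoord_t m n i a) = t i a" if "i \<in> idx m" "a \<in> idx n" for i a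
    using f(3) that P.carrier_F_closed(8)[of "(i, a)"]
    by (auto simp: qcoord_t_def tfree_def qcoord_gens_def B.free_eval_gen[OF h])
  have "f ` homog P.A d \<subseteq> homog B d"
    if "\<forall>i\<in>idx m. \<forall>a\<in>idx n. t i a \<in> homog B (ipar i + ipar a)" "salg B" for d
  proof (rule P.induced_hom_homog[OF that(2) h])
    show "?h g \<in> homog B (genpar g)" if "g \<in> qcoord_gens m n" for g
      using that \<open>\<forall>i\<in>idx m. \<forall>a\<in>idx n. t i a \<in> homog B (ipar i + ipar a)\<close>
      by (auto simp: qcoord_gens_def genpar_def simp del: add_bit_eq_xor)
  qed (use f(3) in blast)
  then show ?thesis using f gens unfolding A by blast
qed

lemma qcoord_rel:
  assumes "i \<in> idx m" "j \<in> idx m" "a \<in> idx n" "b \<in> idx n"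
  shows "satisfies_rel (qcoord m n) (qcoord_t m n) i a j b"
proof -
  interpret P: presented "qcoord_gens m n" genpar "qcoord_rels m n" by (rule presented_qcoord)
  have A: "P.A = qcoord m n" by (simp add: P.A_def qcoord_def)
  let ?h = "\<lambda>g. if g \<in> qcoord_gens m n then P.cl (gen g) else \<zero>\<^bsub>P.A\<^esub>"
  let ?t = "\<lambda>i a. ?h (i, a)"
  let ?r = "mat_mult (idx n) (idx m) (mat_mult (idx m) (idx m) Sfree (slot1 tfree)) (slot2 tfree) i a j b
        - mat_mult (idx n) (idx n) (mat_mult (idx m) (idx n) (slot2 tfree) (slot1 tfree)) Sfree i a j b"
  have r: "?r \<in> qcoord_rels m n" using assms unfolding qcoord_rels_def Let_def by blast
  have h: "(\<lambda>(i, a). ?t i a) = ?h" by auto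
  have "free_eval P.A ?h ?r = P.cl ?r"
    using r P.rels_closed by (intro P.cl_eq_free_eval[symmetric]) blast
  then have "free_eval P.A (\<lambda>(i, a). ?t i a) ?r = \<zero>\<^bsub>P.A\<^esub>"
    unfolding h using P.cl_rel[OF r] by (simp add: P.A_sel(3))
  moreover have "?t i a \<in> carrier P.A" for i a by simp
  ultimately have "satisfies_rel P.A ?t i a j b"
    using free_eval_relator[where t = ?t, OF P.calg_A _ assms] by (metis (no_types, lifting))
  then show ?thesis
    using assms unfolding satisfies_rel_def A
    by (simp add: qcoord_t_def tfree_def qcoord_gens_def del: add_bit_eq_xor)
qed

text \<open>Negating both indices of a generator does not change it, so positive rows suffice. These
  are also the rows on which the braiding and \<open>iota\<close> are prescribed.\<close>

lemma qcoord_induct [consumes 1, case_names one mult add smult]: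
  assumes "x \<in> carrier (qcoord m n)" "P \<one>\<^bsub>qcoord m n\<^esub>"
    and mult: "\<And>i a y. i \<in> {1..int m} \<Longrightarrow> a \<in> idx n \<Longrightarrow> y \<in> carrier (qcoord m n) \<Longrightarrow> P y \<Longrightarrow>
      P (qcoord_t m n i a \<otimes>\<^bsub>qcoord m n\<^esub> y)"
    and "\<And>x y. x \<in> carrier (qcoord m n) \<Longrightarrow> y \<in> carrier (qcoord m n) \<Longrightarrow> P x \<Longrightarrow> P y \<Longrightarrow> P (x \<oplus>\<^bsub>qcoord m n\<^esub> y)"
    and "\<And>c x. x \<in> carrier (qcoord m n) \<Longrightarrow> P x \<Longrightarrow> P (c \<odot>\<^bsub>qcoord m n\<^esub> x)"
  shows "P x"
proof -
  interpret P: presented "qcoord_gens m n" genpar "qcoord_rels m n" by (rule presented_qcoord)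
  have A: "P.A = qcoord m n" by (simp add: P.A_def qcoord_def)
  have step: "P (P.cl (gen g) \<otimes>\<^bsub>qcoord m n\<^esub> y)" if g: "g \<in> qcoord_gens m n" and y: "y \<in> carrier (qcoord m n)" "P y" for g y
  proof -
    obtain i a where ia: "g = (i, a)" "i \<in> idx m" "a \<in> idx n" using g by (auto simp: qcoord_gens_def)
    then have cl: "P.cl (gen g) = qcoord_t m n i a" by (simp add: qcoord_t_def tfree_def)
    show ?thesis
    proof (cases "0 < i")
      case True
      then show ?thesis using mult[of i a y] ia y unfolding cl by (auto simp: idx_def)
    next
      case False
      then have "- i \<in> {1..int m}" "- a \<in> idx n" using ia by (auto simp: idx_def)
      then show ?thesis using mult[of "- i" "- a" y] qcoord_t_uminus[OF ia(2,3)] y unfolding cl by simp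
    qed
  qed
  show ?thesis by (rule P.presented_induct[unfolded A, OF assms(1,2) step assms(4,5)])
qed

lemma qcoord_hom_eqI:
  assumes f: "alg_hom (qcoord m n) B f" and g: "alg_hom (qcoord m n) B g"
    and gens: "\<And>i a. i \<in> {1..int m} \<Longrightarrow> a \<in> idx n \<Longrightarrow> f (qcoord_t m n i a) = g (qcoord_t m n i a)"
    and x: "x \<in> carrier (qcoord m n)"
  shows "f x = g x"
  using x
proof (induction rule: qcoord_induct)
  case one
  show ?case using f g by (simp add: alg_hom_one)
next
  case (mult i a y)
  then have "i \<in> idx m" by (auto simp: idx_def)
  then show ?case using mult qcoord_t_closed gens by (simp add: alg_hom_mult[OF f] alg_hom_mult[OF g])
next
  case (add x y)
  then show ?case by (simp add: linear_on_add[OF alg_hom_linear[OF f]] linear_on_add[OF alg_hom_linear[OF g]])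
next
  case (smult c x)
  then show ?case by (simp add: linear_on_smult[OF alg_hom_linear[OF f]] linear_on_smult[OF alg_hom_linear[OF g]])
qed

text \<open>The row shift underlying \<^const>\<open>iota\<close>: it is odd and strictly increasing, hence
  compatible with every sign and every comparison in the defining relations.\<close>

definition row_shift :: "nat \<Rightarrow> int \<Rightarrow> int" where
  "row_shift s i = (if i < 0 then i - int s else i + int s)"

lemma row_shift_simps:
  assumes "i \<noteq> 0"
  shows "row_shift s (- i) = - row_shift s i" "ipar (row_shift s i) = ipar i" "row_shift s i \<noteq> 0"
  using assms by (auto simp: row_shift_def ipar_def)

lemma row_shift_compare:
  assumes "i \<noteq> 0" "j \<noteq> 0"
  shows "row_shift s i = row_shift s j \<longleftrightarrow> i = j" "row_shift s i = - row_shift s j \<longleftrightarrow> i = - j"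
    "row_shift s i < row_shift s j \<longleftrightarrow> i < j" "row_shift s i < - row_shift s j \<longleftrightarrow> i < - j"
  using assms by (auto simp: row_shift_def)

lemma row_shift_idx: "i \<in> idx m \<Longrightarrow> m + s \<le> m' \<Longrightarrow> row_shift s i \<in> idx m'"
  by (auto simp: idx_def row_shift_def)

lemma satisfies_rel_shift:
  assumes "i \<noteq> 0" "j \<noteq> 0"
  shows "satisfies_rel B t (row_shift s i) a (row_shift s j) b \<longleftrightarrow> satisfies_rel B (\<lambda>i. t (row_shift s i)) i a j b"
proof -
  have "phi (row_shift s i) (row_shift s j) = phi i j"
    using assms by (simp add: phi_def row_shift_simps row_shift_compare)
  moreover have "ipar (- row_shift s j) = ipar (- j)"
    using assms by (simp add: ipar_uminus row_shift_simps del: add_bit_eq_xor)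
  ultimately show ?thesis
    using assms by (simp add: satisfies_rel_def row_shift_simps row_shift_compare del: add_bit_eq_xor)
qed

lemma satisfies_rel_image:
  assumes "calg A" "calg B" and f: "alg_hom A B f" and t: "\<And>i a. i \<in> idx m \<Longrightarrow> a \<in> idx n \<Longrightarrow> t i a \<in> carrier A"
    and ia: "i \<in> idx m" "j \<in> idx m" "a \<in> idx n" "b \<in> idx n"
    and rel: "satisfies_rel A t i a j b"
  shows "satisfies_rel B (\<lambda>i a. f (t i a)) i a j b"
proof -
  interpret A: calg A by fact
  interpret B: calg B by fact
  note lin = alg_hom_linear[OF f]
  from arg_cong[OF rel[unfolded satisfies_rel_def], of f] show ?thesis
    unfolding satisfies_rel_def using ia
    by (simp add: linear_on_add[OF lin] linear_on_smult[OF lin] alg_hom_mult[OF f] t del: add_bit_eq_xor)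
qed

text \<open>Resolves the definite description: existence is the universal property applied to
  shifted rows, uniqueness holds because extensional homomorphisms agreeing on positive rows are
  equal.\<close>

lemma iota_props:
  assumes "m + s \<le> m'" "salg (qcoord m' n)"
  shows "superalgebra_hom (qcoord m n) (qcoord m' n) (iota n m m' s)"
    and "\<And>i a. i \<in> {1..int m} \<Longrightarrow> a \<in> idx n \<Longrightarrow> iota n m m' s (qcoord_t m n i a) = qcoord_t m' n (int s + i) a"
proof -
  let ?B = "qcoord m' n"
  interpret B: calg ?B by (rule calg_qcoord)
  \<comment> \<open>Zero outside the index ranges, since the universal property is stated for
    families with all values in the carrier.\<close>
  let ?t = "\<lambda>i a. if i \<in> idx m \<and> a \<in> idx n then qcoord_t m' n (row_shift s i) a else \<zero>\<^bsub>?B\<^esub>"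
  let ?P = "\<lambda>f. f \<in> extensional (carrier (qcoord m n)) \<and> superalgebra_hom (qcoord m n) ?B f \<and>
     (\<forall>i\<in>{1..int m}. \<forall>a\<in>idx n. f (qcoord_t m n i a) = qcoord_t m' n (int s + i) a)"
  have sh: "row_shift s i \<in> idx m'" if "i \<in> idx m" for i
    using row_shift_idx that assms(1) by blast
  have t: "?t i a \<in> carrier ?B" for i a using sh qcoord_t_closed by auto
  have hom: "?t i a \<in> homog ?B (ipar i + ipar a)" if "i \<in> idx m" "a \<in> idx n" for i a
    using qcoord_t_homog[OF sh that(2), of i] that idx_nonzero[OF that(1)] row_shift_simps(2)[of i s] by simp
  have "\<exists>f\<in>extensional (carrier (qcoord m n)). alg_hom (qcoord m n) ?B f \<and>
    (\<forall>i\<in>idx m. \<forall>a\<in>idx n. f (qcoord_t m n i a) = ?t i a) \<and>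
    ((\<forall>i\<in>idx m. \<forall>a\<in>idx n. ?t i a \<in> homog ?B (ipar i + ipar a)) \<longrightarrow> salg ?B \<longrightarrow>
      (\<forall>d. f ` homog (qcoord m n) d \<subseteq> homog ?B d))"
  proof (rule qcoord_hom_exists[OF calg_qcoord t])
    show "?t (- i) (- a) = ?t i a" if "i \<in> idx m" "a \<in> idx n" for i a
      using that qcoord_t_uminus[OF sh[OF that(1)] that(2)] idx_nonzero[OF that(1)] row_shift_simps(1)[of i s] by simp
    fix i a j b assume ia: "i \<in> idx m" "j \<in> idx m" "a \<in> idx n" "b \<in> idx n"
    have "satisfies_rel ?B (qcoord_t m' n) (row_shift s i) a (row_shift s j) b"
      using qcoord_rel sh ia by blast
    then have "satisfies_rel ?B (\<lambda>i. qcoord_t m' n (row_shift s i)) i a j b"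
      using satisfies_rel_shift ia idx_nonzero by blast
    then show "satisfies_rel ?B ?t i a j b"
      using ia unfolding satisfies_rel_def by (simp del: add_bit_eq_xor)
  qed
  then obtain f where f: "f \<in> extensional (carrier (qcoord m n))" "alg_hom (qcoord m n) ?B f"
    "\<forall>i\<in>idx m. \<forall>a\<in>idx n. f (qcoord_t m n i a) = ?t i a"
    "(\<forall>i\<in>idx m. \<forall>a\<in>idx n. ?t i a \<in> homog ?B (ipar i + ipar a)) \<longrightarrow> salg ?B \<longrightarrow>
      (\<forall>d. f ` homog (qcoord m n) d \<subseteq> homog ?B d)"
    by (elim bexE conjE)
  have f4: "\<forall>d. f ` homog (qcoord m n) d \<subseteq> homog ?B d"
    by (rule mp[OF mp[OF f(4)] assms(2)]) (intro ballI hom)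
  have pos: "i \<in> idx m" "row_shift s i = int s + i" if "i \<in> {1..int m}" for i
    using that by (auto simp: idx_def row_shift_def)
  have gens: "f (qcoord_t m n i a) = qcoord_t m' n (int s + i) a" if "i \<in> {1..int m}" "a \<in> idx n" for i a
    using f(3) pos[OF that(1)] that(2) by simp
  have Pf: "?P f"
    using f(1,2) f4 gens by (simp add: superalgebra_hom_iff)
  have "g = f" if g: "?P g" for g
  proof (rule extensionalityI[OF conjunct1[OF g] f(1)])
    have hg: "alg_hom (qcoord m n) ?B g" using g by (simp add: superalgebra_hom_iff)
    fix x assume x: "x \<in> carrier (qcoord m n)"
    show "g x = f x"
      by (rule qcoord_hom_eqI[OF hg f(2) _ x]) (use g gens in simp)
  qed
  then have "iota n m m' s = f" unfolding iota_def by (intro the_equality[of ?P, OF Pf])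
  then show "superalgebra_hom (qcoord m n) ?B (iota n m m' s)"
    "\<And>i a. i \<in> {1..int m} \<Longrightarrow> a \<in> idx n \<Longrightarrow> iota n m m' s (qcoord_t m n i a) = qcoord_t m' n (int s + i) a"
    using Pf by simp_all
qed

section \<open>The endomorphism algebra of a module\<close>

text \<open>Operators are cut off outside the carrier so that equal operators are equal as HOL
  functions. The grading is only a placeholder.\<close>

definition End_alg :: "'a Cq_superalg \<Rightarrow> ('a \<Rightarrow> 'a) Cq_superalg" where
  "End_alg M = \<lparr>carrier = {f \<in> extensional (carrier M). linear_on M M f},
     monoid.mult = (\<lambda>f g. \<lambda>x\<in>carrier M. f (g x)), one = (\<lambda>x\<in>carrier M. x),
     zero = (\<lambda>x\<in>carrier M. \<zero>\<^bsub>M\<^esub>), add = (\<lambda>f g. \<lambda>x\<in>carrier M. f x \<oplus>\<^bsub>M\<^esub> g x),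
     module.smult = (\<lambda>c f. \<lambda>x\<in>carrier M. c \<odot>\<^bsub>M\<^esub> f x), homog = (\<lambda>_. {})\<rparr>"

context cmod
begin

lemma End_sel [simp]:
  "f \<otimes>\<^bsub>End_alg M\<^esub> g = (\<lambda>x\<in>carrier M. f (g x))" "\<one>\<^bsub>End_alg M\<^esub> = (\<lambda>x\<in>carrier M. x)"
  "\<zero>\<^bsub>End_alg M\<^esub> = (\<lambda>x\<in>carrier M. \<zero>)" "f \<oplus>\<^bsub>End_alg M\<^esub> g = (\<lambda>x\<in>carrier M. f x \<oplus> g x)"
  "c \<odot>\<^bsub>End_alg M\<^esub> f = (\<lambda>x\<in>carrier M. c \<odot> f x)"
  by (simp_all add: End_alg_def)

lemma mem_End: "f \<in> carrier (End_alg M) \<longleftrightarrow> f \<in> extensional (carrier M) \<and> linear_on M M f"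
  by (simp add: End_alg_def)

lemma EndI: "linear_on M M f \<Longrightarrow> restrict f (carrier M) \<in> carrier (End_alg M)"
  by (auto simp: mem_End linear_on_def Pi_iff)

lemma End_apply [simp]:
  assumes "f \<in> carrier (End_alg M)" "x \<in> carrier M"
  shows "f x \<in> carrier M" "y \<in> carrier M \<Longrightarrow> f (x \<oplus> y) = f x \<oplus> f y" "f (c \<odot> x) = c \<odot> f x"
  using assms by (auto simp: mem_End linear_on_def Pi_iff)

lemma End_eqI:
  assumes "f \<in> carrier (End_alg M)" "g \<in> carrier (End_alg M)" "\<And>x. x \<in> carrier M \<Longrightarrow> f x = g x"
  shows "f = g"
  using assms by (intro extensionalityI[of f "carrier M" g]) (auto simp: mem_End)

lemma End_closed:
  assumes f: "f \<in> carrier (End_alg M)" and g: "g \<in> carrier (End_alg M)"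
  shows "f \<otimes>\<^bsub>End_alg M\<^esub> g \<in> carrier (End_alg M)" "f \<oplus>\<^bsub>End_alg M\<^esub> g \<in> carrier (End_alg M)"
    "c \<odot>\<^bsub>End_alg M\<^esub> f \<in> carrier (End_alg M)" "\<one>\<^bsub>End_alg M\<^esub> \<in> carrier (End_alg M)"
    "\<zero>\<^bsub>End_alg M\<^esub> \<in> carrier (End_alg M)"
  unfolding End_sel using f g
  by (auto intro!: EndI linear_onI simp: smult_add_right smult_smult mult.commute a_ac)

lemma calg_End: "calg (End_alg M)"
proof -
  let ?E = "End_alg M"
  note c = End_closed[unfolded End_sel]
  have grp: "abelian_group ?E"
  proof (rule abelian_groupI)
    show "x \<oplus>\<^bsub>?E\<^esub> y \<in> carrier ?E" if "x \<in> carrier ?E" "y \<in> carrier ?E" for x y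
      using End_closed(2)[OF that] .
    show "\<zero>\<^bsub>?E\<^esub> \<in> carrier ?E" unfolding End_sel by (intro EndI linear_onI) auto
    show "x \<oplus>\<^bsub>?E\<^esub> y \<oplus>\<^bsub>?E\<^esub> z = x \<oplus>\<^bsub>?E\<^esub> (y \<oplus>\<^bsub>?E\<^esub> z)"
      if "x \<in> carrier ?E" "y \<in> carrier ?E" "z \<in> carrier ?E" for x y z
      using that by (auto simp: a_assoc intro!: restrict_ext)
    show "x \<oplus>\<^bsub>?E\<^esub> y = y \<oplus>\<^bsub>?E\<^esub> x" if "x \<in> carrier ?E" "y \<in> carrier ?E" for x y
      using that by (auto simp: a_comm intro!: restrict_ext)
    show "\<zero>\<^bsub>?E\<^esub> \<oplus>\<^bsub>?E\<^esub> x = x" if x: "x \<in> carrier ?E" for x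
      by (rule End_eqI[OF End_closed(2)[OF End_closed(5)[OF x x] x] x]) (use x in simp)
    show "\<exists>y\<in>carrier ?E. y \<oplus>\<^bsub>?E\<^esub> x = \<zero>\<^bsub>?E\<^esub>" if x: "x \<in> carrier ?E" for x
      by (rule bexI[of _ "(- 1) \<odot>\<^bsub>?E\<^esub> x"], rule End_eqI)
        (use End_closed(2)[OF End_closed(3)[OF x x] x] End_closed(3,5)[OF x x] x in
          \<open>auto simp: smult_minus_one l_neg simp del: End_sel(1) intro!: restrict_ext\<close>)
  qed
  have ring: "ring ?E"
  proof (rule ringI[OF grp])
    show "Group.monoid ?E"
    proof (rule monoidI)
      show "x \<otimes>\<^bsub>?E\<^esub> y \<in> carrier ?E" if "x \<in> carrier ?E" "y \<in> carrier ?E" for x y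
        using End_closed(1)[OF that] .
      show "\<one>\<^bsub>?E\<^esub> \<in> carrier ?E" unfolding End_sel by (intro EndI linear_onI) auto
      show "x \<otimes>\<^bsub>?E\<^esub> y \<otimes>\<^bsub>?E\<^esub> z = x \<otimes>\<^bsub>?E\<^esub> (y \<otimes>\<^bsub>?E\<^esub> z)"
        if "x \<in> carrier ?E" "y \<in> carrier ?E" "z \<in> carrier ?E" for x y z
        using that by (auto intro!: restrict_ext)
      show "\<one>\<^bsub>?E\<^esub> \<otimes>\<^bsub>?E\<^esub> x = x" if x: "x \<in> carrier ?E" for x
        by (rule End_eqI[OF End_closed(1)[OF End_closed(4)[OF x x] x] x]) (use x in simp)
      show "x \<otimes>\<^bsub>?E\<^esub> \<one>\<^bsub>?E\<^esub> = x" if x: "x \<in> carrier ?E" for x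
        by (rule End_eqI[OF End_closed(1)[OF x End_closed(4)[OF x x]] x]) (use x in simp)
    qed
  qed (auto intro!: restrict_ext)
  have "module Cq_ring ?E"
  proof (rule moduleI[OF cring_from_type_algebra grp])
    show "c \<odot>\<^bsub>?E\<^esub> x \<in> carrier ?E" if "x \<in> carrier ?E" for c x
      using End_closed(3)[OF that that] .
    show "\<one>\<^bsub>Cq_ring\<^esub> \<odot>\<^bsub>?E\<^esub> x = x" if x: "x \<in> carrier ?E" for x
      by (rule End_eqI[OF _ x]) (use x End_closed(3)[OF x x] in \<open>simp_all del: End_sel(1)\<close>)
  qed (auto simp: smult_add_left smult_add_right smult_smult intro!: restrict_ext)
  then show ?thesis
    by (intro calg.intro cmod.intro calg_axioms.intro ring) (auto intro!: restrict_ext)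
qed

end


section \<open>Relations between rows of different blocks\<close>

lemma q_nonzero [simp]: "q \<noteq> 0"
  unfolding q_def Zero_fract_def by (simp add: eq_fract)

text \<open>The braiding writes \<open>t\<^sub>j\<^sub>b t\<^sub>i\<^sub>a\<close> as a combination of the products \<open>t\<^sub>i\<^sub>u t\<^sub>j\<^sub>v\<close>; here \<open>e u v\<close> stands for
  \<open>t\<^sub>i\<^sub>u t\<^sub>j\<^sub>v\<close>.\<close>

definition braid_coeff :: "(int \<Rightarrow> int \<Rightarrow> Cq) \<Rightarrow> int \<Rightarrow> int \<Rightarrow> Cq" where
  "braid_coeff e b a = ksign (ipar a * ipar b) * q powi phi b a * e a b
     + of_bool (b < a) * xi * e b a + of_bool (- b < a) * ksign (ipar a) * xi * e (- b) (- a)"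

text \<open>In each of these twelve positions every parity, every value of \<open>phi\<close> and
  every comparison between the columns up to sign is determined, so the relations become identities
  in the base field.\<close>

lemma sign_cases:
  fixes a b :: int
  assumes "a \<noteq> 0" "b \<noteq> 0"
  shows "a = b \<and> a < 0 \<or> a = b \<and> 0 < a \<or> a = - b \<and> a < 0 \<or> a = - b \<and> 0 < a
    \<or> a \<noteq> b \<and> a \<noteq> - b \<and> (a < 0 \<and> b < 0 \<and> a < b \<or> a < 0 \<and> b < 0 \<and> b < a
      \<or> a < 0 \<and> 0 < b \<and> - a < b \<or> a < 0 \<and> 0 < b \<and> b < - a
      \<or> 0 < a \<and> b < 0 \<and> - a < b \<or> 0 < a \<and> b < 0 \<and> b < - a
      \<or> 0 < a \<and> 0 < b \<and> a < b \<or> 0 < a \<and> 0 < b \<and> b < a)"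
proof -
  have "a < 0 \<or> 0 < a" "b < 0 \<or> 0 < b" "a < b \<or> a = b \<or> b < a" "- a < b \<or> a = - b \<or> b < - a"
    using assms by auto
  then show ?thesis by (elim disjE) simp_all
qed

text \<open>The braiding rewrites each product \<open>N v\<close> times \<open>X' u\<close> in
  normal order, with \<open>X'\<close> to the left of \<open>N\<close>; a relation then holds as
  soon as the coefficients of the normally ordered products agree. For the rows \<open>j\<close>,
  \<open>i\<close> in this order the relation is the braiding formula up to a sign; the other seven
  choices of signs and order follow from it.\<close>

lemma cross_relations:
  fixes i j :: int
  assumes E: "calg E" and ij: "0 < j" "j < i"
    and X: "\<And>a. a \<in> idx n \<Longrightarrow> X' a \<in> carrier E" and N: "\<And>a. a \<in> idx n \<Longrightarrow> N a \<in> carrier E"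
    and braid: "\<And>a b. a \<in> idx n \<Longrightarrow> b \<in> idx n \<Longrightarrow> N b \<otimes>\<^bsub>E\<^esub> X' a =
      (ksign (ipar a * ipar b) * q powi phi b a) \<odot>\<^bsub>E\<^esub> (X' a \<otimes>\<^bsub>E\<^esub> N b)
      \<oplus>\<^bsub>E\<^esub> (of_bool (b < a) * xi) \<odot>\<^bsub>E\<^esub> (X' b \<otimes>\<^bsub>E\<^esub> N a)
      \<oplus>\<^bsub>E\<^esub> (of_bool (- b < a) * ksign (ipar a) * xi) \<odot>\<^bsub>E\<^esub> (X' (- b) \<otimes>\<^bsub>E\<^esub> N (- a))"
    and t: "\<And>a. a \<in> idx n \<Longrightarrow> t i a = X' a" "\<And>a. a \<in> idx n \<Longrightarrow> t (- i) a = X' (- a)"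
      "\<And>a. a \<in> idx n \<Longrightarrow> t j a = N a" "\<And>a. a \<in> idx n \<Longrightarrow> t (- j) a = N (- a)"
    and ab: "a \<in> idx n" "b \<in> idx n"
    and rs: "(r = i \<or> r = - i) \<and> (s = j \<or> s = - j) \<or> (r = j \<or> r = - j) \<and> (s = i \<or> s = - i)"
  shows "satisfies_rel E t r a s b"
proof -
  interpret E: calg E by (rule E)
  let ?P = "idx n \<times> idx n"
  \<comment> \<open>\<open>comb f\<close> is the normally ordered combination with coefficient
    function \<open>f\<close>. The indicator \<open>e p\<close> picks out one coefficient, so that a
    single product is \<open>comb\<close> of an indicator and \<open>braid_coeff\<close> describes a
    reordered one.\<close>
  define comb where "comb f = (\<Oplus>\<^bsub>E\<^esub>p\<in>?P. f (fst p) (snd p) \<odot>\<^bsub>E\<^esub> (X' (fst p) \<otimes>\<^bsub>E\<^esub> N (snd p)))" for f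
  define e where "e p u v = (of_bool (p = (u, v)) :: Cq)" for p :: "int \<times> int" and u v
  have prod: "X' (fst p) \<otimes>\<^bsub>E\<^esub> N (snd p) \<in> carrier E" if "p \<in> ?P" for p using that X N by auto
  have comb_add: "comb f \<oplus>\<^bsub>E\<^esub> comb g = comb (\<lambda>u v. f u v + g u v)" for f g
  proof -
    have "comb (\<lambda>u v. f u v + g u v) = (\<Oplus>\<^bsub>E\<^esub>p\<in>?P. f (fst p) (snd p) \<odot>\<^bsub>E\<^esub> (X' (fst p) \<otimes>\<^bsub>E\<^esub> N (snd p))
        \<oplus>\<^bsub>E\<^esub> g (fst p) (snd p) \<odot>\<^bsub>E\<^esub> (X' (fst p) \<otimes>\<^bsub>E\<^esub> N (snd p)))"
      unfolding comb_def using prod by (intro E.finsum_cong' refl Pi_I) (auto simp: E.smult_add_left)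
    also have "\<dots> = comb f \<oplus>\<^bsub>E\<^esub> comb g"
      unfolding comb_def using prod by (intro E.finsum_addf Pi_I E.smult_closed)
    finally show ?thesis by simp
  qed
  have comb_smult: "c \<odot>\<^bsub>E\<^esub> comb f = comb (\<lambda>u v. c * f u v)" for c f
  proof -
    have "c \<odot>\<^bsub>E\<^esub> comb f = (\<Oplus>\<^bsub>E\<^esub>p\<in>?P. c \<odot>\<^bsub>E\<^esub> (f (fst p) (snd p) \<odot>\<^bsub>E\<^esub> (X' (fst p) \<otimes>\<^bsub>E\<^esub> N (snd p))))"
      unfolding comb_def using prod by (intro E.smult_finsum Pi_I E.smult_closed)
    also have "\<dots> = comb (\<lambda>u v. c * f u v)"
      unfolding comb_def using prod by (intro E.finsum_cong' refl Pi_I) (simp_all add: E.smult_smult)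
    finally show ?thesis .
  qed
  have XN: "X' u \<otimes>\<^bsub>E\<^esub> N v = comb (\<lambda>u' v'. e (u', v') u v)" if "u \<in> idx n" "v \<in> idx n" for u v
  proof -
    have "comb (\<lambda>u' v'. e (u', v') u v) = (\<Oplus>\<^bsub>E\<^esub>p\<in>?P. if (u, v) = p then X' (fst p) \<otimes>\<^bsub>E\<^esub> N (snd p) else \<zero>\<^bsub>E\<^esub>)"
      unfolding comb_def e_def using prod by (intro E.finsum_cong') auto
    also have "\<dots> = X' u \<otimes>\<^bsub>E\<^esub> N v"
      using E.finsum_singleton[of "(u, v)" ?P "\<lambda>p. X' (fst p) \<otimes>\<^bsub>E\<^esub> N (snd p)"] that prod by auto
    finally show ?thesis by simp
  qed
  have NX: "N v \<otimes>\<^bsub>E\<^esub> X' u = comb (\<lambda>u' v'. braid_coeff (e (u', v')) v u)" if "u \<in> idx n" "v \<in> idx n" for u v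
    unfolding braid[OF that] using that
    by (simp add: XN comb_smult comb_add braid_coeff_def)
  have nz: "a \<noteq> 0" "b \<noteq> 0" using ab idx_nonzero by auto
  have [simp]: "- a \<in> idx n" "- b \<in> idx n" using ab by simp_all
  \<comment> \<open>The rows have different absolute values, so \<open>phi\<close> vanishes on
    them.\<close>
  have phi0: "phi i j = 0" "phi (- i) j = 0" "phi i (- j) = 0" "phi (- i) (- j) = 0"
    "phi j i = 0" "phi (- j) i = 0" "phi j (- i) = 0" "phi (- j) (- i) = 0"
    using ij by (auto simp: phi_def)
  have signs: "ipar i = 0" "ipar j = 0" "ipar (- i) = 1" "ipar (- j) = 1"
    using ij by (auto simp: ipar_def)
  from rs consider "r = i" "s = j" | "r = i" "s = - j" | "r = - i" "s = j" | "r = - i" "s = - j"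
    | "r = j" "s = i" | "r = j" "s = - i" | "r = - j" "s = i" | "r = - j" "s = - i"
    by blast
  \<comment> \<open>Both sides are brought into the form \<open>comb\<close> of a coefficient
    function and compared pointwise. Expanding \<open>xi\<close> as \<open>q - inverse q\<close>
    settles the positions where powers of \<open>q\<close> meet multiples of
    \<open>xi\<close>.\<close>
  then show ?thesis
    unfolding satisfies_rel_def
    by cases
      ((simp only: t ab NX XN comb_smult comb_add minus_minus idx_uminus phi0 signs,
        rule arg_cong[of _ _ comb], (rule ext)+, use sign_cases[OF nz] ij in \<open>elim disjE conjE;
          simp add: braid_coeff_def phi_def ipar_def power_int_minus xi_def field_simps\<close>)+)
qed

section \<open>Operators on the braided tensor product\<close>

lemma tensor_sel:
  "carrier (tensor A B) = carrier (tensor_space A B)" "ring.zero (tensor A B) = ring.zero (tensor_space A B)"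
  "ring.add (tensor A B) = ring.add (tensor_space A B)"
  "module.smult (tensor A B) = module.smult (tensor_space A B)"
  "homog (tensor A B) = homog (tensor_space A B)" "monoid.one (tensor A B) = monoid.one (tensor_space A B)"
  by (simp_all add: tensor_def Let_def)

lemma braided_tensor_sel:
  "carrier (braided_tensor A B \<Theta>) = carrier (tensor_space A B)"
  "ring.zero (braided_tensor A B \<Theta>) = ring.zero (tensor_space A B)"
  "ring.add (braided_tensor A B \<Theta>) = ring.add (tensor_space A B)"
  "module.smult (braided_tensor A B \<Theta>) = module.smult (tensor_space A B)"
  "homog (braided_tensor A B \<Theta>) = homog (tensor_space A B)"
  "monoid.one (braided_tensor A B \<Theta>) = monoid.one (tensor_space A B)"
  by (simp_all add: braided_tensor_def Let_def)

text \<open>Finite sums, and hence lifts, do not look at the multiplication; formulas stated in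
  \<open>tensor A B\<close> therefore pass to the underlying space.\<close>

lemma finsum_tensor: "finsum (tensor A B) = finsum (tensor_space A B)"
  by (simp add: finsum_def tensor_sel)

lemma tensor_lift_tensor: "tensor_lift (tensor A B) = tensor_lift (tensor_space A B)"
  by (intro ext) (simp add: tensor_lift_def finsum_tensor tensor_sel)

locale braided_data =
  fixes r k n :: nat
    and \<Delta> :: "(int \<times> int) free_alg set
          \<Rightarrow> ((int \<times> int) free_alg set \<times> (int \<times> int) free_alg set \<Rightarrow>\<^sub>0 Cq) set"
    and \<epsilon> :: "(int \<times> int) free_alg set \<Rightarrow> Cq"
    and \<Phi> :: "nat \<Rightarrow> (int \<times> int) free_alg set \<Rightarrow> (int \<times> int) free_alg set \<Rightarrow> (int \<times> int) free_alg set"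
    and \<Theta> :: "((int \<times> int) free_alg set \<times> (int \<times> int) free_alg set \<Rightarrow>\<^sub>0 Cq) set
          \<Rightarrow> ((int \<times> int) free_alg set \<times> (int \<times> int) free_alg set \<Rightarrow>\<^sub>0 Cq) set"
  assumes coproduct: "Uq_coproduct n \<Delta>"
    and action: "\<And>m. m \<in> {r, k, r + k} \<Longrightarrow> qcoord_action m n \<Delta> \<epsilon> (\<Phi> m)"
    and braiding: "braiding_operator r k n \<Delta> (\<Phi> r) (\<Phi> k) \<Theta>"
begin

abbreviation "A \<equiv> qcoord r n"
abbreviation "B \<equiv> qcoord k n"
abbreviation "C \<equiv> qcoord (r + k) n"
abbreviation "T \<equiv> tensor_space A B"
abbreviation "tA \<equiv> qcoord_t r n"
abbreviation "tB \<equiv> qcoord_t k n"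

text \<open>Being a superalgebra is part of being a supermodule superalgebra, so the assumed action
  supplies the grading.\<close>

lemma salg_qcoord: "m \<in> {r, k, r + k} \<Longrightarrow> salg (qcoord m n)"
  using action[of m] by (intro salg.intro) (simp add: qcoord_action_def supermodule_superalgebra_def)

sublocale A: salg A by (rule salg_qcoord) simp
sublocale B: salg B by (rule salg_qcoord) simp
sublocale C: salg C by (rule salg_qcoord) simp
sublocale AB: tensor_pair A B by (intro tensor_pair.intro A.cmod_axioms B.cmod_axioms)
sublocale BA: tensor_pair B A by (intro tensor_pair.intro A.cmod_axioms B.cmod_axioms)

lemma T_cmod: "cmod T"
  by (rule AB.cmod_tensor_space)

text \<open>Left multiplication by \<open>x \<otimes> 1\<close> and right multiplication by \<open>1 \<otimes> y\<close>; neither involves the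
  braiding.\<close>

definition lact where "lact x = tensor_lift T (\<lambda>x' y'. tens A B (x \<otimes>\<^bsub>A\<^esub> x') y')"
definition ract where "ract y = tensor_lift T (\<lambda>x' y'. tens A B x' (y' \<otimes>\<^bsub>B\<^esub> y))"

lemmas tens_bilinear = AB.bilinear_on_tens

lemma bilinear_lact: "x \<in> carrier A \<Longrightarrow> bilinear_on A B T (\<lambda>x' y'. tens A B (x \<otimes>\<^bsub>A\<^esub> x') y')"
  by (intro bilinear_onI)
    (auto intro: linear_on_compose[OF A.linear_on_mult_left bilinear_on_left[OF tens_bilinear]]
      bilinear_on_right[OF tens_bilinear])

lemma bilinear_ract: "y \<in> carrier B \<Longrightarrow> bilinear_on A B T (\<lambda>x' y'. tens A B x' (y' \<otimes>\<^bsub>B\<^esub> y))"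
  by (intro bilinear_onI)
    (auto intro: linear_on_compose[OF B.linear_on_mult_right bilinear_on_right[OF tens_bilinear]]
      bilinear_on_left[OF tens_bilinear])

lemma lact_linear: "x \<in> carrier A \<Longrightarrow> linear_on T T (lact x)"
  unfolding lact_def by (intro AB.linear_on_tensor_lift bilinear_lact T_cmod)

lemma ract_linear: "y \<in> carrier B \<Longrightarrow> linear_on T T (ract y)"
  unfolding ract_def by (intro AB.linear_on_tensor_lift bilinear_ract T_cmod)

lemma lact_tens [simp]:
  "x \<in> carrier A \<Longrightarrow> x' \<in> carrier A \<Longrightarrow> y' \<in> carrier B \<Longrightarrow> lact x (tens A B x' y') = tens A B (x \<otimes>\<^bsub>A\<^esub> x') y'"
  unfolding lact_def by (intro AB.tensor_lift_tens bilinear_lact T_cmod)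

lemma ract_tens [simp]:
  "y \<in> carrier B \<Longrightarrow> x' \<in> carrier A \<Longrightarrow> y' \<in> carrier B \<Longrightarrow> ract y (tens A B x' y') = tens A B x' (y' \<otimes>\<^bsub>B\<^esub> y)"
  unfolding ract_def by (intro AB.tensor_lift_tens bilinear_ract T_cmod)

lemma lact_closed [simp, intro]: "x \<in> carrier A \<Longrightarrow> Z \<in> carrier T \<Longrightarrow> lact x Z \<in> carrier T"
  and ract_closed [simp, intro]: "y \<in> carrier B \<Longrightarrow> Z \<in> carrier T \<Longrightarrow> ract y Z \<in> carrier T"
  using lact_linear ract_linear by (auto intro: linear_on_closed)

lemma linear_on_tensor_eq:
  assumes "linear_on T N f" "linear_on T N g"
    and "\<And>x y. x \<in> carrier A \<Longrightarrow> y \<in> carrier B \<Longrightarrow> f (tens A B x y) = g (tens A B x y)" "Z \<in> carrier T"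
  shows "f Z = g Z"
  using AB.linear_on_tensor_eqI[OF assms(1,2)] assms(3,4) by blast

lemma linear_on_fun_add: "cmod M \<Longrightarrow> cmod N \<Longrightarrow> linear_on M N f \<Longrightarrow> linear_on M N g \<Longrightarrow> linear_on M N (\<lambda>x. f x \<oplus>\<^bsub>N\<^esub> g x)"
proof -
  assume *: "cmod M" "cmod N" "linear_on M N f" "linear_on M N g"
  interpret M: cmod M by fact
  interpret N: cmod N by fact
  show ?thesis
    using *(3,4) by (intro linear_onI)
      (auto simp: linear_on_add[OF *(3)] linear_on_add[OF *(4)] linear_on_smult[OF *(3)] linear_on_smult[OF *(4)]
        N.smult_add_right linear_on_closed N.a_ac)
qed

lemma linear_on_fun_smult: "cmod N \<Longrightarrow> linear_on M N f \<Longrightarrow> linear_on M N (\<lambda>x. c \<odot>\<^bsub>N\<^esub> f x)"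
proof -
  assume *: "cmod N" "linear_on M N f"
  interpret N: cmod N by fact
  show ?thesis
    using *(2) by (intro linear_onI)
      (auto simp: linear_on_add[OF *(2)] linear_on_smult[OF *(2)]
        N.smult_add_right linear_on_closed N.smult_smult mult.commute)
qed

lemma lact_ract:
  assumes "x \<in> carrier A" "y \<in> carrier B" "Z \<in> carrier T"
  shows "ract y (lact x Z) = lact x (ract y Z)"
  by (rule linear_on_tensor_eq[OF linear_on_compose[OF lact_linear ract_linear] linear_on_compose[OF ract_linear lact_linear]])
    (use assms in auto)

lemma lact_mult:
  assumes "x \<in> carrier A" "x' \<in> carrier A" "Z \<in> carrier T"
  shows "lact (x \<otimes>\<^bsub>A\<^esub> x') Z = lact x (lact x' Z)"
  by (rule linear_on_tensor_eq[OF lact_linear linear_on_compose[OF lact_linear lact_linear]])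
    (use assms in \<open>auto simp: A.m_assoc\<close>)

lemma ract_mult:
  assumes "y \<in> carrier B" "y' \<in> carrier B" "Z \<in> carrier T"
  shows "ract (y \<otimes>\<^bsub>B\<^esub> y') Z = ract y' (ract y Z)"
  by (rule linear_on_tensor_eq[OF ract_linear linear_on_compose[OF ract_linear ract_linear]])
    (use assms in \<open>auto simp: B.m_assoc\<close>)

lemma lact_one: "Z \<in> carrier T \<Longrightarrow> lact \<one>\<^bsub>A\<^esub> Z = Z"
  by (rule linear_on_tensor_eq[OF lact_linear, where g = "\<lambda>Z. Z"]) (auto intro: linear_onI)

lemma ract_one: "Z \<in> carrier T \<Longrightarrow> ract \<one>\<^bsub>B\<^esub> Z = Z"
  by (rule linear_on_tensor_eq[OF ract_linear, where g = "\<lambda>Z. Z"]) (auto intro: linear_onI)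

text \<open>Each \<open>g x\<close> is linear on \<open>T\<close>, so linearity in the parameter
  \<open>x\<close> can be tested on pure tensors, where the operators have explicit
  formulas.\<close>

lemma bilinear_operatorI:
  assumes g: "\<And>x. x \<in> carrier M \<Longrightarrow> linear_on T T (g x)"
    and tens: "\<And>x' y'. x' \<in> carrier A \<Longrightarrow> y' \<in> carrier B \<Longrightarrow> linear_on M T (\<lambda>x. g x (tens A B x' y'))"
    and M: "cmod M"
  shows "bilinear_on M T T g"
proof (intro bilinear_onI linear_onI)
  interpret M: cmod M by (rule M)
  fix x x' Z c assume x: "x \<in> carrier M" and Z: "Z \<in> carrier T"
  show "g (c \<odot>\<^bsub>M\<^esub> x) Z = c \<odot>\<^bsub>T\<^esub> g x Z"
    by (rule linear_on_tensor_eq[OF g linear_on_fun_smult[OF T_cmod g]])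
      (use x Z linear_on_smult[OF tens] in auto)
  assume x': "x' \<in> carrier M"
  show "g (x \<oplus>\<^bsub>M\<^esub> x') Z = g x Z \<oplus>\<^bsub>T\<^esub> g x' Z"
    by (rule linear_on_tensor_eq[OF g linear_on_fun_add[OF T_cmod T_cmod g g]])
      (use x x' Z linear_on_add[OF tens] in auto)
qed (auto simp: linear_on_add[OF g] linear_on_smult[OF g] linear_on_closed[OF g])

lemma lact_bilinear: "bilinear_on A T T lact"
proof (rule bilinear_operatorI[OF lact_linear _ A.cmod_axioms])
  fix x' y' assume xy: "x' \<in> carrier A" "y' \<in> carrier B"
  show "linear_on A T (\<lambda>x. lact x (tens A B x' y'))"
    using linear_on_compose[OF A.linear_on_mult_right[OF xy(1)] bilinear_on_left[OF tens_bilinear xy(2)]] xy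
    by (simp add: linear_on_def)
qed

lemma ract_bilinear: "bilinear_on B T T ract"
proof (rule bilinear_operatorI[OF ract_linear _ B.cmod_axioms])
  fix x' y' assume xy: "x' \<in> carrier A" "y' \<in> carrier B"
  show "linear_on B T (\<lambda>y. ract y (tens A B x' y'))"
    using linear_on_compose[OF B.linear_on_mult_left[OF xy(2)] bilinear_on_right[OF tens_bilinear xy(1)]] xy
    by (simp add: linear_on_def)
qed


subsection \<open>The braiding\<close>

definition braid where "braid y x = \<Theta> (tens B A y x)"

lemmas braiding_unfolded = braiding[unfolded braiding_operator_def Let_def tensor_lift_tensor tensor_sel]

lemma \<Theta>_linear: "linear_on (tensor_space B A) T \<Theta>"
  using braiding_unfolded
  by (simp add: supermodule_hom_def even_linear_map_iff linear_on_def tensor_sel)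

lemma braid_bilinear: "bilinear_on B A T braid"
  unfolding braid_def by (rule bilinear_on_compose[OF BA.bilinear_on_tens \<Theta>_linear])

lemma braid_closed [simp, intro]: "y \<in> carrier B \<Longrightarrow> x \<in> carrier A \<Longrightarrow> braid y x \<in> carrier T"
  using bilinear_on_closed[OF braid_bilinear] .

lemma braid_one_left: "x \<in> carrier A \<Longrightarrow> braid \<one>\<^bsub>B\<^esub> x = tens A B x \<one>\<^bsub>B\<^esub>"
  and braid_one_right: "y \<in> carrier B \<Longrightarrow> braid y \<one>\<^bsub>A\<^esub> = tens A B \<one>\<^bsub>A\<^esub> y"
  using braiding_unfolded by (simp_all add: braid_def)

lemma braid_gens:
  assumes "i \<in> {1..int r}" "j \<in> {1..int k}" "a \<in> idx n" "b \<in> idx n"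
  shows "braid (tB j b) (tA i a) =
    (ksign (ipar a * ipar b) * q powi phi b a) \<odot>\<^bsub>T\<^esub> tens A B (tA i a) (tB j b)
    \<oplus>\<^bsub>T\<^esub> (of_bool (b < a) * xi) \<odot>\<^bsub>T\<^esub> tens A B (tA i b) (tB j a)
    \<oplus>\<^bsub>T\<^esub> (of_bool (- b < a) * ksign (ipar a) * xi) \<odot>\<^bsub>T\<^esub> tens A B (tA i (- b)) (tB j (- a))"
  unfolding braid_def using braiding_unfolded assms by blast

lemma braid_mult_right:
  assumes "y \<in> carrier B" "x \<in> carrier A" "x' \<in> carrier A"
  shows "braid y (x \<otimes>\<^bsub>A\<^esub> x') = tensor_lift T (\<lambda>x1 y1. lact x1 (braid y1 x')) (braid y x)"
  unfolding braid_def lact_def using braiding_unfolded assms by blast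

lemma braid_mult_left:
  assumes "y \<in> carrier B" "y' \<in> carrier B" "x \<in> carrier A"
  shows "braid (y \<otimes>\<^bsub>B\<^esub> y') x = tensor_lift T (\<lambda>x1 y1. ract y1 (braid y x1)) (braid y' x)"
  unfolding braid_def ract_def using braiding_unfolded assms by blast

text \<open>Left multiplication by \<open>1 \<otimes> y\<close>.\<close>

definition nact where "nact y = tensor_lift T (\<lambda>x' y'. ract y' (braid y x'))"

lemma bilinear_nact: "y \<in> carrier B \<Longrightarrow> bilinear_on A B T (\<lambda>x' y'. ract y' (braid y x'))"
  by (intro bilinear_onI)
    (auto intro: linear_on_compose[OF bilinear_on_right[OF braid_bilinear] ract_linear]
      bilinear_on_left[OF ract_bilinear])

lemma nact_linear: "y \<in> carrier B \<Longrightarrow> linear_on T T (nact y)"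
  unfolding nact_def by (intro AB.linear_on_tensor_lift bilinear_nact T_cmod)

lemma nact_tens [simp]:
  "y \<in> carrier B \<Longrightarrow> x' \<in> carrier A \<Longrightarrow> y' \<in> carrier B \<Longrightarrow> nact y (tens A B x' y') = ract y' (braid y x')"
  unfolding nact_def by (intro AB.tensor_lift_tens bilinear_nact T_cmod)

lemma nact_closed [simp, intro]: "y \<in> carrier B \<Longrightarrow> Z \<in> carrier T \<Longrightarrow> nact y Z \<in> carrier T"
  using nact_linear by (rule linear_on_closed)

text \<open>An instance of associativity that does not involve the hexagons: \<open>nact\<close>
  reattaches the second leg by \<open>ract\<close>, and \<open>ract\<close> turns products into
  compositions.\<close>

lemma nact_ract:
  assumes "y \<in> carrier B" "w \<in> carrier B" "Z \<in> carrier T"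
  shows "nact y (ract w Z) = ract w (nact y Z)"
  by (rule linear_on_tensor_eq[OF linear_on_compose[OF ract_linear nact_linear] linear_on_compose[OF nact_linear ract_linear]])
    (use assms in \<open>auto simp: ract_mult\<close>)

lemma nact_mult:
  assumes "y \<in> carrier B" "y' \<in> carrier B" "Z \<in> carrier T"
  shows "nact (y \<otimes>\<^bsub>B\<^esub> y') Z = nact y (nact y' Z)"
proof (rule linear_on_tensor_eq[OF nact_linear linear_on_compose[OF nact_linear nact_linear]])
  fix x w assume xw: "x \<in> carrier A" "w \<in> carrier B"
  \<comment> \<open>This is the second hexagon identity: braiding a product means braiding
    \<open>y'\<close> first and then letting \<open>y\<close> act on the result.\<close>
  have "braid (y \<otimes>\<^bsub>B\<^esub> y') x = nact y (braid y' x)"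
    using assms xw by (simp add: braid_mult_left nact_def)
  then show "nact (y \<otimes>\<^bsub>B\<^esub> y') (tens A B x w) = nact y (nact y' (tens A B x w))"
    using assms xw by (simp add: nact_ract)
qed (use assms in auto)

lemma nact_one: "Z \<in> carrier T \<Longrightarrow> nact \<one>\<^bsub>B\<^esub> Z = Z"
  by (rule linear_on_tensor_eq[OF nact_linear, where g = "\<lambda>Z. Z"]) (auto intro: linear_onI simp: braid_one_left)

lemma nact_bilinear: "bilinear_on B T T nact"
proof (rule bilinear_operatorI[OF nact_linear _ B.cmod_axioms])
  fix x' y' assume xy: "x' \<in> carrier A" "y' \<in> carrier B"
  show "linear_on B T (\<lambda>y. nact y (tens A B x' y'))"
    using linear_on_compose[OF bilinear_on_left[OF braid_bilinear xy(1)] ract_linear[OF xy(2)]] xy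
    by (simp add: linear_on_def)
qed

text \<open>The first hexagon identity in operator form. To move \<open>y\<close> past left
  multiplication by \<open>x\<close>, replace the pair by its braiding and act with the two legs in
  normal order; the factor \<open>w\<close> commutes with all of this.\<close>

lemma nact_lact:
  assumes "y \<in> carrier B" "x \<in> carrier A" "x' \<in> carrier A" "w \<in> carrier B"
  shows "nact y (lact x (tens A B x' w)) = tensor_lift T (\<lambda>x1 y1. lact x1 (nact y1 (tens A B x' w))) (braid y x)"
proof -
  have "nact y (lact x (tens A B x' w)) = ract w (tensor_lift T (\<lambda>x1 y1. lact x1 (braid y1 x')) (braid y x))"
    using assms by (simp add: braid_mult_right)
  also have "\<dots> = tensor_lift T (\<lambda>x1 y1. ract w (lact x1 (braid y1 x'))) (braid y x)"
    using assms by (intro AB.tensor_lift_compose[OF T_cmod _ T_cmod ract_linear]) auto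
  also have "\<dots> = tensor_lift T (\<lambda>x1 y1. lact x1 (nact y1 (tens A B x' w))) (braid y x)"
    using assms by (intro AB.tensor_lift_cong[OF T_cmod]) (auto simp: lact_ract)
  finally show ?thesis .
qed

end

lemma satisfies_rel_cong:
  assumes "i \<in> idx m" "j \<in> idx m" "a \<in> idx n" "b \<in> idx n"
    and "\<And>i a. i \<in> idx m \<Longrightarrow> a \<in> idx n \<Longrightarrow> t i a = t' i a"
  shows "satisfies_rel B t i a j b \<longleftrightarrow> satisfies_rel B t' i a j b"
  unfolding satisfies_rel_def using assms(1-4) by (simp add: assms(5) del: add_bit_eq_xor)

context braided_data
begin

subsection \<open>The inverse of sigma\<close>

abbreviation "E \<equiv> End_alg T"
abbreviation "lend x \<equiv> restrict (lact x) (carrier T)"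
abbreviation "nend y \<equiv> restrict (nact y) (carrier T)"

lemma calg_E: "calg E"
  by (rule AB.T.calg_End)

lemma End_hom:
  assumes g: "bilinear_on M T T g" and mult: "\<And>x y Z. x \<in> carrier M \<Longrightarrow> y \<in> carrier M \<Longrightarrow> Z \<in> carrier T \<Longrightarrow>
      g (x \<otimes>\<^bsub>M\<^esub> y) Z = g x (g y Z)"
    and one: "\<And>Z. Z \<in> carrier T \<Longrightarrow> g \<one>\<^bsub>M\<^esub> Z = Z"
  shows "alg_hom M E (\<lambda>x. restrict (g x) (carrier T))"
proof (intro alg_homI linear_onI)
  show "restrict (g x) (carrier T) \<in> carrier E" if "x \<in> carrier M" for x
    using that by (intro AB.T.EndI bilinear_on_right[OF g])
qed (auto simp: mult one linear_on_smult[OF bilinear_on_left[OF g]] linear_on_add[OF bilinear_on_left[OF g]]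
    bilinear_on_closed[OF g] intro!: restrict_ext)

lemma lend_hom: "alg_hom A E lend" and nend_hom: "alg_hom B E nend"
  using End_hom[OF lact_bilinear lact_mult lact_one] End_hom[OF nact_bilinear nact_mult nact_one] by simp_all

lemma lend_closed: "x \<in> carrier A \<Longrightarrow> lend x \<in> carrier E"
  and nend_closed: "y \<in> carrier B \<Longrightarrow> nend y \<in> carrier E"
  using lend_hom nend_hom by (auto dest: alg_hom_linear linear_on_closed)

lemma pos_idx: "i \<in> {1..int m} \<Longrightarrow> i \<in> idx m"
  by (auto simp: idx_def)

text \<open>The commutation rule demanded by \<open>cross_relations\<close>. Being an equation of
  operators, it has to hold on every pure tensor and not just on the unit, and this is where the
  first hexagon enters.\<close>

lemma nend_lend_gens:
  assumes i: "i \<in> {1..int r}" and j: "j \<in> {1..int k}" and a: "a \<in> idx n" and b: "b \<in> idx n"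
  shows "nend (tB j b) \<otimes>\<^bsub>E\<^esub> lend (tA i a) =
    (ksign (ipar a * ipar b) * q powi phi b a) \<odot>\<^bsub>E\<^esub> (lend (tA i a) \<otimes>\<^bsub>E\<^esub> nend (tB j b))
    \<oplus>\<^bsub>E\<^esub> (of_bool (b < a) * xi) \<odot>\<^bsub>E\<^esub> (lend (tA i b) \<otimes>\<^bsub>E\<^esub> nend (tB j a))
    \<oplus>\<^bsub>E\<^esub> (of_bool (- b < a) * ksign (ipar a) * xi) \<odot>\<^bsub>E\<^esub> (lend (tA i (- b)) \<otimes>\<^bsub>E\<^esub> nend (tB j (- a)))"
    (is "?l = ?r")
proof -
  interpret E: calg E by (rule calg_E)
  have t: "tA i a \<in> carrier A" "tB j a \<in> carrier B" if "a \<in> idx n" for a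
    using that i j qcoord_t_closed pos_idx by auto
  have ab: "- a \<in> idx n" "- b \<in> idx n" using a b by simp_all
  note ts = t[OF a] t[OF b] t[OF ab(1)] t[OF ab(2)]
  note cl = lend_closed[OF ts(1)] lend_closed[OF ts(3)] lend_closed[OF ts(7)]
    nend_closed[OF ts(2)] nend_closed[OF ts(4)] nend_closed[OF ts(6)]
  have lE: "?l \<in> carrier E"
    using cl by (intro E.m_closed)
  have rE: "?r \<in> carrier E"
    using cl by (intro E.m_closed E.a_closed E.smult_closed)
  show ?thesis
  proof (rule AB.T.End_eqI[OF lE rE])
    fix Z assume Z: "Z \<in> carrier T"
    show "?l Z = ?r Z"
    proof (rule linear_on_tensor_eq[OF _ _ _ Z])
      show "linear_on T T ?l" "linear_on T T ?r" using lE rE by (simp_all only: AB.T.mem_End)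
      fix x' w assume xw: "x' \<in> carrier A" "w \<in> carrier B"
      let ?Z = "tens A B x' w"
      let ?G = "\<lambda>x1 y1. lact x1 (nact y1 ?Z)"
      have Z: "?Z \<in> carrier T" using xw by simp
      \<comment> \<open>Bilinearity makes the lift linear, so it can be evaluated on the three
        summands of the braiding formula.\<close>
      have G: "bilinear_on A B T ?G"
        using Z by (intro bilinear_onI)
          (auto intro: bilinear_on_left[OF lact_bilinear] linear_on_compose[OF bilinear_on_left[OF nact_bilinear] lact_linear])
      note lin = AB.linear_on_tensor_lift[OF T_cmod G]
      have "?l ?Z = tensor_lift T ?G (braid (tB j b) (tA i a))"
        using ts xw Z by (simp add: nact_lact del: lact_tens nact_tens)
      also have "\<dots> = ?r ?Z"
        unfolding braid_gens[OF i j a b] using ts Z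
        by (simp add: linear_on_add[OF lin] linear_on_smult[OF lin] AB.tensor_lift_tens[OF T_cmod G]
          del: lact_tens nact_tens)
      finally show "?l ?Z = ?r ?Z" .
    qed
  qed
qed

text \<open>Rows of absolute value at most \<open>k\<close> belong to \<open>B\<close>; the others
  come from \<open>A\<close>, whose rows \<open>\<iota>A\<close> has moved outwards by
  \<open>k\<close>, and are moved back. Outside the index ranges the value is zero to keep the
  family total.\<close>

definition split_gen :: "int \<Rightarrow> int \<Rightarrow> _" where
  "split_gen i a = (if i \<in> idx (r + k) \<and> a \<in> idx n then
     if \<bar>i\<bar> \<le> int k then nend (tB i a) else lend (tA (if i < 0 then i + int k else i - int k) a)
   else \<zero>\<^bsub>E\<^esub>)"

lemma split_gen_low: "i \<in> idx k \<Longrightarrow> a \<in> idx n \<Longrightarrow> split_gen i a = nend (tB i a)"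
  by (auto simp: split_gen_def idx_def)

lemma split_gen_high: "i \<in> idx r \<Longrightarrow> a \<in> idx n \<Longrightarrow> split_gen (row_shift k i) a = lend (tA i a)"
  by (auto simp: split_gen_def idx_def row_shift_def)

lemma idx_split:
  assumes "i \<in> idx (r + k)"
  shows "i \<in> idx k \<or> (\<exists>i0\<in>idx r. i = row_shift k i0)"
proof (cases "\<bar>i\<bar> \<le> int k")
  case False
  then have "(if i < 0 then i + int k else i - int k) \<in> idx r"
    "i = row_shift k (if i < 0 then i + int k else i - int k)"
    using assms by (auto simp: idx_def row_shift_def)
  then show ?thesis by blast
qed (use assms in \<open>auto simp: idx_def\<close>)

lemma split_gen_closed: "split_gen i a \<in> carrier E"
proof -
  interpret E: calg E by (rule calg_E)
  have "split_gen i a \<in> carrier E" if ia: "i \<in> idx (r + k)" "a \<in> idx n"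
    using idx_split[OF ia(1)] ia(2)
    by (auto simp: split_gen_low split_gen_high intro!: lend_closed nend_closed qcoord_t_closed)
  moreover have "split_gen i a = \<zero>\<^bsub>E\<^esub>" if "\<not> (i \<in> idx (r + k) \<and> a \<in> idx n)"
    using that by (simp only: split_gen_def if_False)
  ultimately show ?thesis using E.zero_closed by metis
qed

lemma split_gen_uminus:
  assumes "i \<in> idx (r + k)" "a \<in> idx n"
  shows "split_gen (- i) (- a) = split_gen i a"
  using idx_split[OF assms(1)]
proof (elim disjE bexE)
  fix i0 assume i0: "i0 \<in> idx r" "i = row_shift k i0"
  then have "- i = row_shift k (- i0)" using idx_nonzero row_shift_simps(1) by simp
  then show ?thesis using i0 assms(2) split_gen_high[of "- i0" "- a"] split_gen_high[of i0 a]
    by (simp add: qcoord_t_uminus)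
qed (use assms(2) in \<open>simp add: split_gen_low qcoord_t_uminus\<close>)

lemma split_gen_mixed:
  assumes j: "j \<in> idx k" and i: "i0 \<in> idx r" "i = row_shift k i0" and ab: "a \<in> idx n" "b \<in> idx n"
  shows "satisfies_rel E split_gen i a j b" "satisfies_rel E split_gen j a i b"
proof -
  \<comment> \<open>Absolute values reduce the claim to positive rows, where the braiding formula is
    available; the signs are restored by negating columns, as foreseen in
    \<open>cross_relations\<close>.\<close>
  let ?m = "\<bar>i0\<bar>" and ?i = "row_shift k \<bar>i0\<bar>" and ?j = "\<bar>j\<bar>"
  have i0: "?m \<in> idx r" "?m \<in> {1..int r}" "?m \<noteq> 0" and jj: "?j \<in> idx k" "?j \<in> {1..int k}"
    using i j by (auto simp: idx_def)
  have ord: "0 < ?j" "?j < ?i" using i0 jj by (auto simp: row_shift_def)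
  have ri: "i = ?i \<or> i = - ?i" and rj: "j = ?j \<or> j = - ?j"
    using i by (auto simp: row_shift_def)
  have t: "tA ?m a \<in> carrier A" "tB ?j a \<in> carrier B" if "a \<in> idx n" for a
    using that i0 jj qcoord_t_closed by auto
  have high: "split_gen ?i a = lend (tA ?m a)" "split_gen (- ?i) a = lend (tA ?m (- a))" if "a \<in> idx n" for a
    using that i0 split_gen_high[of "- ?m" a] split_gen_high[of ?m a] qcoord_t_uminus[of ?m r "- a" n]
      row_shift_simps(1)[of ?m k] by simp_all
  have low: "split_gen ?j a = nend (tB ?j a)" "split_gen (- ?j) a = nend (tB ?j (- a))" if "a \<in> idx n" for a
    using that jj split_gen_low[of "- ?j" a] split_gen_low[of ?j a] qcoord_t_uminus[of ?j k "- a" n] by simp_all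
  note cross = cross_relations[OF calg_E ord, where X' = "\<lambda>a. lend (tA ?m a)" and N = "\<lambda>a. nend (tB ?j a)"
      and t = split_gen and n = n, OF lend_closed[OF t(1)] nend_closed[OF t(2)]
      nend_lend_gens[OF i0(2) jj(2)] high low ab]
  show "satisfies_rel E split_gen i a j b" "satisfies_rel E split_gen j a i b"
    using cross ri rj by blast+
qed

text \<open>Within a block the relation is inherited along \<open>nend\<close> or
  \<open>lend\<close>, both of which are homomorphisms; only the mixed cases see the
  braiding.\<close>

lemma split_gen_rel:
  assumes ij: "i \<in> idx (r + k)" "j \<in> idx (r + k)" and ab: "a \<in> idx n" "b \<in> idx n"
  shows "satisfies_rel E split_gen i a j b"
  using idx_split[OF ij(1)] idx_split[OF ij(2)]
proof (elim disjE bexE)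
  assume i: "i \<in> idx k" "j \<in> idx k"
  have "satisfies_rel E (\<lambda>i a. nend (tB i a)) i a j b"
    by (rule satisfies_rel_image[OF calg_qcoord calg_E nend_hom qcoord_t_closed i ab qcoord_rel[OF i ab]])
  with satisfies_rel_cong[where t = split_gen and t' = "\<lambda>i a. nend (tB i a)", OF i ab split_gen_low]
  show ?thesis by (rule iffD2)
next
  fix i0 j0 assume i0: "i0 \<in> idx r" "i = row_shift k i0" and j0: "j0 \<in> idx r" "j = row_shift k j0"
  have "satisfies_rel E (\<lambda>i a. lend (tA i a)) i0 a j0 b"
    by (rule satisfies_rel_image[OF calg_qcoord calg_E lend_hom qcoord_t_closed i0(1) j0(1) ab
          qcoord_rel[OF i0(1) j0(1) ab]])
  moreover have "satisfies_rel E (\<lambda>i. split_gen (row_shift k i)) i0 a j0 b \<longleftrightarrow>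
      satisfies_rel E (\<lambda>i a. lend (tA i a)) i0 a j0 b"
    by (rule satisfies_rel_cong[OF i0(1) j0(1) ab]) (rule split_gen_high)
  ultimately have "satisfies_rel E (\<lambda>i. split_gen (row_shift k i)) i0 a j0 b" by (rule iffD2[rotated])
  then show ?thesis
    using satisfies_rel_shift[OF idx_nonzero[OF i0(1)] idx_nonzero[OF j0(1)]] i0(2) j0(2) by blast
next
  fix j0 assume "i \<in> idx k" "j0 \<in> idx r" "j = row_shift k j0"
  then show ?thesis by (rule split_gen_mixed(2)[OF _ _ _ ab])
next
  fix i0 assume "j \<in> idx k" "i0 \<in> idx r" "i = row_shift k i0"
  then show ?thesis by (rule split_gen_mixed(1)[OF _ _ _ ab])
qed

lemma rep_exists:
  "\<exists>\<rho>. alg_hom C E \<rho> \<and> (\<forall>i\<in>idx (r + k). \<forall>a\<in>idx n. \<rho> (qcoord_t (r + k) n i a) = split_gen i a)"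
proof -
  have "\<exists>f\<in>extensional (carrier C). alg_hom C E f \<and>
    (\<forall>i\<in>idx (r + k). \<forall>a\<in>idx n. f (qcoord_t (r + k) n i a) = split_gen i a) \<and>
    ((\<forall>i\<in>idx (r + k). \<forall>a\<in>idx n. split_gen i a \<in> homog E (ipar i + ipar a)) \<longrightarrow> salg E \<longrightarrow>
      (\<forall>d. f ` homog C d \<subseteq> homog E d))"
    by (rule qcoord_hom_exists[OF calg_E split_gen_closed split_gen_uminus split_gen_rel])
  then show ?thesis by blast
qed


subsection \<open>Sigma\<close>

abbreviation "\<iota>A \<equiv> iota n r (r + k) k"
abbreviation "\<iota>B \<equiv> iota n k (r + k) 0"
abbreviation "\<sigma> \<equiv> sigma r k n"

lemma \<iota>A_hom: "superalgebra_hom A C \<iota>A"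
  and \<iota>A_gen: "\<And>i a. i \<in> {1..int r} \<Longrightarrow> a \<in> idx n \<Longrightarrow> \<iota>A (tA i a) = qcoord_t (r + k) n (int k + i) a"
  by (rule iota_props[OF _ C.salg_axioms], simp)+

lemma \<iota>B_hom: "superalgebra_hom B C \<iota>B"
  and \<iota>B_gen: "\<And>i a. i \<in> {1..int k} \<Longrightarrow> a \<in> idx n \<Longrightarrow> \<iota>B (tB i a) = qcoord_t (r + k) n i a"
  using iota_props[OF _ C.salg_axioms, of k 0] by simp_all

lemma \<iota>A_alg_hom: "alg_hom A C \<iota>A" and \<iota>B_alg_hom: "alg_hom B C \<iota>B"
  using \<iota>A_hom \<iota>B_hom by (simp_all add: superalgebra_hom_iff)

lemmas \<iota>A_linear = alg_hom_linear[OF \<iota>A_alg_hom]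
lemmas \<iota>B_linear = alg_hom_linear[OF \<iota>B_alg_hom]

lemma \<iota>_closed [simp, intro]: "x \<in> carrier A \<Longrightarrow> \<iota>A x \<in> carrier C" "y \<in> carrier B \<Longrightarrow> \<iota>B y \<in> carrier C"
  using \<iota>A_linear \<iota>B_linear by (auto intro: linear_on_closed)

lemma bilinear_\<sigma>: "bilinear_on A B C (\<lambda>x y. \<iota>A x \<otimes>\<^bsub>C\<^esub> \<iota>B y)"
  by (intro bilinear_onI)
    (auto intro: linear_on_compose[OF \<iota>A_linear C.linear_on_mult_right] linear_on_compose[OF \<iota>B_linear C.linear_on_mult_left])

lemma \<sigma>_linear: "linear_on T C \<sigma>"
  unfolding sigma_def by (rule AB.linear_on_tensor_lift[OF C.cmod_axioms bilinear_\<sigma>])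

lemma \<sigma>_closed [simp, intro]: "Z \<in> carrier T \<Longrightarrow> \<sigma> Z \<in> carrier C"
  using \<sigma>_linear by (rule linear_on_closed)

lemma \<sigma>_tens: "x \<in> carrier A \<Longrightarrow> y \<in> carrier B \<Longrightarrow> \<sigma> (tens A B x y) = \<iota>A x \<otimes>\<^bsub>C\<^esub> \<iota>B y"
  unfolding sigma_def by (rule AB.tensor_lift_tens[OF C.cmod_axioms bilinear_\<sigma>])

lemma \<sigma>_inj: "inj_on \<sigma> (carrier T)"
proof -
  obtain \<rho> where \<rho>: "alg_hom C E \<rho>" "\<forall>i\<in>idx (r + k). \<forall>a\<in>idx n. \<rho> (qcoord_t (r + k) n i a) = split_gen i a"
    using rep_exists by blast
  have \<rho>A: "\<rho> (\<iota>A x) = lend x" if "x \<in> carrier A" for x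
  proof (rule qcoord_hom_eqI[OF alg_hom_compose[OF \<iota>A_alg_hom \<rho>(1)] lend_hom _ that])
    fix i a assume i: "i \<in> {1..int r}" and a: "a \<in> idx n"
    then have "row_shift k i = int k + i" "int k + i \<in> idx (r + k)" by (auto simp: row_shift_def idx_def)
    then show "\<rho> (\<iota>A (tA i a)) = lend (tA i a)"
      using \<rho>(2) \<iota>A_gen[OF i a] split_gen_high[OF pos_idx[OF i] a] a by simp
  qed
  have \<rho>B: "\<rho> (\<iota>B y) = nend y" if "y \<in> carrier B" for y
  proof (rule qcoord_hom_eqI[OF alg_hom_compose[OF \<iota>B_alg_hom \<rho>(1)] nend_hom _ that])
    fix i a assume i: "i \<in> {1..int k}" and a: "a \<in> idx n"
    then have "i \<in> idx (r + k)" by (auto simp: idx_def)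
    then show "\<rho> (\<iota>B (tB i a)) = nend (tB i a)"
      using \<rho>(2) \<iota>B_gen[OF i a] split_gen_low[OF pos_idx[OF i] a] a by simp
  qed
  let ?v = "tens A B \<one>\<^bsub>A\<^esub> \<one>\<^bsub>B\<^esub>"
  have v: "?v \<in> carrier T" by simp
  have ev: "linear_on E T (\<lambda>f. f ?v)" by (rule linear_onI) (use v in auto)
  have inv: "\<rho> (\<sigma> Z) ?v = Z" if Z: "Z \<in> carrier T" for Z
  proof (rule linear_on_tensor_eq[OF linear_on_compose[OF \<sigma>_linear linear_on_compose[OF alg_hom_linear[OF \<rho>(1)] ev]] _ _ Z])
    show "linear_on T T (\<lambda>Z. Z)" by (rule linear_onI) auto
    fix x y assume xy: "x \<in> carrier A" "y \<in> carrier B"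
    have "\<rho> (\<sigma> (tens A B x y)) = lend x \<otimes>\<^bsub>E\<^esub> nend y"
      using xy by (simp add: \<sigma>_tens alg_hom_mult[OF \<rho>(1)] \<rho>A \<rho>B del: AB.T.End_sel)
    \<comment> \<open>\<open>nact y\<close> sends the unit tensor to the braiding of
      \<open>y\<close> with the unit, which is \<open>1 \<otimes> y\<close>, and
      \<open>lact x\<close> then puts \<open>x\<close> into the first factor.\<close>
    then show "\<rho> (\<sigma> (tens A B x y)) ?v = tens A B x y"
      using xy by (simp add: braid_one_right ract_one)
  qed
  then show ?thesis by (rule inj_on_inverseI)
qed

lemma \<sigma>_lact: "x \<in> carrier A \<Longrightarrow> Z \<in> carrier T \<Longrightarrow> \<sigma> (lact x Z) = \<iota>A x \<otimes>\<^bsub>C\<^esub> \<sigma> Z"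
  by (rule linear_on_tensor_eq[OF linear_on_compose[OF lact_linear \<sigma>_linear]
        linear_on_compose[OF \<sigma>_linear C.linear_on_mult_left]])
    (auto simp: \<sigma>_tens alg_hom_mult[OF \<iota>A_alg_hom] C.m_assoc)

lemma \<sigma>_ract: "y \<in> carrier B \<Longrightarrow> Z \<in> carrier T \<Longrightarrow> \<sigma> (ract y Z) = \<sigma> Z \<otimes>\<^bsub>C\<^esub> \<iota>B y"
  by (rule linear_on_tensor_eq[OF linear_on_compose[OF ract_linear \<sigma>_linear]
        linear_on_compose[OF \<sigma>_linear C.linear_on_mult_right]])
    (auto simp: \<sigma>_tens alg_hom_mult[OF \<iota>B_alg_hom] C.m_assoc)

lemma \<sigma>_one: "\<sigma> (tens A B \<one>\<^bsub>A\<^esub> \<one>\<^bsub>B\<^esub>) = \<one>\<^bsub>C\<^esub>"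
  by (simp add: \<sigma>_tens alg_hom_one[OF \<iota>A_alg_hom] alg_hom_one[OF \<iota>B_alg_hom])

text \<open>The braiding formula on generators was made for this: it is the defining relation of
  \<open>C\<close> for the rows \<open>j\<close> and \<open>k + i\<close>, solved for the product
  with \<open>j\<close> on the left.\<close>

lemma \<iota>_gens_commute:
  assumes i: "i \<in> {1..int r}" and j: "j \<in> {1..int k}" and a: "a \<in> idx n" and b: "b \<in> idx n"
  shows "\<sigma> (braid (tB j b) (tA i a)) = \<iota>B (tB j b) \<otimes>\<^bsub>C\<^esub> \<iota>A (tA i a)"
proof -
  let ?t = "qcoord_t (r + k) n" and ?i = "int k + i"
  have ij: "?i \<in> idx (r + k)" "j \<in> idx (r + k)" using i j by (auto simp: idx_def)
  have tc: "?t ?i c \<in> carrier C" "?t j c \<in> carrier C" if "c \<in> idx n" for c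
    using qcoord_t_closed that ij by auto
  have ts: "tA i c \<in> carrier A" "tB j c \<in> carrier B" if "c \<in> idx n" for c
    using qcoord_t_closed that i j pos_idx by auto
  have nz: "a \<noteq> 0" "b \<noteq> 0" using a b idx_nonzero by auto
  \<comment> \<open>Since \<open>j \<le> k < k + i\<close>, the row comparisons on the left of the
    relation fail and \<open>phi\<close> of the rows vanishes, so a single product is left
    there.\<close>
  have sg: "ipar ?i = 0" "ipar j = 0" "phi j ?i = 0" "\<not> ?i < j" "\<not> ?i < - j"
    using i j by (auto simp: ipar_def phi_def)
  let ?Q = "\<lambda>u v. ?t ?i u \<otimes>\<^bsub>C\<^esub> ?t j v" and ?P = "?t j b \<otimes>\<^bsub>C\<^esub> ?t ?i a"
  let ?c2 = "ksign (ipar b * (ipar a + ipar b)) * (of_bool (b < a) * (xi * ksign (ipar b)))"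
  let ?c3 = "ksign (ipar (- b) * (ipar (- a) + ipar b)) * (of_bool (- b < a) * (xi * ksign (ipar (- b))))"
  have cl: "?P \<in> carrier C" "?Q a b \<in> carrier C" "?Q b a \<in> carrier C" "?Q (- b) (- a) \<in> carrier C"
    "?t (- ?i) b \<otimes>\<^bsub>C\<^esub> ?t (- j) a \<in> carrier C"
    using tc a b ij qcoord_t_closed idx_uminus by (auto simp del: minus_add_distrib)
  have "ksign (ipar b * ipar a) \<odot>\<^bsub>C\<^esub> ?P =
      q powi phi b a \<odot>\<^bsub>C\<^esub> ?Q a b \<oplus>\<^bsub>C\<^esub> ?c2 \<odot>\<^bsub>C\<^esub> ?Q b a \<oplus>\<^bsub>C\<^esub> ?c3 \<odot>\<^bsub>C\<^esub> ?Q (- b) (- a)"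
    using qcoord_rel[OF ij(2,1) b a] cl
    by (simp add: satisfies_rel_def sg del: add_bit_eq_xor mult_bit_eq_and minus_add_distrib)
  \<comment> \<open>Multiplying once more by the sign, which squares to one, isolates the
    product.\<close>
  then have "ksign (ipar b * ipar a) \<odot>\<^bsub>C\<^esub> (ksign (ipar b * ipar a) \<odot>\<^bsub>C\<^esub> ?P) =
      ksign (ipar b * ipar a) \<odot>\<^bsub>C\<^esub>
      (q powi phi b a \<odot>\<^bsub>C\<^esub> ?Q a b \<oplus>\<^bsub>C\<^esub> ?c2 \<odot>\<^bsub>C\<^esub> ?Q b a \<oplus>\<^bsub>C\<^esub> ?c3 \<odot>\<^bsub>C\<^esub> ?Q (- b) (- a))"
    by simp
  then have P: "?P = (ksign (ipar b * ipar a) * q powi phi b a) \<odot>\<^bsub>C\<^esub> ?Q a b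
      \<oplus>\<^bsub>C\<^esub> (ksign (ipar b * ipar a) * ?c2) \<odot>\<^bsub>C\<^esub> ?Q b a
      \<oplus>\<^bsub>C\<^esub> (ksign (ipar b * ipar a) * ?c3) \<odot>\<^bsub>C\<^esub> ?Q (- b) (- a)"
    using cl by (simp only: C.smult_smult C.smult_add_right C.smult_closed C.a_closed ksign_square C.smult_one)
  have coeffs: "ksign (ipar b * ipar a) * q powi phi b a = ksign (ipar a * ipar b) * q powi phi b a"
    "ksign (ipar b * ipar a) * ?c2 = of_bool (b < a) * xi"
    "ksign (ipar b * ipar a) * ?c3 = of_bool (- b < a) * ksign (ipar a) * xi"
    using nz by (cases "a < 0"; cases "b < 0"; simp add: ipar_def)+
  have "\<sigma> (braid (tB j b) (tA i a)) = (ksign (ipar a * ipar b) * q powi phi b a) \<odot>\<^bsub>C\<^esub> ?Q a b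
      \<oplus>\<^bsub>C\<^esub> (of_bool (b < a) * xi) \<odot>\<^bsub>C\<^esub> ?Q b a
      \<oplus>\<^bsub>C\<^esub> (of_bool (- b < a) * ksign (ipar a) * xi) \<odot>\<^bsub>C\<^esub> ?Q (- b) (- a)"
    unfolding braid_gens[OF i j a b] using ts a b i j
    by (simp add: linear_on_add[OF \<sigma>_linear] linear_on_smult[OF \<sigma>_linear] \<sigma>_tens \<iota>A_gen \<iota>B_gen)
  then show ?thesis
    unfolding \<iota>A_gen[OF i a] \<iota>B_gen[OF j b] P coeffs by simp
qed


text \<open>The column \<open>b\<close> is quantified inside the induction: braiding
  \<open>tB j b\<close> past a generator with column \<open>a\<close> also produces
  \<open>tB j a\<close> and \<open>tB j (- a)\<close>, so the induction hypothesis is used at three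
  columns. The row \<open>j\<close> never changes.\<close>

lemma \<sigma>_braid_gen:
  assumes j: "j \<in> {1..int k}" and x: "x \<in> carrier A"
  shows "\<forall>b\<in>idx n. \<sigma> (braid (tB j b) x) = \<iota>B (tB j b) \<otimes>\<^bsub>C\<^esub> \<iota>A x"
  using x
proof (induction rule: qcoord_induct)
  have t: "tB j b \<in> carrier B" if "b \<in> idx n" for b using that j qcoord_t_closed pos_idx by auto
  {
    case one
    show ?case
      using t by (simp add: braid_one_right \<sigma>_tens alg_hom_one[OF \<iota>A_alg_hom])
  next
    case (mult i a x')
    then have tA: "tA i c \<in> carrier A" if "c \<in> idx n" for c using that qcoord_t_closed pos_idx by auto
    show ?case
    proof
      fix b assume b: "b \<in> idx n"
      let ?H = "\<lambda>x1 y1. lact x1 (braid y1 x')"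
      have H: "bilinear_on A B T ?H"
        using mult(3) by (intro bilinear_onI)
          (auto intro: bilinear_on_left[OF lact_bilinear] linear_on_compose[OF bilinear_on_left[OF braid_bilinear] lact_linear])
      note lin = AB.linear_on_tensor_lift[OF T_cmod H]
      let ?c1 = "ksign (ipar a * ipar b) * q powi phi b a" and ?c2 = "of_bool (b < a) * xi"
        and ?c3 = "of_bool (- b < a) * ksign (ipar a) * xi"
      have ab: "- a \<in> idx n" "- b \<in> idx n" using mult(2) b by simp_all
      note ts = tA[OF mult(2)] tA[OF b] tA[OF ab(2)] t[OF mult(2)] t[OF b] t[OF ab(1)]
      note ii = \<iota>_closed(1)[OF ts(1)] \<iota>_closed(1)[OF ts(2)] \<iota>_closed(1)[OF ts(3)]
        \<iota>_closed(2)[OF ts(4)] \<iota>_closed(2)[OF ts(5)] \<iota>_closed(2)[OF ts(6)]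
      have "braid (tB j b) (tA i a \<otimes>\<^bsub>A\<^esub> x') = tensor_lift T ?H (braid (tB j b) (tA i a))"
        using ts mult(3) by (intro braid_mult_right)
      also have "\<dots> = ?c1 \<odot>\<^bsub>T\<^esub> lact (tA i a) (braid (tB j b) x')
          \<oplus>\<^bsub>T\<^esub> ?c2 \<odot>\<^bsub>T\<^esub> lact (tA i b) (braid (tB j a) x')
          \<oplus>\<^bsub>T\<^esub> ?c3 \<odot>\<^bsub>T\<^esub> lact (tA i (- b)) (braid (tB j (- a)) x')"
        unfolding braid_gens[OF mult(1) j mult(2) b] using ts
        by (simp add: linear_on_add[OF lin] linear_on_smult[OF lin] AB.tensor_lift_tens[OF T_cmod H])
      finally have "\<sigma> (braid (tB j b) (tA i a \<otimes>\<^bsub>A\<^esub> x')) =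
          ?c1 \<odot>\<^bsub>C\<^esub> (\<iota>A (tA i a) \<otimes>\<^bsub>C\<^esub> (\<iota>B (tB j b) \<otimes>\<^bsub>C\<^esub> \<iota>A x'))
          \<oplus>\<^bsub>C\<^esub> ?c2 \<odot>\<^bsub>C\<^esub> (\<iota>A (tA i b) \<otimes>\<^bsub>C\<^esub> (\<iota>B (tB j a) \<otimes>\<^bsub>C\<^esub> \<iota>A x'))
          \<oplus>\<^bsub>C\<^esub> ?c3 \<odot>\<^bsub>C\<^esub> (\<iota>A (tA i (- b)) \<otimes>\<^bsub>C\<^esub> (\<iota>B (tB j (- a)) \<otimes>\<^bsub>C\<^esub> \<iota>A x'))"
        using ts mult(3) mult.IH[rule_format] mult(2) b ab
        by (simp add: linear_on_add[OF \<sigma>_linear] linear_on_smult[OF \<sigma>_linear] \<sigma>_lact)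
      also have "\<dots> = \<sigma> (braid (tB j b) (tA i a)) \<otimes>\<^bsub>C\<^esub> \<iota>A x'"
        unfolding braid_gens[OF mult(1) j mult(2) b] using ts ii \<iota>_closed(1)[OF mult(3)]
        by (simp add: linear_on_add[OF \<sigma>_linear] linear_on_smult[OF \<sigma>_linear] \<sigma>_tens C.l_distr
            C.smult_mult_left C.m_assoc)
      also have "\<dots> = \<iota>B (tB j b) \<otimes>\<^bsub>C\<^esub> \<iota>A (tA i a \<otimes>\<^bsub>A\<^esub> x')"
        unfolding \<iota>_gens_commute[OF mult(1) j mult(2) b] using ts ii mult(3)
        by (simp add: alg_hom_mult[OF \<iota>A_alg_hom] C.m_assoc)
      finally show "\<sigma> (braid (tB j b) (tA i a \<otimes>\<^bsub>A\<^esub> x')) = \<iota>B (tB j b) \<otimes>\<^bsub>C\<^esub> \<iota>A (tA i a \<otimes>\<^bsub>A\<^esub> x')" .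
    qed
  next
    case (add x y)
    then show ?case
      using t by (simp add: linear_on_add[OF bilinear_on_right[OF braid_bilinear]] linear_on_add[OF \<sigma>_linear]
          linear_on_add[OF \<iota>A_linear] C.r_distr)
  next
    case (smult c x)
    then show ?case
      using t by (simp add: linear_on_smult[OF bilinear_on_right[OF braid_bilinear]] linear_on_smult[OF \<sigma>_linear]
          linear_on_smult[OF \<iota>A_linear] C.smult_mult_right)
  }
qed

text \<open>The second hexagon strips a generator from \<open>y\<close>: the rest is braided past
  \<open>x\<close> first, and the generator is then braided past arbitrary first legs of the result,
  which the case of a single generator covers.\<close>

lemma \<sigma>_braid:
  assumes y: "y \<in> carrier B" and x: "x \<in> carrier A"
  shows "\<sigma> (braid y x) = \<iota>B y \<otimes>\<^bsub>C\<^esub> \<iota>A x"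
proof -
  from y have "\<forall>x\<in>carrier A. \<sigma> (braid y x) = \<iota>B y \<otimes>\<^bsub>C\<^esub> \<iota>A x"
  proof (induction rule: qcoord_induct)
    case one
    show ?case
      by (simp add: braid_one_left \<sigma>_tens alg_hom_one[OF \<iota>B_alg_hom])
  next
    case (mult j b y)
    have t: "tB j b \<in> carrier B" using mult qcoord_t_closed pos_idx by auto
    show ?case
    proof
      fix x assume x: "x \<in> carrier A"
      have "\<sigma> (braid (tB j b \<otimes>\<^bsub>B\<^esub> y) x) = \<sigma> (tensor_lift T (\<lambda>x1 y1. ract y1 (braid (tB j b) x1)) (braid y x))"
        using t mult(3) x by (simp add: braid_mult_left)
      also have "\<dots> = tensor_lift C (\<lambda>x1 y1. \<sigma> (ract y1 (braid (tB j b) x1))) (braid y x)"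
        using t mult(3) x by (intro AB.tensor_lift_compose[OF T_cmod _ C.cmod_axioms \<sigma>_linear]) auto
      also have "\<dots> = tensor_lift C (\<lambda>x1 y1. \<iota>B (tB j b) \<otimes>\<^bsub>C\<^esub> (\<iota>A x1 \<otimes>\<^bsub>C\<^esub> \<iota>B y1)) (braid y x)"
        using t mult(1-3) x \<sigma>_braid_gen[OF mult(1)]
        by (intro AB.tensor_lift_cong[OF C.cmod_axioms]) (auto simp: \<sigma>_ract C.m_assoc)
      also have "\<dots> = \<iota>B (tB j b) \<otimes>\<^bsub>C\<^esub> tensor_lift C (\<lambda>x1 y1. \<iota>A x1 \<otimes>\<^bsub>C\<^esub> \<iota>B y1) (braid y x)"
        using t mult(3) x
        by (intro AB.tensor_lift_compose[OF C.cmod_axioms _ C.cmod_axioms C.linear_on_mult_left, symmetric]) auto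
      also have "tensor_lift C (\<lambda>x1 y1. \<iota>A x1 \<otimes>\<^bsub>C\<^esub> \<iota>B y1) (braid y x) = \<sigma> (braid y x)"
        by (simp add: sigma_def)
      finally show "\<sigma> (braid (tB j b \<otimes>\<^bsub>B\<^esub> y) x) = \<iota>B (tB j b \<otimes>\<^bsub>B\<^esub> y) \<otimes>\<^bsub>C\<^esub> \<iota>A x"
        using t mult(3) x mult.IH by (simp add: alg_hom_mult[OF \<iota>B_alg_hom] C.m_assoc)
    qed
  next
    case (add x y)
    then show ?case
      by (simp add: linear_on_add[OF bilinear_on_left[OF braid_bilinear]] linear_on_add[OF \<sigma>_linear]
          linear_on_add[OF \<iota>B_linear] C.l_distr)
  next
    case (smult c x)
    then show ?case
      by (simp add: linear_on_smult[OF bilinear_on_left[OF braid_bilinear]] linear_on_smult[OF \<sigma>_linear]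
          linear_on_smult[OF \<iota>B_linear] C.smult_mult_left)
  qed
  then show ?thesis using x by blast
qed

section \<open>Multiplicativity, surjectivity and parity of the map\<close>

abbreviation "D \<equiv> braided_tensor A B \<Theta>"

lemma braided_mult:
  assumes Z: "Z \<in> carrier T" and W: "W \<in> carrier T"
  shows "Z \<otimes>\<^bsub>D\<^esub> W \<in> carrier T" "\<sigma> (Z \<otimes>\<^bsub>D\<^esub> W) = \<sigma> Z \<otimes>\<^bsub>C\<^esub> \<sigma> W"
proof -
  let ?f = "\<lambda>x y x' y' x'' y''. tens A B (x \<otimes>\<^bsub>A\<^esub> x'') (y'' \<otimes>\<^bsub>B\<^esub> y')"
  let ?g = "\<lambda>x y x' y'. tensor_lift T (?f x y x' y') (braid y x')"
  have D: "Z \<otimes>\<^bsub>D\<^esub> W = tensor_lift T (\<lambda>x y. tensor_lift T (?g x y) W) Z"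
    by (simp add: braided_tensor_def Let_def braid_def)
  have g: "?g x y x' y' \<in> carrier T"
    if "x \<in> carrier A" "y \<in> carrier B" "x' \<in> carrier A" "y' \<in> carrier B" for x y x' y'
    using that by (intro AB.tensor_lift_closed[OF T_cmod]) auto
  have gl: "tensor_lift T (?g x y) W \<in> carrier T" if "x \<in> carrier A" "y \<in> carrier B" for x y
    by (rule AB.tensor_lift_closed[OF T_cmod g[OF that] W])
  show "Z \<otimes>\<^bsub>D\<^esub> W \<in> carrier T"
    unfolding D by (rule AB.tensor_lift_closed[OF T_cmod gl Z])
  have \<sigma>g: "\<sigma> (?g x y x' y') = (\<iota>A x \<otimes>\<^bsub>C\<^esub> \<iota>B y) \<otimes>\<^bsub>C\<^esub> (\<iota>A x' \<otimes>\<^bsub>C\<^esub> \<iota>B y')"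
    if xy: "x \<in> carrier A" "y \<in> carrier B" "x' \<in> carrier A" "y' \<in> carrier B" for x y x' y'
  proof -
    have br: "braid y x' \<in> carrier T" using xy by simp
    \<comment> \<open>On pure tensors the integrand is left multiplication by \<open>x\<close> after
      right multiplication by \<open>y'\<close>. Both are linear, so they leave the lift and only
      the braiding itself remains inside.\<close>
    have "?g x y x' y' = tensor_lift T (\<lambda>x'' y''. lact x (ract y' (tens A B x'' y''))) (braid y x')"
      using xy by (intro AB.tensor_lift_cong[OF T_cmod] br) auto
    also have "\<dots> = lact x (ract y' (tensor_lift T (tens A B) (braid y x')))"
      using xy by (intro AB.tensor_lift_compose[OF T_cmod _ T_cmod linear_on_compose[OF ract_linear lact_linear], symmetric] br) auto
    \<comment> \<open>Lifting the universal bilinear map gives the identity.\<close>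
    also have "tensor_lift T (tens A B) (braid y x') = braid y x'"
      by (rule linear_on_tensor_eq[OF AB.linear_on_tensor_lift[OF T_cmod tens_bilinear], where g = "\<lambda>Z. Z"])
        (auto simp: AB.tensor_lift_tens[OF T_cmod tens_bilinear] br intro: linear_onI)
    finally show ?thesis
      using xy br by (simp add: \<sigma>_lact \<sigma>_ract \<sigma>_braid C.m_assoc)
  qed
  have \<sigma>gl: "\<sigma> (tensor_lift T (?g x y) W) = (\<iota>A x \<otimes>\<^bsub>C\<^esub> \<iota>B y) \<otimes>\<^bsub>C\<^esub> \<sigma> W"
    if xy: "x \<in> carrier A" "y \<in> carrier B" for x y
  proof -
    have "\<sigma> (tensor_lift T (?g x y) W) = tensor_lift C (\<lambda>x' y'. \<sigma> (?g x y x' y')) W"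
      by (rule AB.tensor_lift_compose[OF T_cmod g[OF xy] C.cmod_axioms \<sigma>_linear W])
    also have "\<dots> = tensor_lift C (\<lambda>x' y'. (\<iota>A x \<otimes>\<^bsub>C\<^esub> \<iota>B y) \<otimes>\<^bsub>C\<^esub> (\<iota>A x' \<otimes>\<^bsub>C\<^esub> \<iota>B y')) W"
      using xy W by (intro AB.tensor_lift_cong[OF C.cmod_axioms]) (auto simp: \<sigma>g)
    also have "\<dots> = (\<iota>A x \<otimes>\<^bsub>C\<^esub> \<iota>B y) \<otimes>\<^bsub>C\<^esub> tensor_lift C (\<lambda>x' y'. \<iota>A x' \<otimes>\<^bsub>C\<^esub> \<iota>B y') W"
      using xy W by (intro AB.tensor_lift_compose[OF C.cmod_axioms _ C.cmod_axioms C.linear_on_mult_left, symmetric]) auto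
    finally show ?thesis by (simp add: sigma_def)
  qed
  have "\<sigma> (Z \<otimes>\<^bsub>D\<^esub> W) = tensor_lift C (\<lambda>x y. \<sigma> (tensor_lift T (?g x y) W)) Z"
    unfolding D by (rule AB.tensor_lift_compose[OF T_cmod gl C.cmod_axioms \<sigma>_linear Z])
  also have "\<dots> = tensor_lift C (\<lambda>x y. (\<iota>A x \<otimes>\<^bsub>C\<^esub> \<iota>B y) \<otimes>\<^bsub>C\<^esub> \<sigma> W) Z"
    using Z W by (intro AB.tensor_lift_cong[OF C.cmod_axioms]) (auto simp: \<sigma>gl)
  also have "\<dots> = tensor_lift C (\<lambda>x y. \<iota>A x \<otimes>\<^bsub>C\<^esub> \<iota>B y) Z \<otimes>\<^bsub>C\<^esub> \<sigma> W"
    using Z W by (intro AB.tensor_lift_compose[OF C.cmod_axioms _ C.cmod_axioms C.linear_on_mult_right, symmetric]) auto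
  finally show "\<sigma> (Z \<otimes>\<^bsub>D\<^esub> W) = \<sigma> Z \<otimes>\<^bsub>C\<^esub> \<sigma> W" by (simp add: sigma_def)
qed

lemma \<sigma>_surj: "\<sigma> ` carrier T = carrier C"
proof (intro equalityI subsetI)
  fix z assume "z \<in> carrier C"
  then show "z \<in> \<sigma> ` carrier T"
  proof (induction rule: qcoord_induct)
    case one
    show ?case
      using \<sigma>_one by (intro image_eqI[of _ _ "tens A B \<one>\<^bsub>A\<^esub> \<one>\<^bsub>B\<^esub>"]) simp_all
  next
    case (mult i a y)
    \<comment> \<open>Rows up to \<open>k\<close> are hit through \<open>\<iota>B\<close>, the
      remaining ones through \<open>\<iota>A\<close> after subtracting the shift.\<close>
    have "\<exists>Z\<in>carrier T. \<sigma> Z = qcoord_t (r + k) n i a"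
    proof (cases "i \<le> int k")
      case True
      then have i: "i \<in> {1..int k}" using mult(1) by simp
      then have "tB i a \<in> carrier B" using mult(2) qcoord_t_closed pos_idx by blast
      moreover have "\<iota>B (tB i a) = qcoord_t (r + k) n i a" by (rule \<iota>B_gen[OF i mult(2)])
      ultimately have "\<sigma> (tens A B \<one>\<^bsub>A\<^esub> (tB i a)) = qcoord_t (r + k) n i a"
        using \<iota>_closed(2)[of "tB i a"] by (simp add: \<sigma>_tens alg_hom_one[OF \<iota>A_alg_hom])
      then show ?thesis using AB.tens_closed[OF A.one_closed \<open>tB i a \<in> carrier B\<close>] by blast
    next
      case False
      then have i: "i - int k \<in> {1..int r}" using mult(1) by simp
      then have t: "tA (i - int k) a \<in> carrier A" using mult(2) qcoord_t_closed pos_idx by blast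
      moreover have "\<iota>A (tA (i - int k) a) = qcoord_t (r + k) n i a" using \<iota>A_gen[OF i mult(2)] by simp
      ultimately have "\<sigma> (tens A B (tA (i - int k) a) \<one>\<^bsub>B\<^esub>) = qcoord_t (r + k) n i a"
        using \<iota>_closed(1)[OF t] by (simp add: \<sigma>_tens alg_hom_one[OF \<iota>B_alg_hom])
      then show ?thesis using AB.tens_closed[OF t B.one_closed] by blast
    qed
    then obtain Z where Z: "Z \<in> carrier T" "\<sigma> Z = qcoord_t (r + k) n i a" by blast
    obtain W where W: "W \<in> carrier T" "y = \<sigma> W" using mult(4) by blast
    show ?case
      using braided_mult[OF Z(1) W(1)] Z W by (intro image_eqI[of _ _ "Z \<otimes>\<^bsub>D\<^esub> W"]) simp_all
  next
    case (add x y)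
    then obtain Z W where "Z \<in> carrier T" "x = \<sigma> Z" "W \<in> carrier T" "y = \<sigma> W" by blast
    then show ?case
      by (intro image_eqI[of _ _ "Z \<oplus>\<^bsub>T\<^esub> W"]) (simp_all add: linear_on_add[OF \<sigma>_linear])
  next
    case (smult c x)
    then obtain Z where "Z \<in> carrier T" "x = \<sigma> Z" by blast
    then show ?case
      by (intro image_eqI[of _ _ "c \<odot>\<^bsub>T\<^esub> Z"]) (simp_all add: linear_on_smult[OF \<sigma>_linear])
  qed
qed auto

lemma \<sigma>_bij: "bij_betw \<sigma> (carrier T) (carrier C)"
  using \<sigma>_inj \<sigma>_surj by (simp add: bij_betw_def)

text \<open>A homogeneous class has by definition a representative supported on homogeneous pairs of
  the right total parity, and the lift may be computed on that representative.\<close>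

lemma \<sigma>_even: "\<sigma> ` homog T d \<subseteq> homog C d"
proof
  fix z assume "z \<in> \<sigma> ` homog T d"
  then obtain p where p: "z = \<sigma> (tensor_class A B p)"
    "Poly_Mapping.keys p \<subseteq> (\<Union>e. homog A e \<times> homog B (d - e))"
    by (auto simp: tensor_space_def)
  then have pf: "p \<in> AB.formal" unfolding AB.formal_def using A.homog_closed B.homog_closed by blast
  have hom: "\<iota>A ` homog A e \<subseteq> homog C e" "\<iota>B ` homog B e \<subseteq> homog C e" for e
    using \<iota>A_hom \<iota>B_hom by (simp_all add: superalgebra_hom_iff)
  have "z = linear_ext C (\<lambda>g. \<iota>A (fst g) \<otimes>\<^bsub>C\<^esub> \<iota>B (snd g)) p"
    unfolding p(1) sigma_def by (rule AB.tensor_lift_class[OF C.cmod_axioms bilinear_\<sigma> pf])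
  also have "\<dots> \<in> homog C d"
    unfolding linear_ext_def
  proof (intro C.homog_finsum Pi_I C.homog_smult)
    fix g assume "g \<in> Poly_Mapping.keys p"
    then obtain e where "fst g \<in> homog A e" "snd g \<in> homog B (d - e)" using p(2) by auto
    then have "\<iota>A (fst g) \<in> homog C e" "\<iota>B (snd g) \<in> homog C (d - e)"
      using hom by (blast intro: subsetD[OF hom(1)] subsetD[OF hom(2)])+
    then have "\<iota>A (fst g) \<otimes>\<^bsub>C\<^esub> \<iota>B (snd g) \<in> homog C (e + (d - e))"
      by (rule C.mult_homog)
    moreover have "e + (d - e) = d" by (cases d; cases e) simp_all
    ultimately show "\<iota>A (fst g) \<otimes>\<^bsub>C\<^esub> \<iota>B (snd g) \<in> homog C d" by simp
  qed
  finally show "z \<in> homog C d" .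
qed

section \<open>The grading of the tensor product\<close>

lemma homog_T_subset: "homog T d \<subseteq> carrier T"
proof -
  have "(\<Union>e. homog A e \<times> homog B (d - e)) \<subseteq> carrier A \<times> carrier B"
    using A.homog_closed B.homog_closed by blast
  then have "{p. Poly_Mapping.keys p \<subseteq> (\<Union>e. homog A e \<times> homog B (d - e))} \<subseteq> {p. Poly_Mapping.keys p \<subseteq> carrier A \<times> carrier B}"
    by (intro Collect_mono impI) (rule subset_trans)
  then show ?thesis unfolding tensor_space_def superalg.simps partial_object.simps by (rule image_mono)
qed

lemma homog_T_add: "Z \<in> homog T d \<Longrightarrow> W \<in> homog T d \<Longrightarrow> Z \<oplus>\<^bsub>T\<^esub> W \<in> homog T d"
proof -
  let ?U = "\<Union>e. homog A e \<times> homog B (d - e)"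
  assume "Z \<in> homog T d" "W \<in> homog T d"
  then obtain p s where *: "Z = tensor_class A B p" "Poly_Mapping.keys p \<subseteq> ?U"
    "W = tensor_class A B s" "Poly_Mapping.keys s \<subseteq> ?U" by (auto simp: tensor_space_def)
  then have "Poly_Mapping.keys (p + s) \<subseteq> ?U" using keys_add[of p s] by blast
  moreover have "Z \<oplus>\<^bsub>T\<^esub> W = tensor_class A B (p + s)" using * AB.tensor_class_add by simp
  ultimately show ?thesis by (auto simp: tensor_space_def)
qed

lemma tens_homog: "x \<in> homog A e \<Longrightarrow> y \<in> homog B e' \<Longrightarrow> tens A B x y \<in> homog T (e + e')"
proof -
  assume "x \<in> homog A e" "y \<in> homog B e'"
  moreover have "e + e' - e = e'" by (cases e; cases e') simp_all
  ultimately have "Poly_Mapping.keys (Poly_Mapping.single (x, y) (1 :: Cq)) \<subseteq> (\<Union>f. homog A f \<times> homog B (e + e' - f))"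
    by (auto intro!: exI[of _ e] simp del: add_bit_eq_xor)
  then show ?thesis by (auto simp: tens_def tensor_space_def)
qed

text \<open>Existence is elementary: split both factors of a pure tensor and group the four terms by
  total parity. Uniqueness will be pulled back from \<open>C\<close> along
  \<open>\<sigma>\<close>.\<close>

lemma homog_T_decomp:
  assumes "Z \<in> carrier T"
  shows "\<exists>Y\<in>homog T 0. \<exists>W\<in>homog T 1. Z = Y \<oplus>\<^bsub>T\<^esub> W"
  using assms
proof (induction rule: AB.tensor_induct)
  case (tens x y)
  let ?x = "\<lambda>d. hcomp A d x" and ?y = "\<lambda>d. hcomp B d y"
  have xy: "?x d \<in> homog A d" "?y d \<in> homog B d" "?x d \<in> carrier A" "?y d \<in> carrier B" for d
    using tens A.hcomp_decomp(1) B.hcomp_decomp(1) by auto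
  note lin = linear_on_add[OF bilinear_on_left[OF tens_bilinear]] linear_on_add[OF bilinear_on_right[OF tens_bilinear]]
  have "tens A B x y = tens A B (?x 0 \<oplus>\<^bsub>A\<^esub> ?x 1) (?y 0 \<oplus>\<^bsub>B\<^esub> ?y 1)"
    using A.hcomp_decomp(2)[OF tens(1)] B.hcomp_decomp(2)[OF tens(2)] by simp
  also have "\<dots> = (tens A B (?x 0) (?y 0) \<oplus>\<^bsub>T\<^esub> tens A B (?x 1) (?y 1))
      \<oplus>\<^bsub>T\<^esub> (tens A B (?x 0) (?y 1) \<oplus>\<^bsub>T\<^esub> tens A B (?x 1) (?y 0))"
    using xy by (simp add: lin AB.T.a_ac)
  finally have *: "tens A B x y = \<dots>" .
  have "tens A B (?x 0) (?y 0) \<oplus>\<^bsub>T\<^esub> tens A B (?x 1) (?y 1) \<in> homog T 0"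
    using tens_homog[OF xy(1,2), of 0 0] tens_homog[OF xy(1,2), of 1 1] by (intro homog_T_add) auto
  moreover have "tens A B (?x 0) (?y 1) \<oplus>\<^bsub>T\<^esub> tens A B (?x 1) (?y 0) \<in> homog T 1"
    using tens_homog[OF xy(1,2), of 0 1] tens_homog[OF xy(1,2), of 1 0] by (intro homog_T_add) auto
  ultimately show ?case using * by blast
next
  case (add Z Z')
  then obtain Y W Y' W' where *: "Y \<in> homog T 0" "W \<in> homog T 1" "Z = Y \<oplus>\<^bsub>T\<^esub> W"
    "Y' \<in> homog T 0" "W' \<in> homog T 1" "Z' = Y' \<oplus>\<^bsub>T\<^esub> W'" by blast
  then have "Z \<oplus>\<^bsub>T\<^esub> Z' = (Y \<oplus>\<^bsub>T\<^esub> Y') \<oplus>\<^bsub>T\<^esub> (W \<oplus>\<^bsub>T\<^esub> W')"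
    using homog_T_subset by (simp add: subset_iff AB.T.a_ac)
  then show ?case using * homog_T_add by blast
qed


subsection \<open>Equivariance of sigma\<close>

abbreviation "U \<equiv> Uq n"

sublocale U: sspace U by (rule sspace_Uq)
sublocale UU: tensor_pair U U by (intro tensor_pair.intro U.cmod_axioms)

lemma \<Delta>_closed [simp, intro]: "u \<in> carrier U \<Longrightarrow> \<Delta> u \<in> carrier (tensor_space U U)"
  using coproduct unfolding Uq_coproduct_def superalgebra_hom_def even_linear_map_def tensor_sel by blast

lemma Uq_L_closed [simp, intro]: "a \<in> idx n \<Longrightarrow> b \<in> idx n \<Longrightarrow> Uq_L n a b \<in> carrier U"
  using Uq_L_homog U.homog_closed by blast

section \<open>The assumed actions on coordinate superalgebras\<close>

context
  fixes m assumes m: "m \<in> {r, k, r + k}"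
begin

interpretation M: salg "qcoord m n" using m by (rule salg_qcoord)

lemma smodalg: "supermodule_superalgebra U \<Delta> \<epsilon> (qcoord m n) (\<Phi> m)"
  using action[OF m] by (simp add: qcoord_action_def)

lemma smod: "supermodule U (qcoord m n) (\<Phi> m)"
  using smodalg by (simp add: supermodule_superalgebra_def)

lemma act_linear_right: "u \<in> carrier U \<Longrightarrow> linear_on (qcoord m n) (qcoord m n) (\<Phi> m u)"
  using smod by (intro linear_onI) (simp_all add: supermodule_def)

lemma act_linear_left: "x \<in> carrier (qcoord m n) \<Longrightarrow> linear_on U (qcoord m n) (\<lambda>u. \<Phi> m u x)"
  using smod by (intro linear_onI) (simp_all add: supermodule_def)

lemma act_closed: "u \<in> carrier U \<Longrightarrow> x \<in> carrier (qcoord m n) \<Longrightarrow> \<Phi> m u x \<in> carrier (qcoord m n)"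
  using act_linear_right by (rule linear_on_closed)

lemma act_one: "x \<in> carrier (qcoord m n) \<Longrightarrow> \<Phi> m \<one>\<^bsub>U\<^esub> x = x"
  and act_mult: "u \<in> carrier U \<Longrightarrow> v \<in> carrier U \<Longrightarrow> x \<in> carrier (qcoord m n) \<Longrightarrow>
    \<Phi> m (u \<otimes>\<^bsub>U\<^esub> v) x = \<Phi> m u (\<Phi> m v x)"
  using smod by (simp_all add: supermodule_def)

lemma act_unit: "u \<in> carrier U \<Longrightarrow> \<Phi> m u \<one>\<^bsub>qcoord m n\<^esub> = \<epsilon> u \<odot>\<^bsub>qcoord m n\<^esub> \<one>\<^bsub>qcoord m n\<^esub>"
  using smodalg by (simp add: supermodule_superalgebra_def)

lemma act_gen:
  assumes "i \<in> idx m" "c \<in> idx n" "a \<in> idx n" "b \<in> idx n"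
  shows "ksign ((ipar a + ipar b) * (ipar i + ipar c)) \<odot>\<^bsub>qcoord m n\<^esub> \<Phi> m (Uq_L n a b) (qcoord_t m n i c) =
    (\<Oplus>\<^bsub>qcoord m n\<^esub>e\<in>idx n.
       (ksign ((ipar i + ipar e) * (ipar e + ipar c)) * Smat e c a b) \<odot>\<^bsub>qcoord m n\<^esub> qcoord_t m n i e)"
  using action[OF m, unfolded qcoord_action_def, THEN conjunct2, rule_format, OF assms] .

lemma act_prod:
  assumes "u \<in> carrier U" "x \<in> homog (qcoord m n) d" "y \<in> carrier (qcoord m n)"
  shows "\<Phi> m u (x \<otimes>\<^bsub>qcoord m n\<^esub> y) = tensor_lift (qcoord m n)
    (\<lambda>u1 u2. \<Phi> m u1 x \<otimes>\<^bsub>qcoord m n\<^esub> \<Phi> m (koszul_twist U d u2) y) (\<Delta> u)"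
  using smodalg assms by (simp add: supermodule_superalgebra_def)

text \<open>The product rule made explicit for generators. The first sign is that of the coproduct,
  the second comes from moving \<open>Uq_L n c b\<close> past \<open>x\<close>.\<close>

lemma act_L_prod:
  assumes ab: "a \<in> idx n" "b \<in> idx n" "a \<le> b"
    and x: "x \<in> homog (qcoord m n) d" and y: "y \<in> carrier (qcoord m n)"
  shows "\<Phi> m (Uq_L n a b) (x \<otimes>\<^bsub>qcoord m n\<^esub> y) =
    (\<Oplus>\<^bsub>qcoord m n\<^esub>c\<in>idx n. (ksign ((ipar a + ipar c) * (ipar c + ipar b)) * ksign (d * (ipar c + ipar b)))
       \<odot>\<^bsub>qcoord m n\<^esub> (\<Phi> m (Uq_L n a c) x \<otimes>\<^bsub>qcoord m n\<^esub> \<Phi> m (Uq_L n c b) y))"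
proof -
  let ?f = "\<lambda>u1 u2. \<Phi> m u1 x \<otimes>\<^bsub>qcoord m n\<^esub> \<Phi> m (koszul_twist U d u2) y"
  have xc: "x \<in> carrier (qcoord m n)" using x by blast
  \<comment> \<open>With bilinearity the lift can be evaluated termwise on the coproduct
    sum.\<close>
  have f: "bilinear_on U U (qcoord m n) ?f"
    using xc y by (intro bilinear_onI)
      (auto intro!: linear_on_compose[OF act_linear_left M.linear_on_mult_right]
        linear_on_compose[OF linear_on_compose[OF U.linear_on_koszul_twist act_linear_left] M.linear_on_mult_left]
        act_closed)
  note lin = UU.linear_on_tensor_lift[OF M.cmod_axioms f]
  let ?K = "\<lambda>c. ksign ((ipar a + ipar c) * (ipar c + ipar b)) :: Cq"
  let ?t = "\<lambda>c. tens U U (Uq_L n a c) (Uq_L n c b)"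
  have "\<Delta> (Uq_L n a b) = (\<Oplus>\<^bsub>tensor_space U U\<^esub>c\<in>idx n. ?K c \<odot>\<^bsub>tensor_space U U\<^esub> ?t c)"
    using coproduct ab by (simp add: Uq_coproduct_def finsum_tensor tensor_sel del: add_bit_eq_xor mult_bit_eq_and)
  then have "\<Phi> m (Uq_L n a b) (x \<otimes>\<^bsub>qcoord m n\<^esub> y) =
      tensor_lift (qcoord m n) ?f (\<Oplus>\<^bsub>tensor_space U U\<^esub>c\<in>idx n. ?K c \<odot>\<^bsub>tensor_space U U\<^esub> ?t c)"
    using act_prod[OF _ x y, of "Uq_L n a b"] ab by simp
  also have "\<dots> = (\<Oplus>\<^bsub>qcoord m n\<^esub>c\<in>idx n. tensor_lift (qcoord m n) ?f (?K c \<odot>\<^bsub>tensor_space U U\<^esub> ?t c))"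
    using ab by (intro linear_on_finsum[OF UU.cmod_tensor_space M.cmod_axioms lin] Pi_I UU.T.smult_closed UU.tens_closed Uq_L_closed)
  also have "\<dots> = (\<Oplus>\<^bsub>qcoord m n\<^esub>c\<in>idx n. (?K c * ksign (d * (ipar c + ipar b)))
       \<odot>\<^bsub>qcoord m n\<^esub> (\<Phi> m (Uq_L n a c) x \<otimes>\<^bsub>qcoord m n\<^esub> \<Phi> m (Uq_L n c b) y))"
  proof (intro M.finsum_cong' refl Pi_I)
    fix c assume c: "c \<in> idx n"
    have act: "\<Phi> m (Uq_L n a c) x \<in> carrier (qcoord m n)" "\<Phi> m (Uq_L n c b) y \<in> carrier (qcoord m n)"
      using ab c xc y by (auto intro!: act_closed)
    then show "(?K c * ksign (d * (ipar c + ipar b)))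
       \<odot>\<^bsub>qcoord m n\<^esub> (\<Phi> m (Uq_L n a c) x \<otimes>\<^bsub>qcoord m n\<^esub> \<Phi> m (Uq_L n c b) y) \<in> carrier (qcoord m n)" by simp
    have "tensor_lift (qcoord m n) ?f (?K c \<odot>\<^bsub>tensor_space U U\<^esub> ?t c) = ?K c \<odot>\<^bsub>qcoord m n\<^esub> ?f (Uq_L n a c) (Uq_L n c b)"
      using ab c by (simp add: linear_on_smult[OF lin] UU.tensor_lift_tens[OF M.cmod_axioms f] del: add_bit_eq_xor mult_bit_eq_and)
    also have "?f (Uq_L n a c) (Uq_L n c b) = ksign (d * (ipar c + ipar b)) \<odot>\<^bsub>qcoord m n\<^esub>
        (\<Phi> m (Uq_L n a c) x \<otimes>\<^bsub>qcoord m n\<^esub> \<Phi> m (Uq_L n c b) y)"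
      unfolding U.koszul_twist_homog[OF Uq_L_homog[OF c ab(2)]] using act ab c
      by (simp add: linear_on_smult[OF act_linear_left[OF y]] M.smult_mult_right del: add_bit_eq_xor mult_bit_eq_and)
    finally show "tensor_lift (qcoord m n) ?f (?K c \<odot>\<^bsub>tensor_space U U\<^esub> ?t c) = (?K c * ksign (d * (ipar c + ipar b)))
       \<odot>\<^bsub>qcoord m n\<^esub> (\<Phi> m (Uq_L n a c) x \<otimes>\<^bsub>qcoord m n\<^esub> \<Phi> m (Uq_L n c b) y)"
      using act by (simp add: M.smult_smult del: add_bit_eq_xor mult_bit_eq_and)
  qed
  finally show ?thesis .
qed

end

section \<open>Equivariance of the two embeddings, handled together with row shift
  \<open>s\<close>\<close>

context
  fixes m s assumes m: "m \<in> {r, k}" and ms: "m + s \<le> r + k"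
begin

abbreviation (input) "M \<equiv> qcoord m n"
abbreviation (input) "\<iota> \<equiv> iota n m (r + k) s"

interpretation M: salg M using m by (intro salg_qcoord) auto

lemma m_cases: "m \<in> {r, k, r + k}" "r + k \<in> {r, k, r + k}"
  using m by auto

lemma iota_superalg: "superalgebra_hom M C \<iota>"
  by (rule iota_props(1)[OF ms C.salg_axioms])

lemma iota_alg: "alg_hom M C \<iota>"
  using iota_superalg by (simp add: superalgebra_hom_iff)

lemma iota_lin: "linear_on M C \<iota>"
  by (rule alg_hom_linear[OF iota_alg])

text \<open>The action formula combines columns of one row; the row enters through its parity only,
  and shifting a positive row keeps it positive. The common sign in front is cancelled at the
  end.\<close>

lemma iota_act_gen:
  assumes i: "i \<in> {1..int m}" and abc: "a \<in> idx n" "b \<in> idx n" "c \<in> idx n"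
  shows "\<iota> (\<Phi> m (Uq_L n a b) (qcoord_t m n i c)) = \<Phi> (r + k) (Uq_L n a b) (\<iota> (qcoord_t m n i c))"
proof -
  note gen = iota_props(2)[OF ms C.salg_axioms]
  let ?j = "int s + i"
  let ?K = "\<lambda>e. ksign ((ipar i + ipar e) * (ipar e + ipar c)) * Smat e c a b"
  let ?s = "ksign ((ipar a + ipar b) * (ipar i + ipar c)) :: Cq"
  have par: "ipar ?j = ipar i" using i by (simp add: ipar_def)
  have ii: "i \<in> idx m" "?j \<in> idx (r + k)" using i ms by (auto simp: idx_def)
  have t: "qcoord_t m n i e \<in> carrier M" "qcoord_t (r + k) n ?j e \<in> carrier C" if "e \<in> idx n" for e
    using that ii qcoord_t_closed by auto
  have cl: "\<Phi> m (Uq_L n a b) (qcoord_t m n i c) \<in> carrier M"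
    "\<Phi> (r + k) (Uq_L n a b) (qcoord_t (r + k) n ?j c) \<in> carrier C"
    using act_closed[OF m_cases(1)] act_closed[OF m_cases(2)] abc t by auto
  have "?s \<odot>\<^bsub>C\<^esub> \<iota> (\<Phi> m (Uq_L n a b) (qcoord_t m n i c)) = \<iota> (?s \<odot>\<^bsub>M\<^esub> \<Phi> m (Uq_L n a b) (qcoord_t m n i c))"
    using cl by (simp add: linear_on_smult[OF iota_lin])
  also have "?s \<odot>\<^bsub>M\<^esub> \<Phi> m (Uq_L n a b) (qcoord_t m n i c) = (\<Oplus>\<^bsub>M\<^esub>e\<in>idx n. ?K e \<odot>\<^bsub>M\<^esub> qcoord_t m n i e)"
    by (rule act_gen[OF m_cases(1) ii(1) abc(3,1,2)])
  also have "\<iota> \<dots> = (\<Oplus>\<^bsub>C\<^esub>e\<in>idx n. \<iota> (?K e \<odot>\<^bsub>M\<^esub> qcoord_t m n i e))"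
    using t by (intro linear_on_finsum[OF M.cmod_axioms C.cmod_axioms iota_lin]) auto
  also have "\<dots> = (\<Oplus>\<^bsub>C\<^esub>e\<in>idx n. ?K e \<odot>\<^bsub>C\<^esub> qcoord_t (r + k) n ?j e)"
    using t i by (intro C.finsum_cong') (auto simp: linear_on_smult[OF iota_lin] gen simp del: add_bit_eq_xor mult_bit_eq_and)
  also have "\<dots> = ?s \<odot>\<^bsub>C\<^esub> \<Phi> (r + k) (Uq_L n a b) (qcoord_t (r + k) n ?j c)"
    by (rule act_gen[OF m_cases(2) ii(2) abc(3,1,2), unfolded par, symmetric])
  finally show ?thesis
    using C.smult_cancel[OF _ cl(2) ksign_nonzero] linear_on_closed[OF iota_lin cl(1)] gen[OF i abc(3)] by simp
qed

text \<open>The indices stay quantified in the induction because the coproduct of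
  \<open>Uq_L n a b\<close> applies \<open>Uq_L n e b\<close> to the rest of the word for every
  \<open>e\<close>. Generators are homogeneous, so the product rule applies at each letter.\<close>

lemma iota_act_L:
  assumes "x \<in> carrier M"
  shows "\<forall>a\<in>idx n. \<forall>b\<in>idx n. a \<le> b \<longrightarrow> \<iota> (\<Phi> m (Uq_L n a b) x) = \<Phi> (r + k) (Uq_L n a b) (\<iota> x)"
  using assms
proof (induction rule: qcoord_induct)
  case one
  show ?case
    using act_unit[OF m_cases(1)] act_unit[OF m_cases(2)]
    by (simp add: alg_hom_one[OF iota_alg] linear_on_smult[OF iota_lin])
next
  case (mult i c y)
  show ?case
  proof (intro ballI impI)
    fix a b assume ab: "a \<in> idx n" "b \<in> idx n" "a \<le> b"
    let ?t = "qcoord_t m n i c" and ?d = "ipar i + ipar c"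
    let ?K = "\<lambda>c. ksign ((ipar a + ipar c) * (ipar c + ipar b)) * ksign (?d * (ipar c + ipar b)) :: Cq"
    have t: "?t \<in> homog M ?d" using mult qcoord_t_homog pos_idx by blast
    then have tc: "?t \<in> carrier M" by blast
    have it: "\<iota> ?t \<in> homog C ?d" using t iota_superalg unfolding superalgebra_hom_iff by blast
    have ic: "\<iota> y \<in> carrier C" "\<iota> ?t \<in> carrier C" using linear_on_closed[OF iota_lin] mult(3) tc by auto
    have cl: "\<Phi> m (Uq_L n a e) ?t \<in> carrier M" "\<Phi> m (Uq_L n e b) y \<in> carrier M"
      "\<Phi> (r + k) (Uq_L n a e) (\<iota> ?t) \<in> carrier C" "\<Phi> (r + k) (Uq_L n e b) (\<iota> y) \<in> carrier C"
      if "e \<in> idx n" for e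
      using act_closed[OF m_cases(1)] act_closed[OF m_cases(2)] ab that tc mult(3) ic by auto
    \<comment> \<open>The induction hypothesis covers \<open>e \<le> b\<close>; for larger
      \<open>e\<close> the generator is zero and so are both sides.\<close>
    have IH: "\<iota> (\<Phi> m (Uq_L n e b) y) = \<Phi> (r + k) (Uq_L n e b) (\<iota> y)" if "e \<in> idx n" for e
    proof (cases "e \<le> b")
      case True
      then show ?thesis using mult.IH ab that by blast
    next
      case False
      then have z: "Uq_L n e b = \<zero>\<^bsub>U\<^esub>" by (intro Uq_L_zero) simp
      show ?thesis
        unfolding z linear_on_zero[OF U.cmod_axioms M.cmod_axioms act_linear_left[OF m_cases(1) mult(3)]]
          linear_on_zero[OF U.cmod_axioms C.cmod_axioms act_linear_left[OF m_cases(2) ic(1)]]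
        by (rule linear_on_zero[OF M.cmod_axioms C.cmod_axioms iota_lin])
    qed
    have "\<iota> (\<Phi> m (Uq_L n a b) (?t \<otimes>\<^bsub>M\<^esub> y)) =
        (\<Oplus>\<^bsub>C\<^esub>e\<in>idx n. \<iota> (?K e \<odot>\<^bsub>M\<^esub> (\<Phi> m (Uq_L n a e) ?t \<otimes>\<^bsub>M\<^esub> \<Phi> m (Uq_L n e b) y)))"
      unfolding act_L_prod[OF m_cases(1) ab t mult(3)]
      using cl by (intro linear_on_finsum[OF M.cmod_axioms C.cmod_axioms iota_lin]) auto
    also have "\<dots> = (\<Oplus>\<^bsub>C\<^esub>e\<in>idx n. ?K e \<odot>\<^bsub>C\<^esub> (\<Phi> (r + k) (Uq_L n a e) (\<iota> ?t) \<otimes>\<^bsub>C\<^esub> \<Phi> (r + k) (Uq_L n e b) (\<iota> y)))"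
      using cl iota_act_gen[OF mult(1) ab(1) _ mult(2)] IH
      by (intro C.finsum_cong')
        (auto simp: linear_on_smult[OF iota_lin] alg_hom_mult[OF iota_alg] simp del: add_bit_eq_xor mult_bit_eq_and)
    also have "\<dots> = \<Phi> (r + k) (Uq_L n a b) (\<iota> ?t \<otimes>\<^bsub>C\<^esub> \<iota> y)"
      by (rule act_L_prod[OF m_cases(2) ab it ic(1), symmetric])
    finally show "\<iota> (\<Phi> m (Uq_L n a b) (?t \<otimes>\<^bsub>M\<^esub> y)) = \<Phi> (r + k) (Uq_L n a b) (\<iota> (?t \<otimes>\<^bsub>M\<^esub> y))"
      using tc mult(3) by (simp add: alg_hom_mult[OF iota_alg])
  qed
next
  case (add x y)
  then show ?case
    using act_closed[OF m_cases(1)] linear_on_closed[OF iota_lin]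
    by (simp add: linear_on_add[OF iota_lin] linear_on_add[OF act_linear_right[OF m_cases(1)]]
        linear_on_add[OF act_linear_right[OF m_cases(2)]])
next
  case (smult c x)
  then show ?case
    using act_closed[OF m_cases(1)] linear_on_closed[OF iota_lin]
    by (simp add: linear_on_smult[OF iota_lin] linear_on_smult[OF act_linear_right[OF m_cases(1)]]
        linear_on_smult[OF act_linear_right[OF m_cases(2)]])
qed

lemma iota_act:
  assumes u: "u \<in> carrier U" and x: "x \<in> carrier M"
  shows "\<iota> (\<Phi> m u x) = \<Phi> (r + k) u (\<iota> x)"
proof -
  have ic: "\<iota> x \<in> carrier C" if "x \<in> carrier M" for x using linear_on_closed[OF iota_lin that] .
  note cl = act_closed[OF m_cases(1)]
  from u have "\<forall>x\<in>carrier M. \<iota> (\<Phi> m u x) = \<Phi> (r + k) u (\<iota> x)"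
  proof (induction rule: Uq_induct)
    case one
    show ?case using ic by (simp add: act_one[OF m_cases(1)] act_one[OF m_cases(2)])
  next
    case (mult i j v)
    then show ?case using ic cl iota_act_L
      by (simp add: act_mult[OF m_cases(1)] act_mult[OF m_cases(2)])
  next
    case (add u v)
    then show ?case using ic cl
      by (simp add: linear_on_add[OF act_linear_left[OF m_cases(1)]] linear_on_add[OF act_linear_left[OF m_cases(2)]]
        linear_on_add[OF iota_lin])
  next
    case (smult c u)
    then show ?case using ic cl
      by (simp add: linear_on_smult[OF act_linear_left[OF m_cases(1)]] linear_on_smult[OF act_linear_left[OF m_cases(2)]]
        linear_on_smult[OF iota_lin])
  qed
  then show ?thesis using x by blast
qed

end

abbreviation "act \<equiv> tensor_action U \<Delta> A (\<Phi> r) B (\<Phi> k)"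

text \<open>The product rule in \<open>C\<close> concerns a homogeneous left factor, and
  \<open>tensor_action\<close> splits \<open>x\<close> accordingly: for each parity the
  corresponding summand becomes the action on one product, and the two add up to the action on the
  whole.\<close>

lemma \<sigma>_act:
  assumes u: "u \<in> carrier U" and Z: "Z \<in> carrier T"
  shows "act u Z \<in> carrier T" "\<sigma> (act u Z) = \<Phi> (r + k) u (\<sigma> Z)"
proof -
  have mm: "r \<in> {r, k, r + k}" "k \<in> {r, k, r + k}" "r + k \<in> {r, k, r + k}" by auto
  let ?h = "\<lambda>x y u1 u2 d. tens A B (\<Phi> r u1 (hcomp A d x)) (\<Phi> k (koszul_twist U d u2) y)"
  let ?g = "\<lambda>x y u1 u2. \<Oplus>\<^bsub>T\<^esub>d\<in>UNIV. ?h x y u1 u2 d"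
  have D: "act u Z = tensor_lift T (\<lambda>x y. tensor_lift T (?g x y) (\<Delta> u)) Z"
    by (simp add: tensor_action_def Let_def)
  have bits: "(UNIV :: bit set) = {0, 1}" using bit_cases by auto
  have h: "?h x y u1 u2 d \<in> carrier T"
    if "x \<in> carrier A" "y \<in> carrier B" "u1 \<in> carrier U" "u2 \<in> carrier U" for x y u1 u2 d
    using that act_closed[OF mm(1)] act_closed[OF mm(2)] by simp
  have g: "?g x y u1 u2 \<in> carrier T" "\<sigma> (?g x y u1 u2) =
      (\<Phi> (r + k) u1 (\<iota>A (hcomp A 0 x)) \<otimes>\<^bsub>C\<^esub> \<Phi> (r + k) (koszul_twist U 0 u2) (\<iota>B y))
      \<oplus>\<^bsub>C\<^esub> (\<Phi> (r + k) u1 (\<iota>A (hcomp A 1 x)) \<otimes>\<^bsub>C\<^esub> \<Phi> (r + k) (koszul_twist U 1 u2) (\<iota>B y))"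
    if xy: "x \<in> carrier A" "y \<in> carrier B" and u12: "u1 \<in> carrier U" "u2 \<in> carrier U" for x y u1 u2
  proof -
    have e: "?g x y u1 u2 = ?h x y u1 u2 0 \<oplus>\<^bsub>T\<^esub> ?h x y u1 u2 1"
      using h[OF xy u12] AB.T.finsum_insert[of "{1}" 0 "?h x y u1 u2"] AB.T.finsum_insert[of "{}" 1 "?h x y u1 u2"]
      unfolding bits by simp
    then show "?g x y u1 u2 \<in> carrier T" using h[OF xy u12] by simp
    have "\<sigma> (?h x y u1 u2 d) = \<Phi> (r + k) u1 (\<iota>A (hcomp A d x)) \<otimes>\<^bsub>C\<^esub> \<Phi> (r + k) (koszul_twist U d u2) (\<iota>B y)" for d
      using xy u12 act_closed[OF mm(1)] act_closed[OF mm(2)] iota_act[of r k] iota_act[of k 0]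
      by (simp add: \<sigma>_tens)
    then show "\<sigma> (?g x y u1 u2) =
      (\<Phi> (r + k) u1 (\<iota>A (hcomp A 0 x)) \<otimes>\<^bsub>C\<^esub> \<Phi> (r + k) (koszul_twist U 0 u2) (\<iota>B y))
      \<oplus>\<^bsub>C\<^esub> (\<Phi> (r + k) u1 (\<iota>A (hcomp A 1 x)) \<otimes>\<^bsub>C\<^esub> \<Phi> (r + k) (koszul_twist U 1 u2) (\<iota>B y))"
      unfolding e using h[OF xy u12] by (simp add: linear_on_add[OF \<sigma>_linear])
  qed
  note \<Delta>u = \<Delta>_closed[OF u]
  have gl: "tensor_lift T (?g x y) (\<Delta> u) \<in> carrier T" if "x \<in> carrier A" "y \<in> carrier B" for x y
    by (rule UU.tensor_lift_closed[OF T_cmod g(1)[OF that] \<Delta>u])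
  show "act u Z \<in> carrier T"
    unfolding D by (rule AB.tensor_lift_closed[OF T_cmod gl Z])
  let ?p = "\<lambda>x y d u1 u2. \<Phi> (r + k) u1 (\<iota>A (hcomp A d x)) \<otimes>\<^bsub>C\<^esub> \<Phi> (r + k) (koszul_twist U d u2) (\<iota>B y)"
  have \<sigma>gl: "\<sigma> (tensor_lift T (?g x y) (\<Delta> u)) = \<Phi> (r + k) u (\<iota>A x \<otimes>\<^bsub>C\<^esub> \<iota>B y)"
    if xy: "x \<in> carrier A" "y \<in> carrier B" for x y
  proof -
    \<comment> \<open>\<open>\<iota>A\<close> preserves parity, so each component of
      \<open>x\<close> gives a homogeneous left factor in \<open>C\<close>.\<close>
    have hc: "\<iota>A (hcomp A d x) \<in> homog C d" for d
      using A.hcomp_decomp(1)[OF xy(1)] \<iota>A_hom unfolding superalgebra_hom_iff by blast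
    have pc: "?p x y d u1 u2 \<in> carrier C" if "u1 \<in> carrier U" "u2 \<in> carrier U" for d u1 u2
      using that xy act_closed[OF mm(3)] C.homog_closed[OF hc] by simp
    have pd: "tensor_lift C (?p x y d) (\<Delta> u) = \<Phi> (r + k) u (\<iota>A (hcomp A d x) \<otimes>\<^bsub>C\<^esub> \<iota>B y)" for d
      using xy by (intro act_prod[OF mm(3) u hc, symmetric]) simp
    have "\<sigma> (tensor_lift T (?g x y) (\<Delta> u)) = tensor_lift C (\<lambda>u1 u2. \<sigma> (?g x y u1 u2)) (\<Delta> u)"
      by (rule UU.tensor_lift_compose[OF T_cmod g(1)[OF xy] C.cmod_axioms \<sigma>_linear \<Delta>u])
    also have "\<dots> = tensor_lift C (\<lambda>u1 u2. ?p x y 0 u1 u2 \<oplus>\<^bsub>C\<^esub> ?p x y 1 u1 u2) (\<Delta> u)"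
      using pc by (intro UU.tensor_lift_cong[OF C.cmod_axioms _ g(2)[OF xy] \<Delta>u]) simp
    also have "\<dots> = tensor_lift C (?p x y 0) (\<Delta> u) \<oplus>\<^bsub>C\<^esub> tensor_lift C (?p x y 1) (\<Delta> u)"
      by (rule UU.tensor_lift_fun_add[OF C.cmod_axioms pc pc \<Delta>u])
    also have "\<dots> = \<Phi> (r + k) u ((\<iota>A (hcomp A 0 x) \<oplus>\<^bsub>C\<^esub> \<iota>A (hcomp A 1 x)) \<otimes>\<^bsub>C\<^esub> \<iota>B y)"
      unfolding pd using C.homog_closed[OF hc] xy
      by (simp add: C.l_distr linear_on_add[OF act_linear_right[OF mm(3) u]])
    also have "\<iota>A (hcomp A 0 x) \<oplus>\<^bsub>C\<^esub> \<iota>A (hcomp A 1 x) = \<iota>A x"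
      using A.hcomp_decomp(2)[OF xy(1)] linear_on_add[OF \<iota>A_linear] A.hcomp_closed[OF xy(1)] by metis
    finally show ?thesis .
  qed
  have "\<sigma> (act u Z) = tensor_lift C (\<lambda>x y. \<sigma> (tensor_lift T (?g x y) (\<Delta> u))) Z"
    unfolding D by (rule AB.tensor_lift_compose[OF T_cmod gl C.cmod_axioms \<sigma>_linear Z])
  also have "\<dots> = tensor_lift C (\<lambda>x y. \<Phi> (r + k) u (\<iota>A x \<otimes>\<^bsub>C\<^esub> \<iota>B y)) Z"
    using act_closed[OF mm(3) u] by (intro AB.tensor_lift_cong[OF C.cmod_axioms _ \<sigma>gl Z]) simp
  also have "\<dots> = \<Phi> (r + k) u (tensor_lift C (\<lambda>x y. \<iota>A x \<otimes>\<^bsub>C\<^esub> \<iota>B y) Z)"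
    using Z by (intro AB.tensor_lift_compose[OF C.cmod_axioms _ C.cmod_axioms act_linear_right[OF mm(3) u], symmetric]) simp_all
  finally show "\<sigma> (act u Z) = \<Phi> (r + k) u (\<sigma> Z)" by (simp add: sigma_def)
qed

end

section \<open>Transport of structure\<close>

text \<open>Every algebraic identity in \<open>S\<close> is tested after applying the injective
  \<open>f\<close>, where it holds in \<open>A\<close>. What \<open>S\<close> contributes is a
  module, closed operations and homogeneous parts that span it.\<close>

lemma transport_supermodule_superalgebra:
  fixes S :: "'s Cq_superalg" and A :: "'a Cq_superalg"
  assumes A: "supermodule_superalgebra U \<Delta> \<epsilon> A actA"
    and U: "cmod U" "\<And>u. u \<in> carrier U \<Longrightarrow> \<Delta> u \<in> carrier (tensor_space U U)"
      "\<And>d u. u \<in> carrier U \<Longrightarrow> koszul_twist U d u \<in> carrier U"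
    and Ualg: "\<one>\<^bsub>U\<^esub> \<in> carrier U" "\<And>u v. u \<in> carrier U \<Longrightarrow> v \<in> carrier U \<Longrightarrow> u \<otimes>\<^bsub>U\<^esub> v \<in> carrier U"
      "\<And>d. homog U d \<subseteq> carrier U"
    and S: "cmod S" and bij: "bij_betw f (carrier S) (carrier A)" and lin: "linear_on S A f"
    and mult: "\<And>x y. x \<in> carrier S \<Longrightarrow> y \<in> carrier S \<Longrightarrow> x \<otimes>\<^bsub>S\<^esub> y \<in> carrier S"
      "\<And>x y. x \<in> carrier S \<Longrightarrow> y \<in> carrier S \<Longrightarrow> f (x \<otimes>\<^bsub>S\<^esub> y) = f x \<otimes>\<^bsub>A\<^esub> f y"
    and one: "\<one>\<^bsub>S\<^esub> \<in> homog S 0" "f \<one>\<^bsub>S\<^esub> = \<one>\<^bsub>A\<^esub>"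
    and hom: "\<And>d. homog S d \<subseteq> carrier S" "\<And>d. f ` homog S d \<subseteq> homog A d"
      "\<And>x. x \<in> carrier S \<Longrightarrow> \<exists>y\<in>homog S 0. \<exists>z\<in>homog S 1. x = y \<oplus>\<^bsub>S\<^esub> z"
    and act: "\<And>u x. u \<in> carrier U \<Longrightarrow> x \<in> carrier S \<Longrightarrow> actS u x \<in> carrier S"
      "\<And>u x. u \<in> carrier U \<Longrightarrow> x \<in> carrier S \<Longrightarrow> f (actS u x) = actA u (f x)"
  shows "supermodule_superalgebra_iso U \<Delta> \<epsilon> S actS A actA f"
proof -
  interpret A: salg A using A by (intro salg.intro) (simp add: supermodule_superalgebra_def)
  interpret S: cmod S by (rule S)
  interpret U: cmod U by (rule U(1))
  interpret UU: tensor_pair U U by (intro tensor_pair.intro U.cmod_axioms)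
  note cl [simp, intro] = linear_on_closed[OF lin]
  note add = linear_on_add[OF lin] and smult = linear_on_smult[OF lin]
  have zero: "f \<zero>\<^bsub>S\<^esub> = \<zero>\<^bsub>A\<^esub>" by (rule linear_on_zero[OF S A.cmod_axioms lin])
  have eqI: "x = y" if "x \<in> carrier S" "y \<in> carrier S" "f x = f y" for x y
    using bij that by (simp add: bij_betw_def inj_onD[of f "carrier S"])
  have one_closed [simp]: "\<one>\<^bsub>S\<^esub> \<in> carrier S" using one(1) hom(1) by blast
  note mult_closed [simp] = mult(1) and act_closed [simp] = act(1)
  \<comment> \<open>Decompose \<open>x\<close> in \<open>S\<close> and compare components of
    \<open>f x\<close> in \<open>A\<close>: the part of the wrong parity is mapped to zero, hence is
    zero. The grading of \<open>S\<close> is thus the full preimage of that of \<open>A\<close>, and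
    its directness follows.\<close>
  have homog_iff: "x \<in> homog S d \<longleftrightarrow> x \<in> carrier S \<and> f x \<in> homog A d" for x d
  proof
    assume "x \<in> homog S d"
    then show "x \<in> carrier S \<and> f x \<in> homog A d"
      using subsetD[OF hom(1)] subsetD[OF hom(2) imageI] by simp
  next
    assume x: "x \<in> carrier S \<and> f x \<in> homog A d"
    from hom(3)[OF conjunct1[OF x]] obtain y z
      where yz: "y \<in> homog S 0" "z \<in> homog S 1" "x = y \<oplus>\<^bsub>S\<^esub> z" by (elim bexE)
    have c: "y \<in> carrier S" "z \<in> carrier S" using yz subsetD[OF hom(1)] by simp_all
    have h: "f y \<in> homog A 0" "f z \<in> homog A 1" using yz subsetD[OF hom(2) imageI] by simp_all
    have fx: "f y \<oplus>\<^bsub>A\<^esub> f z = f x" unfolding yz(3) by (rule add[OF c, symmetric])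
    have fxA: "f x \<in> homog A d" "f x \<in> carrier A" using x cl by blast+
    show "x \<in> homog S d"
    proof (cases "d = 0")
      case True
      have "f z = \<zero>\<^bsub>A\<^esub>"
        by (rule A.homog_decomp_unique(2)[OF h fxA(1)[unfolded True] A.homog_zero]) (simp only: fx A.r_zero fxA)
      then have "z = \<zero>\<^bsub>S\<^esub>" by (intro eqI c S.zero_closed) (simp only: zero)
      then show ?thesis using yz c True by simp
    next
      case False
      then have d: "d = 1" using bit_cases by blast
      have "f y = \<zero>\<^bsub>A\<^esub>"
        by (rule A.homog_decomp_unique(1)[OF h A.homog_zero fxA(1)[unfolded d]]) (simp only: fx A.l_zero fxA)
      then have "y = \<zero>\<^bsub>S\<^esub>" by (intro eqI c S.zero_closed) (simp only: zero)
      then show ?thesis using yz c d by simp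
    qed
  qed
  have mod: "module Cq_ring S" by (rule S.is_module)
  have superspace: "superspace S"
    unfolding superspace_def
  proof (intro conjI allI ballI mod)
    show "submodule (homog S d) Cq_ring S" for d
    proof (rule module.submoduleI[OF mod hom(1)])
      show "\<ominus>\<^bsub>S\<^esub> a \<in> homog S d" if "a \<in> homog S d" for a
        using that A.homog_smult[of "f a" d "- 1"] S.smult_minus_one[of a]
        by (metis S.smult_closed homog_iff smult)
    qed (auto simp: homog_iff zero add smult)
    fix x assume "x \<in> carrier S"
    then obtain y z where yz: "y \<in> homog S 0" "z \<in> homog S 1" "x = y \<oplus>\<^bsub>S\<^esub> z" using hom(3) by blast
    have "y' = y \<and> z' = z" if "y' \<in> homog S 0" "z' \<in> homog S 1" "x = y' \<oplus>\<^bsub>S\<^esub> z'" for y' z'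
    proof -
      have h: "y \<in> carrier S" "f y \<in> homog A 0" "z \<in> carrier S" "f z \<in> homog A 1"
        "y' \<in> carrier S" "f y' \<in> homog A 0" "z' \<in> carrier S" "f z' \<in> homog A 1"
        using yz that by (auto simp: homog_iff)
      have "f y' \<oplus>\<^bsub>A\<^esub> f z' = f y \<oplus>\<^bsub>A\<^esub> f z"
        using yz(3) that(3) add h by metis
      then show ?thesis
        using A.homog_decomp_unique[OF h(6,8,2,4)] eqI h by blast
    qed
    then show "\<exists>!(y, z). y \<in> homog S 0 \<and> z \<in> homog S 1 \<and> x = y \<oplus>\<^bsub>S\<^esub> z"
      using yz by (intro ex1I[of _ "(y, z)"]) auto
  qed
  have ring: "ring S"
  proof (rule ringI[OF S.abelian_group_axioms])
    show "Group.monoid S"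
      by (rule monoidI) (auto intro!: eqI simp: mult(2) one(2) A.m_assoc)
  qed (auto intro!: eqI simp: mult(2) add A.l_distr A.r_distr)
  have alg: "superalgebra S"
    unfolding superalgebra_def
    using superspace ring one(1)
    by (auto intro!: eqI simp: mult(2) smult A.smult_mult_left A.smult_mult_right homog_iff A.mult_homog simp del: add_bit_eq_xor)
  have modA: "supermodule U A actA" using A by (simp add: supermodule_superalgebra_def)
  have mA: "actA u x \<in> carrier A" "y \<in> carrier A \<Longrightarrow> actA u (x \<oplus>\<^bsub>A\<^esub> y) = actA u x \<oplus>\<^bsub>A\<^esub> actA u y"
    "v \<in> carrier U \<Longrightarrow> actA (u \<oplus>\<^bsub>U\<^esub> v) x = actA u x \<oplus>\<^bsub>A\<^esub> actA v x"
    "actA u (c \<odot>\<^bsub>A\<^esub> x) = c \<odot>\<^bsub>A\<^esub> actA u x" "actA (c \<odot>\<^bsub>U\<^esub> u) x = c \<odot>\<^bsub>A\<^esub> actA u x"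
    "v \<in> carrier U \<Longrightarrow> actA (u \<otimes>\<^bsub>U\<^esub> v) x = actA u (actA v x)"
    if "u \<in> carrier U" "x \<in> carrier A" for u v x y c
    using modA that by (simp_all add: supermodule_def)
  have mod: "supermodule U S actS"
    unfolding supermodule_def
  proof (intro conjI ballI allI superspace)
    fix u x assume u: "u \<in> carrier U" and x: "x \<in> carrier S"
    note fx = cl[OF x]
    show "actS u x \<in> carrier S" by (rule act(1)[OF u x])
    show "actS u (c \<odot>\<^bsub>S\<^esub> x) = c \<odot>\<^bsub>S\<^esub> actS u x" for c
      by (rule eqI) (use u x fx in \<open>simp_all add: act(2) smult mA\<close>)
    show "actS (c \<odot>\<^bsub>U\<^esub> u) x = c \<odot>\<^bsub>S\<^esub> actS u x" for c
      by (rule eqI) (use u x fx in \<open>simp_all add: act(2) smult mA\<close>)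
    show "actS u (x \<oplus>\<^bsub>S\<^esub> y) = actS u x \<oplus>\<^bsub>S\<^esub> actS u y" if "y \<in> carrier S" for y
      by (rule eqI) (use that u x fx in \<open>simp_all add: act(2) add mA\<close>)
    show "actS (u \<oplus>\<^bsub>U\<^esub> v) x = actS u x \<oplus>\<^bsub>S\<^esub> actS v x" if "v \<in> carrier U" for v
      by (rule eqI) (use that u x fx in \<open>simp_all add: act(2) add mA\<close>)
    show "actS (u \<otimes>\<^bsub>U\<^esub> v) x = actS u (actS v x)" if "v \<in> carrier U" for v
      by (rule eqI) (use that u x fx in \<open>simp_all add: act(2) mA Ualg(2)\<close>)
  next
    fix x assume "x \<in> carrier S"
    then show "actS \<one>\<^bsub>U\<^esub> x = x"
      using modA by (intro eqI) (simp_all add: act(2) Ualg(1) supermodule_def)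
  next
    fix d e u x assume u: "u \<in> homog U d" and x: "x \<in> homog S e"
    have "actA u (f x) \<in> homog A (d + e)" "u \<in> carrier U"
      using modA u x Ualg(3) by (auto simp: supermodule_def homog_iff simp del: add_bit_eq_xor)
    then show "actS u x \<in> homog S (d + e)" using x by (simp add: homog_iff act(2) del: add_bit_eq_xor)
  qed
  have "actS u (a \<otimes>\<^bsub>S\<^esub> b) = tensor_lift S (\<lambda>u1 u2. actS u1 a \<otimes>\<^bsub>S\<^esub> actS (koszul_twist U d u2) b) (\<Delta> u)"
    if u: "u \<in> carrier U" and ad: "a \<in> homog S d" and b: "b \<in> carrier S" for u a b d
  proof (rule eqI)
    have a: "a \<in> carrier S" "f a \<in> homog A d" using ad by (auto simp: homog_iff)
    have c: "actS u1 a \<otimes>\<^bsub>S\<^esub> actS (koszul_twist U d u2) b \<in> carrier S" if "u1 \<in> carrier U" "u2 \<in> carrier U" for u1 u2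
      using that a b U(3) by simp
    show "actS u (a \<otimes>\<^bsub>S\<^esub> b) \<in> carrier S" using u a b by simp
    show "tensor_lift S (\<lambda>u1 u2. actS u1 a \<otimes>\<^bsub>S\<^esub> actS (koszul_twist U d u2) b) (\<Delta> u) \<in> carrier S"
      by (rule UU.tensor_lift_closed[OF S c U(2)[OF u]])
    \<comment> \<open>Being linear, \<open>f\<close> passes through the lift and converts the
      product rule to be shown into the one known in \<open>A\<close>.\<close>
    have "f (tensor_lift S (\<lambda>u1 u2. actS u1 a \<otimes>\<^bsub>S\<^esub> actS (koszul_twist U d u2) b) (\<Delta> u)) =
        tensor_lift A (\<lambda>u1 u2. f (actS u1 a \<otimes>\<^bsub>S\<^esub> actS (koszul_twist U d u2) b)) (\<Delta> u)"
      by (rule UU.tensor_lift_compose[OF S c A.cmod_axioms lin U(2)[OF u]])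
    also have "\<dots> = tensor_lift A (\<lambda>u1 u2. actA u1 (f a) \<otimes>\<^bsub>A\<^esub> actA (koszul_twist U d u2) (f b)) (\<Delta> u)"
      using a b U(3) by (intro UU.tensor_lift_cong[OF A.cmod_axioms _ _ U(2)[OF u]]) (auto simp: mult(2) act(2) mA(1))
    also have "\<dots> = actA u (f a \<otimes>\<^bsub>A\<^esub> f b)"
      using A u a b by (simp add: supermodule_superalgebra_def)
    also have "\<dots> = f (actS u (a \<otimes>\<^bsub>S\<^esub> b))"
      using u a b by (simp add: act(2) mult(2))
    finally show "f (actS u (a \<otimes>\<^bsub>S\<^esub> b)) =
        f (tensor_lift S (\<lambda>u1 u2. actS u1 a \<otimes>\<^bsub>S\<^esub> actS (koszul_twist U d u2) b) (\<Delta> u))" by simp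
  qed
  moreover have "actS u \<one>\<^bsub>S\<^esub> = \<epsilon> u \<odot>\<^bsub>S\<^esub> \<one>\<^bsub>S\<^esub>" if "u \<in> carrier U" for u
    by (rule eqI) (use A that in \<open>simp_all add: act(2) smult one(2) supermodule_superalgebra_def\<close>)
  ultimately have "supermodule_superalgebra U \<Delta> \<epsilon> S actS"
    using alg mod unfolding supermodule_superalgebra_def by blast
  moreover have "alg_hom S A f"
    using lin mult(2) one(2) by (intro alg_homI)
  ultimately show ?thesis
    unfolding supermodule_superalgebra_iso_def supermodule_hom_def superalgebra_hom_iff even_linear_map_iff
    using A lin hom(2) act(2) bij by blast
qed

context braided_data
begin

lemma \<sigma>_iso: "supermodule_superalgebra_iso U \<Delta> \<epsilon> D act C (\<Phi> (r + k)) \<sigma>"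
proof (rule transport_supermodule_superalgebra)
  interpret UA: calg U by (rule calg_Uq)
  show "\<one>\<^bsub>U\<^esub> \<in> carrier U" "\<And>u v. u \<in> carrier U \<Longrightarrow> v \<in> carrier U \<Longrightarrow> u \<otimes>\<^bsub>U\<^esub> v \<in> carrier U"
    by simp_all
  show "supermodule_superalgebra U \<Delta> \<epsilon> C (\<Phi> (r + k))" by (rule smodalg) simp
  \<comment> \<open>\<open>D\<close> differs from \<open>T\<close> in its multiplication only, so
    the module axioms are copied.\<close>
  have "abelian_group D"
  proof (rule abelian_groupI)
    show "\<exists>y\<in>carrier D. y \<oplus>\<^bsub>D\<^esub> x = \<zero>\<^bsub>D\<^esub>" if "x \<in> carrier D" for x
      using AB.T.l_neg AB.T.a_inv_closed that unfolding braided_tensor_sel by blast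
  qed (auto simp: braided_tensor_sel AB.T.a_ac)
  then have "module Cq_ring D"
    by (rule moduleI[OF cring_from_type_algebra])
      (auto simp: braided_tensor_sel AB.T.smult_add_left AB.T.smult_add_right AB.T.smult_smult)
  then show "cmod D" by (rule cmod.intro)
  show "homog U d \<subseteq> carrier U" for d using U.homog_closed by blast
  show "\<one>\<^bsub>D\<^esub> \<in> homog D 0"
    using tens_homog[OF A.one_homog B.one_homog] by (simp add: braided_tensor_sel AB.tensor_space_sel(2))
  show "\<sigma> \<one>\<^bsub>D\<^esub> = \<one>\<^bsub>C\<^esub>"
    by (simp add: braided_tensor_sel AB.tensor_space_sel(2) \<sigma>_one)
  show "linear_on D C \<sigma>"
    using \<sigma>_linear by (simp add: linear_on_def braided_tensor_sel)
  show "homog D d \<subseteq> carrier D" for d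
    unfolding braided_tensor_sel by (rule homog_T_subset)
  show "\<sigma> ` homog D d \<subseteq> homog C d" for d
    unfolding braided_tensor_sel by (rule \<sigma>_even)
  show "\<exists>y\<in>homog D 0. \<exists>z\<in>homog D 1. x = y \<oplus>\<^bsub>D\<^esub> z" if "x \<in> carrier D" for x
    using homog_T_decomp that unfolding braided_tensor_sel .
  show "bij_betw \<sigma> (carrier D) (carrier C)"
    unfolding braided_tensor_sel by (rule \<sigma>_bij)
  show "x \<otimes>\<^bsub>D\<^esub> y \<in> carrier D" "\<sigma> (x \<otimes>\<^bsub>D\<^esub> y) = \<sigma> x \<otimes>\<^bsub>C\<^esub> \<sigma> y" if "x \<in> carrier D" "y \<in> carrier D" for x y
    using braided_mult that unfolding braided_tensor_sel by blast+
  show "act u x \<in> carrier D" "\<sigma> (act u x) = \<Phi> (r + k) u (\<sigma> x)" if "u \<in> carrier U" "x \<in> carrier D" for u x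
    using \<sigma>_act that unfolding braided_tensor_sel by blast+
qed (use U.cmod_axioms in simp_all)

end

theorem theorem3p5:
  fixes r k n :: nat
    and \<Delta> :: "(int \<times> int) free_alg set
          \<Rightarrow> ((int \<times> int) free_alg set \<times> (int \<times> int) free_alg set \<Rightarrow>\<^sub>0 Cq) set"
    and \<epsilon> :: "(int \<times> int) free_alg set \<Rightarrow> Cq"
    and \<Phi> :: "nat \<Rightarrow> (int \<times> int) free_alg set \<Rightarrow> (int \<times> int) free_alg set \<Rightarrow> (int \<times> int) free_alg set"
    and \<Theta> :: "((int \<times> int) free_alg set \<times> (int \<times> int) free_alg set \<Rightarrow>\<^sub>0 Cq) set
          \<Rightarrow> ((int \<times> int) free_alg set \<times> (int \<times> int) free_alg set \<Rightarrow>\<^sub>0 Cq) set"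
  assumes "r > 0" and "k > 0" and "n > 0"
    and "Uq_coproduct n \<Delta>" and "Uq_counit n \<epsilon>"
    and "\<And>m. m \<in> {r, k, r + k} \<Longrightarrow> qcoord_action m n \<Delta> \<epsilon> (\<Phi> m)"
    and "braiding_operator r k n \<Delta> (\<Phi> r) (\<Phi> k) \<Theta>"
  shows "(\<forall>x\<in>carrier (qcoord r n). \<forall>y\<in>carrier (qcoord k n).
            sigma r k n (tens (qcoord r n) (qcoord k n) x y) =
              iota n r (r + k) k x \<otimes>\<^bsub>qcoord (r + k) n\<^esub> iota n k (r + k) 0 y) \<and>
         supermodule_superalgebra_iso (Uq n) \<Delta> \<epsilon>
           (braided_tensor (qcoord r n) (qcoord k n) \<Theta>)
           (tensor_action (Uq n) \<Delta> (qcoord r n) (\<Phi> r) (qcoord k n) (\<Phi> k))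
           (qcoord (r + k) n) (\<Phi> (r + k))
           (sigma r k n)"
proof -
  interpret braided_data r k n \<Delta> \<epsilon> \<Phi> \<Theta>
    by (rule braided_data.intro) (fact assms)+
  show ?thesis using \<sigma>_tens \<sigma>_iso by blast
qed

end
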